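(* Let $\theta,d\in\mathbb{R}$ with $d\neq0$, and consider the isolated eigenvalues $c$ given by the zeros in $\mathbb{C}\setminus[-1,1]$ of $c\mapsto E(c;\theta,d)$ (that is, zeros other than $c=0$), counted with multiplicity. \begin{itemize} \item When $(\theta,d)$ is in region 0 there are no eigenvalues. \item When $(\theta,d)$ is in region I there is a pair of purely imaginary eigenvalues (and no others). \item When $(\theta,d)$ is in region II there are $4$ eigenvalues: either two purely imaginary pairs, a single purely imaginary pair with multiplicity $2$, or a complex quadruplet. \item On the boundary between region I and region II there is a pair of purely imaginary eigenvalues (and no others). \end{itemize} In all cases half of the eigenvalues are unstable.
   Context: For $c\in\mathbb{C}\setminus[-1,1]$ let $s=s(c)$ be the unique solution of $c=\frac12(s+\frac1s)$ with $|s|<1$. Put $\kappa=-\frac{1+s^2}{1-s^2}$, $g_0=1+\kappa$, and $g_k=\kappa\, i^k s^{|k|}$ for $k\in\mathbb{Z}\setminus\{0\}$; these are the Fourier coefficients of $Q(\eta)=\frac{\sin\eta}{c+\sin\eta}$. The Hill determinant is the bi-infinite determinant $$D(\Lambda)=\det\left(\frac{\tilde g_{n-m}}{\Lambda-n^2}+\delta_{n,m}\right)_{n,m\in\mathbb{Z}},\qquad \tilde g_0=0,\ \tilde g_k=g_k\ (k\neq0),$$ understood as the limit of the determinants of the truncations to $|n|,|m|\le N$ as $N\to\infty$. Define $$E(c;\theta,d)=-2+2\cos(2\pi\theta)+4D(g_0-d^2)\sin^2\!\left(\pi\sqrt{g_0-d^2}\right),$$ where at points with $g_0-d^2=n^2$,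 $n\in\mathbb{Z}$, the product $D\sin^2$ is defined by continuity. Regions: consider the circles $(\theta+l)^2+d^2=1$, $l\in\mathbb{Z}$, in the $(\theta,d)$-plane. A point is in region 0 if it is outside all circles, in region I if it is contained inside exactly one circle (and on none), and in region II if it is contained inside exactly two circles. A point is on the boundary between region I and region II if it lies on exactly one of the circles and inside exactly one other. A pair means $\{c,-c\}$; a complex quadruplet means $\{c,-c,\bar c,-\bar c\}$ with $c$ neither real nor purely imaginary. For wave number $k\neq0$ the eigenvalue $c$ corresponds to the temporal eigenvalue $\lambda=-ikc$ of the linearised Euler equations; it is unstable if $\mathrm{Re}\,\lambda>0$ (equivalently, for $k>0$, $\mathrm{Im}\,c>0$). *)

theory Defs
  imports "HOL-Complex_Analysis.Complex_Analysis" "Jordan_Normal_Form.Determinant"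
begin

definition cut :: "complex set" where
  "cut = complex_of_real ` {-1..1}"

definition s_of :: "complex \<Rightarrow> complex" where
  "s_of c = (THE s. c = (s + 1 / s) / 2 \<and> norm s < 1)"

(* The g c k below are the Fourier coefficients of sin \<eta> / (c + sin \<eta>). The junk value
   1 / 0 = 0 in s_of matters only for c = 0, which lies on the cut. *)
definition kappa :: "complex \<Rightarrow> complex" where
  "kappa c = - ((1 + (s_of c)\<^sup>2) / (1 - (s_of c)\<^sup>2))"

definition g :: "complex \<Rightarrow> int \<Rightarrow> complex" where
  "g c k = (if k = 0 then 1 + kappa c
            else kappa c * \<i> powi k * s_of c ^ nat \<bar>k\<bar>)"

definition g_tilde :: "complex \<Rightarrow> int \<Rightarrow> complex" where
  "g_tilde c k = (if k = 0 then 0 else g c k)"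

(* Jordan_Normal_Form matrices are indexed from 0; entry (i,j) here stands for
   (n,m) = (i - N, j - N), so that n and m range over -N..N. *)
definition hill_matrix :: "complex \<Rightarrow> complex \<Rightarrow> nat \<Rightarrow> complex mat" where
  "hill_matrix c \<Lambda> N = mat (2 * N + 1) (2 * N + 1) (\<lambda>(i, j).
     let n = int i - int N; m = int j - int N
     in g_tilde c (n - m) / (\<Lambda> - (of_int n)\<^sup>2) + (if n = m then 1 else 0))"

definition hill_det :: "complex \<Rightarrow> complex \<Rightarrow> complex" where
  "hill_det c \<Lambda> = lim (\<lambda>N. Determinant.det (hill_matrix c \<Lambda> N))"

(* The product D(\<Lambda>) sin^2(pi sqrt \<Lambda>), extended by continuity in \<Lambda> to the squares
   of integers.  The choice of the branch of the root is immaterial, as sin^2 is even. *)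
definition hill_sin2 :: "complex \<Rightarrow> complex \<Rightarrow> complex" where
  "hill_sin2 c \<Lambda> =
     (if \<exists>n::int. \<Lambda> = (of_int n)\<^sup>2
      then Lim (at \<Lambda>) (\<lambda>z. hill_det c z * (sin (of_real pi * csqrt z))\<^sup>2)
      else hill_det c \<Lambda> * (sin (of_real pi * csqrt \<Lambda>))\<^sup>2)"

definition E :: "complex \<Rightarrow> real \<Rightarrow> real \<Rightarrow> complex" where
  "E c \<theta> d = - 2 + 2 * of_real (cos (2 * pi * \<theta>)) + 4 * hill_sin2 c (g c 0 - (of_real d)\<^sup>2)"

definition eigenvalues :: "real \<Rightarrow> real \<Rightarrow> complex set" where
  "eigenvalues \<theta> d = {c. c \<notin> cut \<and> E c \<theta> d = 0}"

definition mult :: "real \<Rightarrow> real \<Rightarrow> complex \<Rightarrow> int" where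
  "mult \<theta> d c = zorder (\<lambda>z. E z \<theta> d) c"

definition inside_circles :: "real \<Rightarrow> real \<Rightarrow> int set" where
  "inside_circles \<theta> d = {l. (\<theta> + of_int l)\<^sup>2 + d\<^sup>2 < 1}"

definition on_circles :: "real \<Rightarrow> real \<Rightarrow> int set" where
  "on_circles \<theta> d = {l. (\<theta> + of_int l)\<^sup>2 + d\<^sup>2 = 1}"

definition region_0 :: "real \<Rightarrow> real \<Rightarrow> bool" where
  "region_0 \<theta> d \<longleftrightarrow> (\<forall>l::int. (\<theta> + of_int l)\<^sup>2 + d\<^sup>2 > 1)"

definition region_I :: "real \<Rightarrow> real \<Rightarrow> bool" where
  "region_I \<theta> d \<longleftrightarrow> card (inside_circles \<theta> d) = 1 \<and> on_circles \<theta> d = {}"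

definition region_II :: "real \<Rightarrow> real \<Rightarrow> bool" where
  "region_II \<theta> d \<longleftrightarrow> card (inside_circles \<theta> d) = 2"

definition boundary_I_II :: "real \<Rightarrow> real \<Rightarrow> bool" where
  "boundary_I_II \<theta> d \<longleftrightarrow> card (on_circles \<theta> d) = 1 \<and> card (inside_circles \<theta> d) = 1"

definition pair :: "complex \<Rightarrow> complex set" where
  "pair c = {c, - c}"

definition quadruplet :: "complex \<Rightarrow> complex set" where
  "quadruplet c = {c, - c, cnj c, - cnj c}"

definition purely_imaginary :: "complex \<Rightarrow> bool" where
  "purely_imaginary c \<longleftrightarrow> Re c = 0 \<and> c \<noteq> 0"

definition one_imaginary_pair :: "real \<Rightarrow> real \<Rightarrow> int \<Rightarrow> bool" where
  "one_imaginary_pair \<theta> d \<mu> \<longleftrightarrow>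
     (\<exists>c. purely_imaginary c \<and> eigenvalues \<theta> d = pair c \<and> (\<forall>z\<in>pair c. mult \<theta> d z = \<mu>))"

definition two_imaginary_pairs :: "real \<Rightarrow> real \<Rightarrow> bool" where
  "two_imaginary_pairs \<theta> d \<longleftrightarrow>
     (\<exists>c c'. purely_imaginary c \<and> purely_imaginary c' \<and> pair c \<inter> pair c' = {} \<and>
        eigenvalues \<theta> d = pair c \<union> pair c' \<and> (\<forall>z\<in>pair c \<union> pair c'. mult \<theta> d z = 1))"

definition one_complex_quadruplet :: "real \<Rightarrow> real \<Rightarrow> bool" where
  "one_complex_quadruplet \<theta> d \<longleftrightarrow>
     (\<exists>c. Re c \<noteq> 0 \<and> Im c \<noteq> 0 \<and> eigenvalues \<theta> d = quadruplet c \<and>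
        (\<forall>z\<in>quadruplet c. mult \<theta> d z = 1))"

(* The eigenvalue c at wave number k is the temporal eigenvalue -i k c of the linearised
   Euler equations. *)
definition unstable :: "real \<Rightarrow> complex \<Rightarrow> bool" where
  "unstable k c \<longleftrightarrow> Re (- \<i> * of_real k * c) > 0"

definition num_eigenvalues :: "real \<Rightarrow> real \<Rightarrow> int" where
  "num_eigenvalues \<theta> d = (\<Sum>c\<in>eigenvalues \<theta> d. mult \<theta> d c)"

definition num_unstable :: "real \<Rightarrow> real \<Rightarrow> real \<Rightarrow> int" where
  "num_unstable k \<theta> d = (\<Sum>c\<in>{c \<in> eigenvalues \<theta> d. unstable k c}. mult \<theta> d c)"

end

theory Submission
  imports Defs "HOL-Real_Asymp.Real_Asymp"
begin

text \<open>
Let s = s(c) and z = s^2, so that z runs through the unit disc. The coefficients g_k = \<kappa> i^k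
s^|k| form a geometric kernel: multiplying the truncated Hill matrix on either side by a unit
bidiagonal matrix makes it tridiagonal, and its determinant becomes a continuant, that is, a
solution of a three-term recurrence. The limit of the truncations then gives E(c; \<theta>, d) = -4
(sin^2(\<pi>\<theta>) + K(z)), where K is holomorphic in the disc and does not depend on \<theta>
(hill_sin2_eq, E_eq).

The same continuants, with the weights \<rho>_n = 1 - 1/((x+n)^2 + d^2), have a two-sided limit that
is periodic in x, has simple poles only at the points of \<plusminus>id + \<int>, and is bounded
towards \<plusminus>i\<infinity>. Liouville's theorem determines it up to one constant, whence
sin^2(\<pi>\<theta>) + K(z) = (1-z) (sin^2(\<pi>\<theta>) + sinh^2(\<pi>d)) W(z) with W the
two-sided limit at x = \<theta> (theta_dependence). A zero of W gives a solution of 2 c y_n =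
\<rho>_n (y_{n-1} + y_{n+1}) that decays in both directions. Here \<rho>_n is negative exactly when
(\<theta>, d) lies inside the circle with index n, and at most two circles contain the point.

Upper bounds. If y and y' are decaying solutions for c and c', and c is not the conjugate of c',
then the sum of y_n times the conjugate of y'_n over \<rho>_n vanishes. The solutions with Im c > 0
therefore span a neutral subspace of a Hermitian form whose number of negative squares is the number
of circles around the point, and a neutral subspace cannot have larger dimension (eigvec_card_le).
This counts zeros without multiplicity; a zero of order n splits into n simple zeros when \<theta>
is moved a little, so the bound also holds for the total order (zero_order_sum_le).

Existence. At z = 0 the function is positive. In region I and on the boundary between I and II it is
negative near z = -1, which gives a zero in (-1,0). In region II one moves \<theta> from that
boundary inwards: the set of \<theta> that admit a zero is open because K is an open map, and it is
closed because no zero can tend to the unit circle (no_zero_reaches_circle). Indeed the limit would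
be a decaying solution with c in [-1,1]; an energy estimate excludes |c| < 1, and comparison with
the explicit sequence 1/(x+n) excludes c = 1 and c = -1. Since K is real on the real axis, zeros
come in conjugate pairs, and a simple real zero in region II forces a second real one because the
function is then positive near z = -1 as well.

Finally c and -c correspond to the same z, real z in (-1,0) to imaginary c, and the multiplicity of
c equals the order of the zero z (mult_eq_zero_order).
\<close>

section \<open>Continuants and their limits\<close>

text \<open>
The determinant of the n by n tridiagonal matrix with diagonal entries 1 + z in which the products
of opposite off-diagonal entries are z r_i r_{i+1}. For r = 1 it is the geometric sum 1 + z + ... +
z^n.
\<close>

fun continuant :: "'a::comm_ring_1 \<Rightarrow> (nat \<Rightarrow> 'a) \<Rightarrow> nat \<Rightarrow> 'a" where
  "continuant z r 0 = 1"
| "continuant z r (Suc 0) = 1 + z"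
| "continuant z r (Suc (Suc n)) = (1 + z) * continuant z r (Suc n) - z * r n * r (Suc n) * continuant z r n"

abbreviation (input) shift :: "nat \<Rightarrow> (nat \<Rightarrow> 'a) \<Rightarrow> nat \<Rightarrow> 'a" where
  "shift m r \<equiv> \<lambda>n. r (n + m)"

lemma continuant_cong:
  "(\<And>i. i < n \<Longrightarrow> r i = r' i) \<Longrightarrow> continuant z r n = continuant z r' n"
  by (induction z r n rule: continuant.induct) auto

text \<open>
Laplace expansion along the cut between two blocks of rows: only the two entries that couple the
blocks contribute the second term.
\<close>

lemma continuant_split:
  "continuant z r (Suc m + Suc n) = continuant z r (Suc m) * continuant z (shift (Suc m) r) (Suc n)
     - z * r m * r (Suc m) * continuant z r m * continuant z (shift (Suc (Suc m)) r) n"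
proof (induction n rule: less_induct)
  case (less n)
  consider "n = 0" | "n = Suc 0" | k where "n = Suc (Suc k)"
    by (metis not0_implies_Suc)
  then show ?case
  proof cases
    case 3
    have a: "continuant z r (Suc m + Suc k) = continuant z r (Suc m) * continuant z (shift (Suc m) r) (Suc k)
     - z * r m * r (Suc m) * continuant z r m * continuant z (shift (Suc (Suc m)) r) k"
      using less.IH[of k] 3 by simp
    have b: "continuant z r (Suc m + Suc (Suc k)) = continuant z r (Suc m) * continuant z (shift (Suc m) r) (Suc (Suc k))
     - z * r m * r (Suc m) * continuant z r m * continuant z (shift (Suc (Suc m)) r) (Suc k)"
      using less.IH[of "Suc k"] 3 by simp
    have "continuant z r (Suc m + Suc n) = (1 + z) * continuant z r (Suc m + Suc (Suc k))
       - z * r (Suc m + Suc k) * r (Suc (Suc m + Suc k)) * continuant z r (Suc m + Suc k)"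
      using 3 by simp
    then show ?thesis unfolding a b using 3 by (simp add: algebra_simps)
  qed (simp_all add: algebra_simps)
qed

lemma continuant_jost_left:
  "continuant z r (Suc (Suc n)) = (1 + z) * continuant z (shift 1 r) (Suc n) - z * r 0 * r 1 * continuant z (shift 2 r) n"
  using continuant_split[of z r 0 n] by (simp add: numeral_2_eq_2)

lemma continuant_reverse: "continuant z (\<lambda>i. r (n - 1 - i)) n = continuant z r n"
proof (induction n arbitrary: r rule: less_induct)
  case (less n)
  consider "n = 0" | "n = Suc 0" | k where "n = Suc (Suc k)"
    by (metis not0_implies_Suc)
  then show ?case
  proof cases
    case 3
    have 1: "continuant z (shift 1 (\<lambda>i. r (n - 1 - i))) (Suc k) = continuant z r (Suc k)"
      using less.IH[of "Suc k" r] 3 by simp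
    have 2: "continuant z (shift 2 (\<lambda>i. r (n - 1 - i))) k = continuant z r k"
    proof -
      have "continuant z (shift 2 (\<lambda>i. r (n - 1 - i))) k = continuant z (\<lambda>i. r (k - 1 - i)) k"
        using 3 by (intro continuant_cong) (auto intro!: arg_cong[where f = r])
      then show ?thesis using less.IH[of k r] 3 by simp
    qed
    show ?thesis using 1 2 3 continuant_jost_left[of z "\<lambda>i. r (n - 1 - i)" k] by simp
  qed simp_all
qed

lemma continuant_of_real:
  "continuant (of_real z) (\<lambda>i. of_real (r i)) n = (of_real (continuant z r n) :: 'a::{real_algebra_1,comm_ring_1})"
  by (induction z r n rule: continuant.induct) simp_all

lemma continuant_cnj: "continuant (cnj z) (\<lambda>i. cnj (r i)) n = cnj (continuant z r n)"
  by (induction z r n rule: continuant.induct) simp_all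

lemma continuant_unperturbed: "(1 - z) * continuant z (\<lambda>_. 1) n = 1 - z ^ Suc n"
proof (induction n rule: less_induct)
  case (less n)
  consider "n = 0" | "n = Suc 0" | k where "n = Suc (Suc k)"
    by (metis not0_implies_Suc)
  then show ?case
  proof cases
    case 3
    have "(1 - z) * continuant z (\<lambda>_. 1) n = (1 + z) * ((1 - z) * continuant z (\<lambda>_. 1) (Suc k)) - z * ((1 - z) * continuant z (\<lambda>_. 1) k)"
      using 3 by (simp add: algebra_simps)
    also have "\<dots> = (1 + z) * (1 - z ^ Suc (Suc k)) - z * (1 - z ^ Suc k)"
      using less.IH[of k] less.IH[of "Suc k"] 3 by simp
    finally show ?thesis using 3 by (simp add: algebra_simps)
  qed (simp_all add: algebra_simps)
qed

text \<open>
Quadratic decay of 1 - r makes all sums below converge. The constant is fixed so that bounds are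
uniform over the whole class; 16 suffices for 1 - r_n = 1/((x+n+1)^2 + d^2) when |Re x| is at most
3/4, since then |x+n+1| is at least (n+1)/4.
\<close>

definition admissible :: "(nat \<Rightarrow> complex) \<Rightarrow> bool" where
  "admissible r \<longleftrightarrow> (\<forall>n. norm (1 - r n) \<le> 16 / (real n + 1)^2)"

lemma admissible_shift: "admissible r \<Longrightarrow> admissible (shift m r)"
  unfolding admissible_def
proof (intro allI)
  fix n assume r: "\<forall>n. norm (1 - r n) \<le> 16 / (real n + 1)^2"
  have "norm (1 - r (n + m)) \<le> 16 / (real (n+m) + 1)^2" using r by blast
  also have "\<dots> \<le> 16 / (real n + 1)^2"
    by (intro divide_left_mono power_mono mult_pos_pos) auto
  finally show "norm (1 - r (n + m)) \<le> 16 / (real n + 1)^2" .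
qed

lemma admissible_tendsto: "admissible r \<Longrightarrow> r \<longlonglongrightarrow> 1"
proof -
  assume a: "admissible r"
  have "(\<lambda>n. 16 / (real n + 1)^2) \<longlonglongrightarrow> 0" by real_asymp
  then have "(\<lambda>n. r n - 1) \<longlonglongrightarrow> 0"
    by (rule Lim_null_comparison[rotated]) (use a in \<open>auto simp: admissible_def norm_minus_commute\<close>)
  then show ?thesis by (simp add: LIM_zero_iff)
qed

text \<open>
The majorant of |1 - r_n r_{n+1}| for admissible r: 288 = 16 + 17 * 16, where 17 bounds |r_n|.
\<close>

definition defect :: "nat \<Rightarrow> real" where
  "defect n = 288 / (real n + 1)^2"

lemma defect_nonneg: "defect n \<ge> 0" by (simp add: defect_def)

lemma defect_summable: "summable defect"
proof -
  have "summable (\<lambda>n. inverse (real (Suc n) ^ 2))"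
    by (subst summable_Suc_iff) (rule inverse_power_summable, simp)
  then have "summable (\<lambda>n. 288 * inverse (real (Suc n) ^ 2))" by (rule summable_mult)
  then show ?thesis unfolding defect_def by (simp add: field_simps)
qed

lemma admissible_defect:
  assumes "admissible r"
  shows "norm (1 - r n * r (Suc n)) \<le> defect n"
proof -
  have 1: "norm (1 - r n) \<le> 16 / (real n + 1)^2" "norm (1 - r (Suc n)) \<le> 16 / (real (Suc n) + 1)^2"
    using assms unfolding admissible_def by blast+
  have 2: "16 / (real (Suc n) + 1)^2 \<le> 16 / (real n + 1)^2"
    by (intro divide_left_mono power_mono mult_pos_pos) auto
  have 3: "16 / (real n + 1)^2 \<le> 16" by (simp add: divide_le_eq) 
  have "norm (r n) \<le> 17"
    using norm_triangle_ineq2[of "r n" 1] 1(1) 3 by (simp add: norm_minus_commute)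
  moreover have eq: "1 - r n * r (Suc n) = (1 - r n) + r n * (1 - r (Suc n))" by (simp add: algebra_simps)
  moreover have "norm (r n * (1 - r (Suc n))) \<le> 17 * (16 / (real n + 1)^2)"
    unfolding norm_mult using calculation 1(2) 2 by (intro mult_mono) auto
  ultimately have "norm (1 - r n * r (Suc n)) \<le> 16 / (real n + 1)^2 + 17 * (16 / (real n + 1)^2)"
    using 1(1) norm_triangle_ineq[of "1 - r n" "r n * (1 - r (Suc n))"] unfolding eq by linarith
  then show ?thesis by (simp add: defect_def)
qed

text \<open>
The name refers to the Jost function of scattering theory: up to a power of s and a product of
weights this is the solution that decays along the half-line, evaluated at its end.
\<close>

definition jost :: "complex \<Rightarrow> (nat \<Rightarrow> complex) \<Rightarrow> complex" where
  "jost z r = lim (continuant z r)"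

lemma continuant_increment:
  "continuant z r (Suc (Suc n)) - continuant z r (Suc n) =
     z * (continuant z r (Suc n) - continuant z r n) + z * (1 - r n * r (Suc n)) * continuant z r n"
  by (simp add: algebra_simps)

text \<open>
In the unperturbed recurrence the increments shrink by the factor z in each step, so a discrete
Gronwall argument for the value and its increment together gives a bound that is uniform in n and in
the class of admissible weights.
\<close>

lemma continuant_bound:
  assumes "norm z \<le> R" "R < 1" "admissible r"
  shows "norm (continuant z r n) \<le> (1 + 1 / (1 - R)) * exp (2 / (1 - R) * suminf defect)"
proof -
  \<comment> \<open>The weight q of the increment satisfies q R = q - 1: one unperturbed step does not increase S.\<close>
  define q where "q = 1 / (1 - R)"
  have R: "0 \<le> R" using assms(1) norm_ge_zero order_trans by blast
  have q1: "q \<ge> 1" using R assms(2) by (simp add: q_def)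
  define S where "S n = norm (continuant z r n) + q * norm (continuant z r (Suc n) - continuant z r n)" for n
  have S0: "S n \<ge> 0" for n unfolding S_def using q1 by simp
  have step: "S (Suc n) \<le> S n * (1 + 2 * q * defect n)" for n
  proof -
    define D where "D = norm (continuant z r (Suc n) - continuant z r n)"
    define T where "T = norm (continuant z r n)"
    have "norm (continuant z r (Suc (Suc n)) - continuant z r (Suc n)) \<le> R * D + R * defect n * T"
      unfolding continuant_increment
      by (rule order_trans[OF norm_triangle_ineq])
         (auto simp: norm_mult D_def T_def intro!: add_mono mult_mono assms admissible_defect R mult_nonneg_nonneg defect_nonneg)
    then have 1: "q * norm (continuant z r (Suc (Suc n)) - continuant z r (Suc n)) \<le> q * (R * D + R * defect n * T)"
      using q1 by (intro mult_left_mono) auto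
    have 2: "norm (continuant z r (Suc n)) \<le> T + D"
      using norm_triangle_ineq[of "continuant z r n" "continuant z r (Suc n) - continuant z r n"] by (simp add: T_def D_def)
    have qR: "q * R = q - 1" using assms(2) by (simp add: q_def field_simps)
    have D0: "D \<ge> 0" and T0: "T \<ge> 0" by (auto simp: D_def T_def)
    have "S (Suc n) \<le> T + D + q * (R * D + R * defect n * T)"
      using 1 2 by (simp add: S_def)
    also have "\<dots> = T + q * D + (q - 1) * defect n * T"
    proof -
      have "q * (R * D) = (q - 1) * D" "q * (R * defect n * T) = (q - 1) * defect n * T"
        using qR by (simp_all flip: mult.assoc)
      then show ?thesis by (simp add: algebra_simps)
    qed
    also have "\<dots> \<le> (T + q * D) + 2 * q * defect n * (T + q * D)"
    proof -
      have "(q - 1) * defect n * T \<le> 2 * q * defect n * (T + q * D)"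
        using q1 D0 T0 defect_nonneg[of n] by (intro mult_mono mult_nonneg_nonneg) auto
      then show ?thesis by simp
    qed
    finally show ?thesis by (simp add: S_def T_def D_def algebra_simps)
  qed
  have "S n \<le> S 0 * exp (2 * q * sum defect {..<n})" for n
  proof (induction n)
    case (Suc n)
    have "S (Suc n) \<le> S n * (1 + 2 * q * defect n)" by (rule step)
    also have "\<dots> \<le> S n * exp (2 * q * defect n)"
      using S0 exp_ge_add_one_self by (intro mult_left_mono) auto
    also have "\<dots> \<le> S 0 * exp (2 * q * sum defect {..<n}) * exp (2 * q * defect n)"
      using Suc by (intro mult_right_mono) auto
    finally show ?case by (simp add: exp_add[symmetric] algebra_simps)
  qed simp
  also have "S 0 * exp (2 * q * sum defect {..<n}) \<le> (1 + q) * exp (2 * q * suminf defect)" for n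
  proof (intro mult_mono)
    show "S 0 \<le> 1 + q" using q1 assms(1,2) by (simp add: S_def mult_left_le)
    show "exp (2 * q * sum defect {..<n}) \<le> exp (2 * q * suminf defect)"
      using q1 sum_le_suminf[OF defect_summable, of "{..<n}"] defect_nonneg by (simp add: mult_left_mono)
  qed (use q1 in auto)
  finally have "S n \<le> (1 + q) * exp (2 * q * suminf defect)" .
  moreover have "norm (continuant z r n) \<le> S n" using q1 by (simp add: S_def)
  ultimately show ?thesis by (simp add: q_def)
qed

text \<open>
Uniformity over all admissible weights at once is what lets limits in the weights be exchanged with
the limit in n, and gives holomorphy in any parameter on which they depend.
\<close>

lemma continuant_uniform_limit:
  assumes "R < 1"
  shows "uniform_limit {(z, r). norm z \<le> R \<and> admissible r} (\<lambda>n (z, r). continuant z r n) (\<lambda>(z, r). jost z r) sequentially"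
proof (cases "0 \<le> R")
  case False
  then have "\<not> norm z \<le> R" for z :: complex
    using norm_ge_zero order_trans by blast
  then show ?thesis by (simp add: uniform_limit_iff)
next
  case R: True
  define B where "B = (1 + 1 / (1 - R)) * exp (2 / (1 - R) * suminf defect)"
  have B: "B \<ge> 0" using R assms by (simp add: B_def)
  have cb: "norm (continuant z r n) \<le> B" if "norm z \<le> R" "admissible r" for z r n
    unfolding B_def by (rule continuant_bound) (use that assms in auto)
  \<comment> \<open>M solves the linear recursion that the bound on the increments obeys.\<close>
  define M where "M n = R ^ Suc n + (\<Sum>j<n. R ^ (n - j) * (B * defect j))" for n
  have Mrec: "M (Suc n) = R * M n + R * (B * defect n)" for n
  proof -
    have "(\<Sum>j<n. R ^ (Suc n - j) * (B * defect j)) = R * (\<Sum>j<n. R ^ (n - j) * (B * defect j))"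
      by (auto simp: sum_distrib_left Suc_diff_le mult.assoc intro!: sum.cong)
    then show ?thesis by (simp add: M_def algebra_simps)
  qed
  have bound: "norm (continuant z r (Suc n) - continuant z r n) \<le> M n" if "norm z \<le> R" "admissible r" for z r n
  proof (induction n)
    case 0 then show ?case using that by (simp add: M_def)
  next
    case (Suc n)
    have "norm (continuant z r (Suc (Suc n)) - continuant z r (Suc n)) \<le> R * M n + R * defect n * B"
      unfolding continuant_increment
      by (rule order_trans[OF norm_triangle_ineq])
         (use Suc that cb in \<open>auto simp: norm_mult intro!: add_mono mult_mono assms admissible_defect R mult_nonneg_nonneg defect_nonneg\<close>)
    then show ?case by (simp add: Mrec algebra_simps)
  qed
  have sM: "summable M"
  proof -
    have M0: "M n \<ge> 0" for n
      using R B defect_nonneg by (auto simp: M_def intro!: add_nonneg_nonneg sum_nonneg mult_nonneg_nonneg)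
    have "(\<Sum>i<n. M i) \<le> (R + B * suminf defect) / (1 - R)" for n
    proof -
      have "(\<Sum>i<Suc n. M i) = M 0 + (\<Sum>i<n. R * M i + R * (B * defect i))"
        by (subst sum.lessThan_Suc_shift) (simp add: Mrec)
      also have "\<dots> \<le> R + R * (\<Sum>i<n. M i) + B * suminf defect"
      proof -
        have "R * (B * (\<Sum>i<n. defect i)) \<le> 1 * (B * suminf defect)"
          using R B assms defect_nonneg sum_le_suminf[OF defect_summable, of "{..<n}"]
          by (intro mult_mono mult_nonneg_nonneg sum_nonneg) auto
        moreover have "M 0 = R" by (simp add: M_def)
        moreover have "(\<Sum>i<n. R * M i + R * (B * defect i)) = R * (\<Sum>i<n. M i) + R * (B * (\<Sum>i<n. defect i))"
          by (simp add: sum.distrib flip: sum_distrib_left)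
        ultimately show ?thesis by simp
      qed
      finally have "(\<Sum>i<Suc n. M i) \<le> R + R * (\<Sum>i<n. M i) + B * suminf defect" .
      moreover have "R * (\<Sum>i<n. M i) \<le> R * (\<Sum>i<Suc n. M i)"
        using M0 R by (intro mult_left_mono) auto
      ultimately have *: "(\<Sum>i<Suc n. M i) \<le> R + R * (\<Sum>i<Suc n. M i) + B * suminf defect"
        by linarith
      then have "(\<Sum>i<Suc n. M i) \<le> (R + B * suminf defect) / (1 - R)"
        using assms by (simp add: field_simps)
      then show ?thesis using M0[of n] by simp
    qed
    then show ?thesis using M0 by (intro summableI_nonneg_bounded) auto
  qed
  have "uniform_limit {(z, r). norm z \<le> R \<and> admissible r} (\<lambda>n p. \<Sum>i<n. (case p of (z, r) \<Rightarrow> continuant z r (Suc i) - continuant z r i))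
      (\<lambda>p. \<Sum>i. (case p of (z, r) \<Rightarrow> continuant z r (Suc i) - continuant z r i)) sequentially"
    by (rule Weierstrass_m_test[OF _ sM]) (use bound in auto)
  then have *: "uniform_limit {(z, r). norm z \<le> R \<and> admissible r} (\<lambda>n (z, r). continuant z r n - 1)
      (\<lambda>p. \<Sum>i. (case p of (z, r) \<Rightarrow> continuant z r (Suc i) - continuant z r i)) sequentially"
    by (simp add: case_prod_unfold sum_lessThan_telescope)
  have **: "uniform_limit {(z, r). norm z \<le> R \<and> admissible r} (\<lambda>n (z, r). continuant z r n)
      (\<lambda>p. 1 + (\<Sum>i. (case p of (z, r) \<Rightarrow> continuant z r (Suc i) - continuant z r i))) sequentially"
    using uniform_limit_add[OF uniform_limit_const[where c = "\<lambda>_. 1"] *] by (simp add: case_prod_unfold)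
  have eq: "jost z r = 1 + (\<Sum>i. continuant z r (Suc i) - continuant z r i)" if "norm z \<le> R" "admissible r" for z r
  proof -
    have "(\<lambda>n. continuant z r n) \<longlonglongrightarrow> 1 + (\<Sum>i. continuant z r (Suc i) - continuant z r i)"
      using tendsto_uniform_limitI[OF **, of "(z, r)"] that by simp
    then show ?thesis unfolding jost_def by (rule limI)
  qed
  show ?thesis
    by (rule uniform_limit_cong'[THEN iffD1, OF _ _ **]) (auto simp: eq)
qed

lemma continuant_tendsto_jost:
  assumes "norm z < 1" "admissible r"
  shows "continuant z r \<longlonglongrightarrow> jost z r"
  using tendsto_uniform_limitI[OF continuant_uniform_limit[OF assms(1)], of "(z, r)"] assms by simp

lemma jost_rec:
  assumes "norm z < 1" "admissible r"
  shows "jost z r = (1 + z) * jost z (shift 1 r) - z * r 0 * r 1 * jost z (shift 2 r)"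
proof -
  have "(\<lambda>n. continuant z r (Suc (Suc n))) \<longlonglongrightarrow> (1 + z) * jost z (shift 1 r) - z * r 0 * r 1 * jost z (shift 2 r)"
    unfolding continuant_jost_left using assms
    by (intro tendsto_intros LIMSEQ_Suc continuant_tendsto_jost admissible_shift)
  moreover have "(\<lambda>n. continuant z r (Suc (Suc n))) \<longlonglongrightarrow> jost z r"
    using assms by (intro LIMSEQ_Suc continuant_tendsto_jost)
  ultimately show ?thesis using LIMSEQ_unique by blast
qed

lemma continuant_fun_uniform_limit:
  assumes "R < 1" "\<And>p. p \<in> X \<Longrightarrow> norm (z p) \<le> R" "\<And>p. p \<in> X \<Longrightarrow> admissible (r p)"
  shows "uniform_limit X (\<lambda>n p. continuant (z p) (r p) n) (\<lambda>p. jost (z p) (r p)) sequentially"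
  using uniform_limit_compose'[OF continuant_uniform_limit[OF assms(1)], of "\<lambda>p. (z p, r p)" X] assms(2,3)
  by (simp add: case_prod_unfold Pi_def)

text \<open>
Pointwise convergence of the weights suffices because the limit in n is uniform over the admissible
class.
\<close>

lemma jost_tendsto_1:
  assumes z: "norm z < 1" and admissible: "eventually (\<lambda>p. admissible (r p)) F"
    and lim: "\<And>n. ((\<lambda>p. r p n) \<longlongrightarrow> 1) F" and F: "F \<noteq> bot"
  shows "((\<lambda>p. jost z (r p)) \<longlongrightarrow> 1 / (1 - z)) F"
proof -
  have z1: "1 - z \<noteq> 0" using z by auto
  have adm1: "admissible (\<lambda>_. 1)" by (simp add: admissible_def)
  have c1: "((\<lambda>p. continuant z (r p) n) \<longlongrightarrow> continuant z (\<lambda>_. 1) n) F" for n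
  proof (induction n rule: less_induct)
    case (less n)
    consider "n = 0" | "n = Suc 0" | k where "n = Suc (Suc k)"
      by (metis not0_implies_Suc)
    then show ?case
    proof cases
      case 3
      have "((\<lambda>p. (1 + z) * continuant z (r p) (Suc k) - z * r p k * r p (Suc k) * continuant z (r p) k)
         \<longlongrightarrow> (1 + z) * continuant z (\<lambda>_. 1) (Suc k) - z * 1 * 1 * continuant z (\<lambda>_. 1) k) F"
        using 3 by (intro tendsto_intros lim less.IH) auto
      then show ?thesis using 3 by simp
    qed simp_all
  qed
  have c2: "continuant z (\<lambda>_. 1) \<longlonglongrightarrow> 1 / (1 - z)"
  proof -
    have "(\<lambda>n. z ^ Suc n) \<longlonglongrightarrow> 0" using z LIMSEQ_power_zero LIMSEQ_Suc by blast
    then have "(\<lambda>n. (1 - z ^ Suc n) / (1 - z)) \<longlonglongrightarrow> (1 - 0) / (1 - z)"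
      using z1 by (intro tendsto_intros) auto
    moreover have "continuant z (\<lambda>_. 1) n = (1 - z ^ Suc n) / (1 - z)" for n
      using continuant_unperturbed[of z n] z1 by (simp add: field_simps)
    then have "continuant z (\<lambda>_. 1) = (\<lambda>n. (1 - z ^ Suc n) / (1 - z))" by blast
    ultimately show ?thesis by (simp only: diff_zero)
  qed
  have u: "uniform_limit {s. admissible s} (\<lambda>n s. continuant z s n) (\<lambda>s. jost z s) sequentially"
    by (rule continuant_fun_uniform_limit[OF z]) auto
  have F': "filtermap r F \<noteq> bot" using F by (simp add: filtermap_bot_iff)
  have "((\<lambda>s. jost z s) \<longlongrightarrow> 1 / (1 - z)) (filtermap r F)"
  proof (rule swap_uniform_limit')
    show "\<forall>\<^sub>F n in sequentially. ((\<lambda>s. continuant z s n) \<longlongrightarrow> continuant z (\<lambda>_. 1) n) (filtermap r F)"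
      using c1 by (simp add: filterlim_filtermap)
    show "(continuant z (\<lambda>_. 1) \<longlongrightarrow> 1 / (1 - z)) sequentially" by (rule c2)
    show "uniform_limit {s. admissible s} (\<lambda>n s. continuant z s n) (\<lambda>s. jost z s) sequentially" by (rule u)
    show "\<forall>\<^sub>F s in filtermap r F. s \<in> {s. admissible s}" using admissible by (simp add: eventually_filtermap)
  qed (use F' in auto)
  then show ?thesis by (simp add: filterlim_filtermap)
qed

lemma jost_holomorphic:
  assumes "open S" "\<And>p. p \<in> S \<Longrightarrow> norm (z p) < 1" "\<And>p. p \<in> S \<Longrightarrow> admissible (r p)"
    and z: "z holomorphic_on S" and r: "\<And>n. (\<lambda>p. r p n) holomorphic_on S"
  shows "(\<lambda>p. jost (z p) (r p)) holomorphic_on S"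
proof -
  have c: "(\<lambda>p. continuant (z p) (r p) n) holomorphic_on S" for n
  proof (induction n rule: less_induct)
    case (less n)
    consider "n = 0" | "n = Suc 0" | k where "n = Suc (Suc k)"
      by (metis not0_implies_Suc)
    then show ?case
    proof cases
      case 3
      then show ?thesis using less.IH[of k] less.IH[of "Suc k"] by (simp) (intro holomorphic_intros z r, auto)
    qed (auto intro!: holomorphic_intros z)
  qed
  show ?thesis
  proof (rule holomorphic_uniform_sequence[OF assms(1) c])
    fix x assume x: "x \<in> S"
    obtain d where d: "0 < d" "cball x d \<subseteq> S" using assms(1) x open_contains_cball by blast
    have cont_z: "continuous_on (cball x d) (\<lambda>p. norm (z p))"
      using holomorphic_on_imp_continuous_on[OF z] d continuous_on_subset by (intro continuous_intros) blast
    obtain p0 where p0: "p0 \<in> cball x d" "\<And>p. p \<in> cball x d \<Longrightarrow> norm (z p) \<le> norm (z p0)"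
      using continuous_attains_sup[OF compact_cball _ cont_z] d by auto
    have "uniform_limit (cball x d) (\<lambda>n p. continuant (z p) (r p) n) (\<lambda>p. jost (z p) (r p)) sequentially"
      by (rule continuant_fun_uniform_limit[of "norm (z p0)"]) (use p0 d assms(2,3) in auto)
    then show "\<exists>d. 0 < d \<and> cball x d \<subseteq> S \<and> uniform_limit (cball x d) (\<lambda>n p. continuant (z p) (r p) n) (\<lambda>p. jost (z p) (r p)) sequentially"
      using d by blast
  qed
qed

lemma jost_cnj:
  assumes "norm z < 1" "admissible r"
  shows "jost (cnj z) (\<lambda>i. cnj (r i)) = cnj (jost z r)"
proof -
  have "(\<lambda>n. cnj (continuant z r n)) \<longlonglongrightarrow> cnj (jost z r)"
    using continuant_tendsto_jost[OF assms] by (intro tendsto_intros)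
  then show ?thesis unfolding jost_def[of "cnj z"] by (intro limI) (simp add: continuant_cnj[abs_def])
qed

section \<open>Two-sided limits of continuants\<close>

text \<open>
The argument k is the first index that is used; right and left refer to the direction in which the
weights are read.
\<close>

definition jost_right :: "complex \<Rightarrow> (int \<Rightarrow> complex) \<Rightarrow> int \<Rightarrow> complex" where
  "jost_right z \<rho> k = jost z (\<lambda>n. \<rho> (k + int n))"

definition jost_left :: "complex \<Rightarrow> (int \<Rightarrow> complex) \<Rightarrow> int \<Rightarrow> complex" where
  "jost_left z \<rho> k = jost z (\<lambda>n. \<rho> (k - int n))"

text \<open>
The expansion of the continuant of a bi-infinite matrix around the row with index 0. It plays the
role of an Evans function: it vanishes when the solutions decaying to the left and to the right can
be glued together. The half-line limits start at the indices 1 and -1, so \<rho>_0 enters only as an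
explicit factor and may be arbitrarily large.
\<close>

definition evans :: "complex \<Rightarrow> (int \<Rightarrow> complex) \<Rightarrow> complex" where
  "evans z \<rho> = (1 + z) * jost_left z \<rho> (-1) * jost_right z \<rho> 1
     - z * \<rho> 0 * (\<rho> (-1) * jost_left z \<rho> (-2) * jost_right z \<rho> 1 + \<rho> 1 * jost_left z \<rho> (-1) * jost_right z \<rho> 2)"

definition admissible2 :: "(int \<Rightarrow> complex) \<Rightarrow> bool" where
  "admissible2 \<rho> \<longleftrightarrow> admissible (\<lambda>n. \<rho> (1 + int n)) \<and> admissible (\<lambda>n. \<rho> (-1 - int n))"

lemma admissible2_jost_right: "admissible2 \<rho> \<Longrightarrow> k \<ge> 1 \<Longrightarrow> admissible (\<lambda>n. \<rho> (k + int n))"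
  using admissible_shift[of "\<lambda>n. \<rho> (1 + int n)" "nat (k - 1)"] by (simp add: admissible2_def algebra_simps)

lemma admissible2_jost_left: "admissible2 \<rho> \<Longrightarrow> k \<le> -1 \<Longrightarrow> admissible (\<lambda>n. \<rho> (k - int n))"
  using admissible_shift[of "\<lambda>n. \<rho> (-1 - int n)" "nat (-1 - k)"] by (simp add: admissible2_def algebra_simps)

lemma jost_right_rec:
  assumes "norm z < 1" "admissible2 \<rho>" "k \<ge> 1"
  shows "jost_right z \<rho> k = (1 + z) * jost_right z \<rho> (k + 1) - z * \<rho> k * \<rho> (k + 1) * jost_right z \<rho> (k + 2)"
  using jost_rec[OF assms(1) admissible2_jost_right[OF assms(2,3)]] unfolding jost_right_def by (simp add: algebra_simps)

lemma jost_left_reflect: "jost_left z \<rho> k = jost_right z (\<lambda>n. \<rho> (- n)) (- k)"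
  by (simp add: jost_left_def jost_right_def)

lemma admissible2_reflect: "admissible2 \<rho> \<Longrightarrow> admissible2 (\<lambda>n. \<rho> (- n))"
  by (simp add: admissible2_def algebra_simps)

lemma jost_right_tendsto:
  assumes z: "norm z < 1" and a: "admissible2 \<rho>"
  shows "(\<lambda>k. jost_right z \<rho> (int k)) \<longlonglongrightarrow> 1 / (1 - z)"
  unfolding jost_right_def
proof (rule jost_tendsto_1[OF z])
  show "\<forall>\<^sub>F p in sequentially. admissible (\<lambda>n. \<rho> (int p + int n))"
    using eventually_ge_at_top[of 1] by eventually_elim (use admissible2_jost_right[OF a] in auto)
  show "(\<lambda>p. \<rho> (int p + int n)) \<longlonglongrightarrow> 1" for n
  proof -
    have "(\<lambda>p. \<rho> (1 + int p)) \<longlonglongrightarrow> 1"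
      using a admissible_tendsto by (simp add: admissible2_def)
    then have "(\<lambda>p. \<rho> (1 + int (p + n))) \<longlonglongrightarrow> 1" by (rule LIMSEQ_ignore_initial_segment)
    then have "(\<lambda>p. \<rho> (int (Suc p) + int n)) \<longlonglongrightarrow> 1" by (simp add: algebra_simps)
    then show ?thesis by (rule LIMSEQ_imp_Suc)
  qed
qed simp

text \<open>
The two ends of the window may move independently; this is needed to compare windows that are
shifted against each other, or that are shortened by one row at one end.
\<close>

lemma window_tendsto_evans:
  assumes z: "norm z < 1" and a: "admissible2 \<rho>"
    and M: "filterlim M at_top F" and N: "filterlim N at_top F"
  shows "((\<lambda>k. continuant z (\<lambda>i. \<rho> (int i - int (M k))) (M k + N k + 1)) \<longlongrightarrow> evans z \<rho>) F"
proof -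
  define Rc where "Rc j n = continuant z (\<lambda>i. \<rho> (j + int i)) n" for j n
  define Lc where "Lc j n = continuant z (\<lambda>i. \<rho> (j - int i)) n" for j n
  have Rl: "((\<lambda>k. Rc j (f k)) \<longlongrightarrow> jost_right z \<rho> j) F" if "j \<ge> 1" "filterlim f at_top F" for j f
    unfolding Rc_def jost_right_def
    by (rule filterlim_compose[OF continuant_tendsto_jost[OF z admissible2_jost_right[OF a that(1)]] that(2)])
  have Ll: "((\<lambda>k. Lc j (f k)) \<longlongrightarrow> jost_left z \<rho> j) F" if "j \<le> -1" "filterlim f at_top F" for j f
    unfolding Lc_def jost_left_def
    by (rule filterlim_compose[OF continuant_tendsto_jost[OF z admissible2_jost_left[OF a that(1)]] that(2)])
  have minus: "filterlim (\<lambda>k. f k - 1) at_top F" if "filterlim f at_top F" for f :: "_ \<Rightarrow> nat"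
    by (rule filterlim_compose[OF _ that]) (simp add: filterlim_minus_const_nat_at_top)
  have eq: "continuant z (\<lambda>i. \<rho> (int i - int m)) (m + n + 1) =
      Lc (-1) m * ((1 + z) * Rc 1 n - z * \<rho> 0 * \<rho> 1 * Rc 2 (n - 1)) - z * \<rho> (-1) * \<rho> 0 * Lc (-2) (m - 1) * Rc 1 n"
    if mn1: "m \<ge> 1" "n \<ge> 1" for m n
  proof -
    \<comment> \<open>The window is cut just before the row with index 0; the part to its left is read backwards.\<close>
    obtain m' n' where mn: "m = Suc m'" "n = Suc n'" using mn1 by (cases m; cases n) auto
    have rev: "Lc j k = continuant z (\<lambda>i. \<rho> (j - int k + 1 + int i)) k" for j k
    proof -
      have "continuant z (\<lambda>i. \<rho> (j - int k + 1 + int i)) k = continuant z (\<lambda>i. \<rho> (j - int k + 1 + int (k - 1 - i))) k"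
        using continuant_reverse[of z "\<lambda>i. \<rho> (j - int k + 1 + int i)" k] by simp
      also have "\<dots> = Lc j k" unfolding Lc_def by (intro continuant_cong) (auto simp: of_nat_diff intro!: arg_cong[where f = \<rho>])
      finally show ?thesis by simp
    qed
    have "continuant z (\<lambda>i. \<rho> (int i - int m)) (Suc m' + Suc (Suc n')) =
       continuant z (\<lambda>i. \<rho> (int i - int m)) (Suc m') * continuant z (\<lambda>i. \<rho> (int (i + Suc m') - int m)) (Suc (Suc n'))
       - z * \<rho> (int m' - int m) * \<rho> (int (Suc m') - int m) * continuant z (\<lambda>i. \<rho> (int i - int m)) m' * continuant z (\<lambda>i. \<rho> (int (i + Suc (Suc m')) - int m)) (Suc n')"
      by (rule continuant_split)
    also have "continuant z (\<lambda>i. \<rho> (int i - int m)) (Suc m') = Lc (-1) m"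
      unfolding rev mn by (intro continuant_cong arg_cong[where f = \<rho>]) auto
    also have "continuant z (\<lambda>i. \<rho> (int i - int m)) m' = Lc (-2) m'"
      unfolding rev mn by (intro continuant_cong arg_cong[where f = \<rho>]) auto
    also have "continuant z (\<lambda>i. \<rho> (int (i + Suc m') - int m)) (Suc (Suc n')) = continuant z (\<lambda>i. \<rho> (int i)) (Suc (Suc n'))"
      unfolding mn by (intro continuant_cong arg_cong[where f = \<rho>]) auto
    also have "\<dots> = (1 + z) * Rc 1 n - z * \<rho> 0 * \<rho> 1 * Rc 2 n'"
      unfolding continuant_jost_left Rc_def mn by (simp add: algebra_simps)
    also have "continuant z (\<lambda>i. \<rho> (int (i + Suc (Suc m')) - int m)) (Suc n') = Rc 1 n"
      unfolding mn Rc_def by (intro continuant_cong arg_cong[where f = \<rho>]) auto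
    finally show ?thesis by (simp add: mn)
  qed
  have "((\<lambda>k. Lc (-1) (M k) * ((1 + z) * Rc 1 (N k) - z * \<rho> 0 * \<rho> 1 * Rc 2 (N k - 1)) - z * \<rho> (-1) * \<rho> 0 * Lc (-2) (M k - 1) * Rc 1 (N k))
     \<longlongrightarrow> jost_left z \<rho> (-1) * ((1 + z) * jost_right z \<rho> 1 - z * \<rho> 0 * \<rho> 1 * jost_right z \<rho> 2) - z * \<rho> (-1) * \<rho> 0 * jost_left z \<rho> (-2) * jost_right z \<rho> 1) F"
    by (intro tendsto_intros Ll Rl minus M N) auto
  also have "jost_left z \<rho> (-1) * ((1 + z) * jost_right z \<rho> 1 - z * \<rho> 0 * \<rho> 1 * jost_right z \<rho> 2) - z * \<rho> (-1) * \<rho> 0 * jost_left z \<rho> (-2) * jost_right z \<rho> 1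
     = evans z \<rho>" by (simp add: evans_def algebra_simps)
  finally show ?thesis
  proof (rule Lim_transform_eventually)
    have "eventually (\<lambda>k. M k \<ge> 1) F" "eventually (\<lambda>k. N k \<ge> 1) F"
      using M N by (auto simp: filterlim_at_top)
    then show "\<forall>\<^sub>F k in F. Lc (-1) (M k) * ((1 + z) * Rc 1 (N k) - z * \<rho> 0 * \<rho> 1 * Rc 2 (N k - 1)) - z * \<rho> (-1) * \<rho> 0 * Lc (-2) (M k - 1) * Rc 1 (N k)
        = continuant z (\<lambda>i. \<rho> (int i - int (M k))) (M k + N k + 1)"
      by eventually_elim (rule eq[symmetric])
  qed
qed

text \<open>
Shifting the weights only moves the window of indices by one, which is invisible in the limit.
\<close>

lemma evans_shift:
  assumes z: "norm z < 1" and a: "admissible2 \<rho>" "admissible2 (\<lambda>n. \<rho> (n + 1))"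
  shows "evans z (\<lambda>n. \<rho> (n + 1)) = evans z \<rho>"
proof -
  have 1: "(\<lambda>k. continuant z (\<lambda>i. \<rho> (int i - int (Suc k) + 1)) (Suc k + k + 1)) \<longlonglongrightarrow> evans z (\<lambda>n. \<rho> (n + 1))"
    by (rule window_tendsto_evans[OF z a(2)]) (auto simp: filterlim_Suc filterlim_ident)
  have 2: "(\<lambda>k. continuant z (\<lambda>i. \<rho> (int i - int k)) (k + Suc k + 1)) \<longlonglongrightarrow> evans z \<rho>"
    by (rule window_tendsto_evans[OF z a(1)]) (auto simp: filterlim_Suc filterlim_ident)
  have eq: "(\<lambda>k. continuant z (\<lambda>i. \<rho> (int i - int (Suc k) + 1)) (Suc k + k + 1)) = (\<lambda>k. continuant z (\<lambda>i. \<rho> (int i - int k)) (k + Suc k + 1))"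
    by (simp add: algebra_simps)
  show ?thesis by (rule LIMSEQ_unique[OF 1[unfolded eq] 2])
qed

lemma evans_holomorphic:
  assumes S: "open S" "\<And>p. p \<in> S \<Longrightarrow> norm (z p) < 1" "\<And>p. p \<in> S \<Longrightarrow> admissible2 (\<rho> p)"
    and z: "z holomorphic_on S" and r: "\<And>n. (\<lambda>p. \<rho> p n) holomorphic_on S"
  shows "(\<lambda>p. evans (z p) (\<rho> p)) holomorphic_on S"
proof -
  have "(\<lambda>p. jost_right (z p) (\<rho> p) k) holomorphic_on S" if "k \<ge> 1" for k
    unfolding jost_right_def using that by (intro jost_holomorphic assms admissible2_jost_right)
  moreover have "(\<lambda>p. jost_left (z p) (\<rho> p) k) holomorphic_on S" if "k \<le> -1" for k
    unfolding jost_left_def using that by (intro jost_holomorphic assms admissible2_jost_left)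
  ultimately show ?thesis unfolding evans_def by (intro holomorphic_intros z r) auto
qed

lemma evans_cnj:
  assumes "norm z < 1" "admissible2 \<rho>"
  shows "evans (cnj z) (\<lambda>n. cnj (\<rho> n)) = cnj (evans z \<rho>)"
proof -
  have "jost_right (cnj z) (\<lambda>n. cnj (\<rho> n)) k = cnj (jost_right z \<rho> k)" if "k \<ge> 1" for k
    unfolding jost_right_def using that assms by (intro jost_cnj admissible2_jost_right)
  moreover have "jost_left (cnj z) (\<lambda>n. cnj (\<rho> n)) k = cnj (jost_left z \<rho> k)" if "k \<le> -1" for k
    unfolding jost_left_def using that assms by (intro jost_cnj admissible2_jost_left)
  ultimately show ?thesis by (simp add: evans_def)
qed

lemma evans_tendsto_1:
  assumes z: "norm z < 1" and a: "eventually (\<lambda>p. admissible2 (\<rho> p)) F"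
    and lim: "\<And>n. ((\<lambda>p. \<rho> p n) \<longlongrightarrow> 1) F" and F: "F \<noteq> bot"
  shows "((\<lambda>p. evans z (\<rho> p)) \<longlongrightarrow> 1 / (1 - z)) F"
proof -
  have z1: "1 - z \<noteq> 0" using z by auto
  have 1: "((\<lambda>p. jost_right z (\<rho> p) k) \<longlongrightarrow> 1 / (1 - z)) F" if "k \<ge> 1" for k
    unfolding jost_right_def
    by (rule jost_tendsto_1[OF z _ lim F]) (use a in eventually_elim, use admissible2_jost_right that in auto)
  have 2: "((\<lambda>p. jost_left z (\<rho> p) k) \<longlongrightarrow> 1 / (1 - z)) F" if "k \<le> -1" for k
    unfolding jost_left_def
    by (rule jost_tendsto_1[OF z _ lim F]) (use a in eventually_elim, use admissible2_jost_left that in auto)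
  define q where "q = 1 / (1 - z)"
  have "((\<lambda>p. evans z (\<rho> p)) \<longlongrightarrow> (1 + z) * q * q - z * 1 * (1 * q * q + 1 * q * q)) F"
    unfolding evans_def q_def by (intro tendsto_intros 1 2 lim) auto
  also have "(1 + z) * q * q - z * 1 * (1 * q * q + 1 * q * q) = q"
  proof -
    have "q * (1 - z) = 1" using z1 by (simp add: q_def)
    then have "q = q * (q * (1 - z))" by simp
    then show ?thesis by (simp add: algebra_simps)
  qed
  finally show ?thesis by (simp add: q_def)
qed

section \<open>Weights with poles on a translated lattice\<close>

text \<open>
In the application w = d^2 and x = \<theta>; complex x is needed for the Liouville argument and
complex w for the continuity of the Hill determinant in \<Lambda>.
\<close>

definition complex_weight :: "complex \<Rightarrow> complex \<Rightarrow> int \<Rightarrow> complex" where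
  "complex_weight w x n = 1 - 1 / ((x + of_int n)^2 + w)"

text \<open>
The strip has to be wider than one half of a period to both sides, so that its translate by 1
overlaps with it; 3/4 does this and still keeps x + n away from 0 for n \<noteq> 0.
\<close>

lemma admissible2_complex_weight:
  assumes x: "\<bar>Re x\<bar> \<le> 3 / 4" and b: "\<And>n::int. (Re x + n)^2 \<le> norm ((x + of_int n)^2 + w)"
  shows "admissible2 (complex_weight w x)"
proof -
  have *: "norm (1 - complex_weight w x n) \<le> 16 / (real m + 1)^2" if "\<bar>n\<bar> = int m + 1" for n m
  proof -
    have "((real m + 1) / 4)^2 \<le> (Re x + n)^2"
    proof -
      have "real_of_int \<bar>n\<bar> = real m + 1" using that by simp
      then have "(real m + 1) / 4 \<le> \<bar>Re x + n\<bar>" using x by (simp add: abs_real_def split: if_splits)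
      then have "((real m + 1) / 4)^2 \<le> \<bar>Re x + n\<bar>^2" by (intro power_mono) auto
      then show ?thesis by simp
    qed
    also note b[of n]
    finally have "1 / norm ((x + of_int n)^2 + w) \<le> 1 / ((real m + 1) / 4)^2"
      by (intro divide_left_mono mult_pos_pos) (auto intro: less_le_trans[rotated])
    then show ?thesis by (simp add: complex_weight_def norm_divide power_divide)
  qed
  show ?thesis unfolding admissible2_def admissible_def using * by auto
qed

text \<open>
The product of the two factors y + id and y - id, each of which has real part Re y.
\<close>

lemma norm_sq_plus_real:
  fixes y :: complex
  shows "(Re y)^2 \<le> norm (y^2 + of_real (d^2))"
proof -
  have e: "y^2 + of_real (d^2) = (y + \<i> * of_real d) * (y - \<i> * of_real d)"
    by (simp add: algebra_simps power2_eq_square)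
  have "\<bar>Re y\<bar> \<le> norm (y + \<i> * of_real d)" "\<bar>Re y\<bar> \<le> norm (y - \<i> * of_real d)"
    using abs_Re_le_cmod[of "y + \<i> * of_real d"] abs_Re_le_cmod[of "y - \<i> * of_real d"] by auto
  then have "\<bar>Re y\<bar> * \<bar>Re y\<bar> \<le> norm (y + \<i> * of_real d) * norm (y - \<i> * of_real d)"
    by (intro mult_mono) auto
  then show ?thesis unfolding e norm_mult by (simp add: power2_eq_square)
qed

lemma admissible2_complex_weight_strip: "\<bar>Re x\<bar> \<le> 3 / 4 \<Longrightarrow> admissible2 (complex_weight (of_real (d^2)) x)"
  by (rule admissible2_complex_weight) (use norm_sq_plus_real[of "x + of_int n" d for n] in auto)

lemma admissible2_complex_weight_0:
  assumes "Re w \<ge> 0"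
  shows "admissible2 (complex_weight w 0)"
proof (rule admissible2_complex_weight)
  fix n :: int
  have "(of_int n :: complex)^2 = of_real (n^2)" by simp
  then have "Re ((of_int n)^2 + w) = n^2 + Re w" by (metis Re_complex_of_real plus_complex.sel(1))
  then show "(Re 0 + n)^2 \<le> norm ((0 + of_int n)^2 + w)"
    using complex_Re_le_cmod[of "(of_int n)^2 + w"] assms by simp
qed simp

section \<open>Determinants of geometric kernels\<close>

definition tridiag :: "(nat \<Rightarrow> 'a::comm_ring_1) \<Rightarrow> (nat \<Rightarrow> 'a) \<Rightarrow> (nat \<Rightarrow> 'a) \<Rightarrow> nat \<Rightarrow> 'a mat" where
  "tridiag D P L n = mat n n (\<lambda>(i, j). if i = j then D i else if j = Suc i then P i else if i = Suc j then L j else 0)"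

lemma tridiag_carrier [simp]: "tridiag D P L n \<in> carrier_mat n n"
  by (simp add: tridiag_def)

lemma det_tridiag:
  "Determinant.det (tridiag D P L (Suc (Suc n))) =
     D (Suc n) * Determinant.det (tridiag D P L (Suc n)) - P n * L n * Determinant.det (tridiag D P L n)"
proof -
  define A where "A = tridiag D P L (Suc (Suc n))"
  have A: "A \<in> carrier_mat (Suc (Suc n)) (Suc (Suc n))" by (simp add: A_def)
  define B where "B = mat_delete A (Suc n) n"
  have B: "B \<in> carrier_mat (Suc n) (Suc n)" using A by (auto simp: B_def mat_delete_def)
  have 1: "mat_delete A (Suc n) (Suc n) = tridiag D P L (Suc n)"
    by (rule eq_matI) (auto simp: A_def mat_delete_def tridiag_def)
  have 2: "mat_delete B n n = tridiag D P L n"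
    by (rule eq_matI) (auto simp: B_def A_def mat_delete_def tridiag_def)
  have dB: "Determinant.det B = P n * Determinant.det (tridiag D P L n)"
  proof -
    have "Determinant.det B = (\<Sum>i<Suc n. B $$ (i, n) * cofactor B i n)"
      by (rule laplace_expansion_column[OF B]) simp
    also have "\<dots> = (\<Sum>i<Suc n. if i = n then P n * cofactor B n n else 0)"
      by (intro sum.cong refl) (auto simp: B_def A_def mat_delete_def tridiag_def)
    also have "\<dots> = P n * cofactor B n n" by simp
    finally show ?thesis by (simp add: cofactor_def 2)
  qed
  have "Determinant.det A = (\<Sum>j<Suc (Suc n). A $$ (Suc n, j) * cofactor A (Suc n) j)"
    by (rule laplace_expansion_row[OF A]) simp
  also have "\<dots> = A $$ (Suc n, Suc n) * cofactor A (Suc n) (Suc n) + A $$ (Suc n, n) * cofactor A (Suc n) n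
      + (\<Sum>j<n. A $$ (Suc n, j) * cofactor A (Suc n) j)" by simp
  also have "(\<Sum>j<n. A $$ (Suc n, j) * cofactor A (Suc n) j) = 0"
    by (rule sum.neutral) (auto simp: A_def tridiag_def)
  finally have *: "Determinant.det A = D (Suc n) * cofactor A (Suc n) (Suc n) + L n * cofactor A (Suc n) n + 0"
    by (simp add: A_def tridiag_def)
  have "cofactor A (Suc n) (Suc n) = Determinant.det (tridiag D P L (Suc n))"
    by (simp add: cofactor_def 1)
  moreover have "cofactor A (Suc n) n = - (P n * Determinant.det (tridiag D P L n))"
    using dB by (simp add: cofactor_def B_def)
  ultimately show ?thesis using * by (simp add: A_def algebra_simps)
qed

lemma det_tridiag_0: "Determinant.det (tridiag D P L 0) = 1"
  by (rule det_dim_zero) simp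

lemma det_tridiag_1: "Determinant.det (tridiag D P L (Suc 0)) = D 0"
  by (subst det_single) (simp_all add: tridiag_def)

text \<open>
The Fourier coefficients of Q have this form with \<alpha> = is and \<beta> = -is.
\<close>

definition geom_kernel :: "'a::comm_ring_1 \<Rightarrow> 'a \<Rightarrow> nat \<Rightarrow> nat \<Rightarrow> 'a" where
  "geom_kernel \<alpha> \<beta> i j = (if j \<le> i then \<alpha> ^ (i - j) else \<beta> ^ (j - i))"

lemma geom_kernel_simps:
  "geom_kernel \<alpha> \<beta> i i = 1"
  "j < i \<Longrightarrow> geom_kernel \<alpha> \<beta> i j = \<alpha> ^ (i - j)"
  "i < j \<Longrightarrow> geom_kernel \<alpha> \<beta> i j = \<beta> ^ (j - i)"
  by (auto simp: geom_kernel_def)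

lemma sum_two_terms:
  fixes f :: "nat \<Rightarrow> 'a::comm_ring_1"
  assumes "i < M"
  shows "(\<Sum>k = 0..<M. (if i = k then 1 else if i = Suc k then - c else 0) * f k) = f i - (if i = 0 then 0 else c * f (i - 1))"
proof -
  have "(\<Sum>k = 0..<M. (if i = k then 1 else if i = Suc k then - c else 0) * f k)
     = (\<Sum>k = 0..<M. (if k = i then f k else 0) + (if i \<noteq> 0 \<and> k = i - 1 then - (c * f k) else 0))"
    by (intro sum.cong) auto
  also have "\<dots> = f i + (\<Sum>k = 0..<M. if i \<noteq> 0 \<and> k = i - 1 then - (c * f k) else 0)"
    using assms by (simp add: sum.distrib)
  also have "(\<Sum>k = 0..<M. if i \<noteq> 0 \<and> k = i - 1 then - (c * f k) else 0) = - (if i = 0 then 0 else c * f (i - 1))"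
    using assms by (cases "i = 0") (auto simp: sum.delta)
  finally show ?thesis by simp
qed

text \<open>
Subtracting \<alpha> times the previous row and \<beta> times the previous column annihilates a
geometric kernel outside the diagonal. Both operations are multiplications by unitriangular
matrices, so they preserve the determinant, and the diagonal perturbation becomes tridiagonal.
\<close>

lemma det_geom_kernel_tridiag:
  fixes \<alpha> \<beta> \<kappa> :: "'a::comm_ring_1"
  shows "Determinant.det (mat M M (\<lambda>(i, j). \<kappa> * geom_kernel \<alpha> \<beta> i j - (if i = j then a i else 0)))
    = Determinant.det (tridiag (\<lambda>i. if i = 0 then \<kappa> - a 0 else \<kappa> * (1 - \<alpha> * \<beta>) - a i - \<alpha> * \<beta> * a (i - 1)) (\<lambda>i. \<beta> * a i) (\<lambda>i. \<alpha> * a i) M)"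
proof -
  define G where "G = mat M M (\<lambda>(i, j). \<kappa> * geom_kernel \<alpha> \<beta> i j - (if i = j then a i else 0))"
  define X where "X = mat M M (\<lambda>(i, j). if i = j then 1 else if i = Suc j then - \<alpha> else 0)"
  define Y where "Y = mat M M (\<lambda>(i, j). if j = i then 1 else if j = Suc i then - \<beta> else 0)"
  have car: "G \<in> carrier_mat M M" "X \<in> carrier_mat M M" "Y \<in> carrier_mat M M"
    by (auto simp: G_def X_def Y_def)
  have dX: "Determinant.det X = 1"
  proof -
    have "Determinant.det X = prod_list (diag_mat X)"
      by (rule det_lower_triangular[OF _ car(2)]) (auto simp: X_def)
    also have "diag_mat X = map (\<lambda>_. 1) [0..<M]"
      by (auto simp: diag_mat_def X_def intro!: map_cong)
    finally show ?thesis by (simp add: prod_list_replicate map_replicate_const)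
  qed
  have dY: "Determinant.det Y = 1"
  proof -
    have "Determinant.det Y = prod_list (diag_mat Y)"
      by (rule det_upper_triangular[OF _ car(3)]) (auto simp: Y_def upper_triangular_def)
    also have "diag_mat Y = map (\<lambda>_. 1) [0..<M]"
      by (auto simp: diag_mat_def Y_def intro!: map_cong)
    finally show ?thesis by (simp add: prod_list_replicate map_replicate_const)
  qed
  have XG: "(X * G) $$ (i, j) = G $$ (i, j) - (if i = 0 then 0 else \<alpha> * G $$ (i - 1, j))"
    if "i < M" "j < M" for i j
  proof -
    have "(X * G) $$ (i, j) = (\<Sum>k = 0..<M. X $$ (i, k) * G $$ (k, j))"
      using that car by (simp add: scalar_prod_def)
    also have "\<dots> = (\<Sum>k = 0..<M. (if i = k then 1 else if i = Suc k then - \<alpha> else 0) * G $$ (k, j))"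
      using that by (intro sum.cong) (auto simp: X_def)
    also note sum_two_terms[OF that(1)]
    finally show ?thesis .
  qed
  have XGY: "(X * G * Y) $$ (i, j) = (X * G) $$ (i, j) - (if j = 0 then 0 else \<beta> * (X * G) $$ (i, j - 1))"
    if "i < M" "j < M" for i j
  proof -
    have "X * G \<in> carrier_mat M M" using car by simp
    then have "(X * G * Y) $$ (i, j) = (\<Sum>k = 0..<M. (X * G) $$ (i, k) * Y $$ (k, j))"
      using that car by (subst index_mult_mat) (auto simp: scalar_prod_def intro!: sum.cong)
    also have "\<dots> = (\<Sum>k = 0..<M. (if j = k then 1 else if j = Suc k then - \<beta> else 0) * (X * G) $$ (i, k))"
      using that by (intro sum.cong) (auto simp: Y_def mult.commute)
    also note sum_two_terms[OF that(2)]
    finally show ?thesis .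
  qed
  have "X * G * Y = tridiag (\<lambda>i. if i = 0 then \<kappa> - a 0 else \<kappa> * (1 - \<alpha> * \<beta>) - a i - \<alpha> * \<beta> * a (i - 1)) (\<lambda>i. \<beta> * a i) (\<lambda>i. \<alpha> * a i) M" (is "_ = ?T")
  proof (rule eq_matI)
    fix i j assume "i < dim_row ?T" "j < dim_col ?T"
    then have ij: "i < M" "j < M" by (auto simp: tridiag_def)
    have G: "G $$ (k, l) = \<kappa> * geom_kernel \<alpha> \<beta> k l - (if k = l then a k else 0)" if "k < M" "l < M" for k l
      using that by (simp add: G_def)
    have XG0: "(X * G) $$ (0, l) = \<kappa> * \<beta> ^ l - (if l = 0 then a 0 else 0)" if "0 < M" "l < M" for l
      using that by (simp add: XG G geom_kernel_def)
    have XG1: "(X * G) $$ (Suc k, l) = (if l \<le> k then 0 else \<kappa> * (1 - \<alpha> * \<beta>) * \<beta> ^ (l - Suc k))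
        - (if l = Suc k then a l else 0) + (if l = k then \<alpha> * a l else 0)" if kl: "Suc k < M" "l < M" for k l
    proof -
      consider "l < k" | "l = k" | "l = Suc k" | m where "l = Suc (Suc k) + m"
        by (metis add_Suc_right linorder_cases not_less_eq nat_less_le le_Suc_ex Suc_leI add_Suc)
      then show ?thesis
        by cases (use kl in \<open>auto simp: XG G geom_kernel_def Suc_diff_le algebra_simps\<close>)
    qed
    show "(X * G * Y) $$ (i, j) = ?T $$ (i, j)"
    proof (cases i)
      case 0
      then show ?thesis
        using ij by (cases j) (auto simp: XGY XG0 tridiag_def algebra_simps)
    next
      case (Suc k)
      consider "j < k" | "j = k" | "j = Suc k" | "j = Suc (Suc k)" | m where "j = Suc (Suc (Suc k)) + m"
        by (metis add_Suc_right linorder_cases not_less_eq nat_less_le le_Suc_ex Suc_leI add_Suc)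
      then show ?thesis
      proof cases
        case 5
        then show ?thesis
          using ij Suc by (simp add: XGY XG1 tridiag_def Suc_diff_le algebra_simps)
      qed (use ij Suc in \<open>auto simp: XGY XG1 tridiag_def algebra_simps\<close>)
    qed
  qed (use car in \<open>auto simp: tridiag_def\<close>)
  moreover have "Determinant.det (X * G * Y) = Determinant.det G"
    using car dX dY by (simp add: det_mult[of _ M])
  ultimately show ?thesis by (simp add: G_def)
qed

text \<open>
The continuant of a truncated matrix whose first diagonal entry is modified: the elimination treats
the first row differently from the others.
\<close>

fun corner_continuant :: "complex \<Rightarrow> (nat \<Rightarrow> complex) \<Rightarrow> nat \<Rightarrow> complex" where
  "corner_continuant z r 0 = 1"
| "corner_continuant z r (Suc 0) = 1 + z - z * r 0"
| "corner_continuant z r (Suc (Suc n)) = (1 + z) * corner_continuant z r (Suc n) - z * r n * r (Suc n) * corner_continuant z r n"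

lemma corner_continuant_eq: "corner_continuant z r (Suc n) = continuant z r (Suc n) - z * r 0 * continuant z (shift 1 r) n"
proof (induction n rule: less_induct)
  case (less n)
  consider "n = 0" | "n = Suc 0" | k where "n = Suc (Suc k)"
    by (metis not0_implies_Suc)
  then show ?case
  proof cases
    case 3
    have e1: "corner_continuant z r (Suc n) = (1 + z) * corner_continuant z r (Suc (Suc k)) - z * r (Suc k) * r (Suc (Suc k)) * corner_continuant z r (Suc k)"
      using 3 by simp
    have e2: "continuant z r (Suc n) = (1 + z) * continuant z r (Suc (Suc k)) - z * r (Suc k) * r (Suc (Suc k)) * continuant z r (Suc k)"
      using 3 by simp
    have e3: "continuant z (shift 1 r) n = (1 + z) * continuant z (shift 1 r) (Suc k) - z * r (Suc k) * r (Suc (Suc k)) * continuant z (shift 1 r) k"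
      using 3 by simp
    have i1: "corner_continuant z r (Suc (Suc k)) = continuant z r (Suc (Suc k)) - z * r 0 * continuant z (shift 1 r) (Suc k)"
      by (rule less.IH) (use 3 in simp)
    have i2: "corner_continuant z r (Suc k) = continuant z r (Suc k) - z * r 0 * continuant z (shift 1 r) k"
      by (rule less.IH) (use 3 in simp)
    show ?thesis unfolding e1 e2 e3 i1 i2 by (simp only: algebra_simps)
  qed (simp_all add: algebra_simps)
qed

text \<open>
After division by the product of the b_i the tridiagonal determinant is a continuant with modified
corners. With b_i = n^2 + w the weights r_i = 1 - 1/b_i are those of the limit above.
\<close>

lemma det_geom_kernel_corner:
  fixes \<alpha> \<beta> z \<kappa> :: complex and b :: "nat \<Rightarrow> complex"
  assumes z: "\<alpha> * \<beta> = z" "z \<noteq> 1" and k: "\<kappa> = - ((1 + z) / (1 - z))" and b: "\<And>i. b i \<noteq> 0"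
  defines "r \<equiv> \<lambda>i. 1 - 1 / b i"
  shows "(1 - z) * Determinant.det (mat (Suc n) (Suc n) (\<lambda>(i, j). \<kappa> * geom_kernel \<alpha> \<beta> i j - (if i = j then b i - 1 else 0)))
    = (-1) ^ Suc n * (\<Prod>i<Suc n. b i) * (corner_continuant z r (Suc n) - z * r n * corner_continuant z r n)"
proof -
  define D where "D M = Determinant.det (mat M M (\<lambda>(i, j). \<kappa> * geom_kernel \<alpha> \<beta> i j - (if i = j then b i - 1 else 0)))" for M
  have kz: "\<kappa> * (1 - z) = - (1 + z)" using k z(2) by simp
  have D0: "D 0 = 1" unfolding D_def det_geom_kernel_tridiag det_tridiag_0 ..
  have D1: "D (Suc 0) = \<kappa> - (b 0 - 1)" unfolding D_def det_geom_kernel_tridiag det_tridiag_1 by simp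
  have D2: "D (Suc (Suc n)) = - (b (Suc n) + z * b n) * D (Suc n) - z * (b n - 1)^2 * D n" for n
  proof -
    have "D (Suc (Suc n)) = (\<kappa> * (1 - \<alpha> * \<beta>) - (b (Suc n) - 1) - \<alpha> * \<beta> * (b n - 1)) * D (Suc n)
       - (\<beta> * (b n - 1)) * (\<alpha> * (b n - 1)) * D n"
      unfolding D_def det_geom_kernel_tridiag by (subst det_tridiag) simp
    also have "\<kappa> * (1 - \<alpha> * \<beta>) = - (1 + z)" using kz z(1) by simp
    also have "(\<beta> * (b n - 1)) * (\<alpha> * (b n - 1)) = z * (b n - 1)^2"
      using z(1) by (simp add: power2_eq_square mult_ac)
    finally show ?thesis using z(1) by (simp add: algebra_simps)
  qed
  have br: "b i * r i = b i - 1" for i using b[of i] by (simp add: r_def field_simps)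
  define C where "C = corner_continuant z r"
  define B where "B n = (-1) ^ n * (\<Prod>i<n. b i)" for n
  have BS: "B (Suc n) = - B n * b n" for n by (simp add: B_def)
  have C2: "C (Suc (Suc n)) = (1 + z) * C (Suc n) - z * r n * r (Suc n) * C n" for n by (simp add: C_def)
  \<comment> \<open>The first conjunct expresses (b n - 1) * D n without dividing by r n, which may vanish.\<close>
  have "(1 - z) * (b n - 1) * D n = B n * b n * (r n * C n - (1 + z) * C n + C (Suc n)) \<and>
        (1 - z) * D (Suc n) = B (Suc n) * (C (Suc n) - z * r n * C n)" for n
  proof (induction n)
    case 0
    have "b 0 * (r 0 - (1 + z) + (1 + z - z * r 0)) = (1 - z) * (b 0 * r 0)"
      by (simp add: algebra_simps)
    then have "(1 - z) * (b 0 - 1) = b 0 * (r 0 - (1 + z) + (1 + z - z * r 0))"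
      by (simp only: br)
    moreover have "(1 - z) * (\<kappa> - (b 0 - 1)) = - b 0 * (1 + z - z * r 0 - z * r 0)"
    proof -
      have "- b 0 * (1 + z - z * r 0 - z * r 0) = - b 0 * (1 + z) + 2 * z * (b 0 * r 0)"
        by (simp add: algebra_simps)
      also have "\<dots> = - (1 + z) - (1 - z) * (b 0 - 1)" unfolding br by (simp add: algebra_simps)
      also have "\<dots> = (1 - z) * (\<kappa> - (b 0 - 1))" unfolding kz[symmetric] by (simp add: algebra_simps)
      finally show ?thesis by simp
    qed
    ultimately show ?case by (simp add: D0 D1 B_def C_def)
  next
    case (Suc n)
    note IH1 = conjunct1[OF Suc] and IH2 = conjunct2[OF Suc]
    have "(1 - z) * (b (Suc n) - 1) * D (Suc n) = (b (Suc n) - 1) * (B (Suc n) * (C (Suc n) - z * r n * C n))"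
      unfolding IH2[symmetric] by (simp add: mult_ac)
    also have "\<dots> = B (Suc n) * b (Suc n) * (r (Suc n) * C (Suc n) - z * r n * r (Suc n) * C n)"
      unfolding br[symmetric] by (simp add: algebra_simps)
    also have "r (Suc n) * C (Suc n) - z * r n * r (Suc n) * C n = r (Suc n) * C (Suc n) - (1 + z) * C (Suc n) + C (Suc (Suc n))"
      by (simp add: C2)
    finally have 1: "(1 - z) * (b (Suc n) - 1) * D (Suc n) = B (Suc n) * b (Suc n) * (r (Suc n) * C (Suc n) - (1 + z) * C (Suc n) + C (Suc (Suc n)))" .
    define x y where "x = b n" and "y = b (Suc n)"
    define p q where "p = r n" and "q = r (Suc n)"
    define c d where "c = C n" and "d = C (Suc n)"
    have xp: "x * p = x - 1" and yq: "y * q = y - 1" using br by (auto simp: x_def y_def p_def q_def)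
    have "(1 - z) * D (Suc (Suc n)) = - (y + z * x) * ((1 - z) * D (Suc n)) - z * (x - 1) * ((1 - z) * (x - 1) * D n)"
      unfolding D2 by (simp add: algebra_simps power2_eq_square x_def y_def)
    also have "\<dots> = B n * x * ((y + z * x) * (d - z * p * c) - z * (x - 1) * (p * c - (1 + z) * c + d))"
    proof -
      have "(1 - z) * (x - 1) * D n = B n * x * (p * c - (1 + z) * c + d)"
        using IH1 by (simp only: x_def p_def c_def d_def)
      moreover have "(1 - z) * D (Suc n) = - B n * x * (d - z * p * c)"
        using IH2 by (simp only: BS x_def p_def c_def d_def)
      ultimately show ?thesis unfolding x_def[symmetric] by (simp only:) (simp add: algebra_simps)
    qed
    also have "(y + z * x) * (d - z * p * c) - z * (x - 1) * (p * c - (1 + z) * c + d)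
        = y * ((1 + z) * d - z * p * q * c - z * q * d)"
    proof -
      have e: "x * p = x - 1" "y * q = y - 1" by (fact xp yq)+
      have "y * ((1 + z) * d - z * p * q * c - z * q * d) = y * (1 + z) * d - z * p * (y * q) * c - z * (y * q) * d"
        by (simp add: algebra_simps)
      also have "\<dots> = y * d + z * d - z * p * y * c + z * p * c" unfolding e by (simp add: algebra_simps)
      finally have R: "y * ((1 + z) * d - z * p * q * c - z * q * d) = y * d + z * d - z * p * y * c + z * p * c" .
      have "(y + z * x) * (d - z * p * c) - z * (x - 1) * (p * c - (1 + z) * c + d)
         = y * d - z * y * p * c + z * x * d - z * z * (x * p) * c - z * (x * p) * c + z * p * c
           + z * (1 + z) * x * c - z * (1 + z) * c - z * x * d + z * d"
        by (simp add: algebra_simps)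
      also have "\<dots> = y * d + z * d - z * p * y * c + z * p * c" unfolding e by (simp add: algebra_simps)
      finally show ?thesis using R by simp
    qed
    also have "B n * x * (y * ((1 + z) * d - z * p * q * c - z * q * d)) = B (Suc (Suc n)) * (C (Suc (Suc n)) - z * r (Suc n) * C (Suc n))"
      by (simp add: BS C2 x_def y_def p_def q_def c_def d_def algebra_simps)
    finally show ?case using 1 by blast
  qed
  from conjunct2[OF this[of n]] show ?thesis by (simp only: D_def B_def C_def)
qed

section \<open>The inverse Joukowski map\<close>

lemma cut_iff: "c \<in> cut \<longleftrightarrow> Im c = 0 \<and> \<bar>Re c\<bar> \<le> 1"
  by (auto simp: cut_def image_iff complex_eq_iff abs_le_iff intro!: bexI[of _ "Re c"])

lemma joukowski_inj:
  fixes s t :: complex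
  assumes "s + 1 / s = t + 1 / t" "norm s < 1" "norm t < 1" "s \<noteq> 0" "t \<noteq> 0"
  shows "s = t"
proof -
  have "(s - t) * (s * t - 1) = (s + 1 / s - (t + 1 / t)) * (s * t)"
    using assms(4,5) by (simp add: field_simps)
  then have "(s - t) * (s * t - 1) = 0" using assms(1) by simp
  moreover have "norm (s * t) < 1" using assms(2,3) mult_strict_mono[of "norm s" 1 "norm t" 1] by (simp add: norm_mult)
  then have "s * t \<noteq> 1" by auto
  ultimately show ?thesis by simp
qed

text \<open>
The closed form shows that the inverse Joukowski map is defined and holomorphic off the cut. Of the
two roots s and 1/s of the quadratic equation, the principal square root selects the smaller one.
\<close>

lemma s_of_explicit:
  assumes "c \<notin> cut"
  shows "c \<noteq> 0" "1 - 1 / c^2 \<notin> \<real>\<^sub>\<le>\<^sub>0"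
    "s_of c = c * (1 - csqrt (1 - 1 / c^2))"
    "norm (s_of c) < 1" "s_of c \<noteq> 0" "c = (s_of c + 1 / s_of c) / 2"
proof -
  show c0: "c \<noteq> 0" using assms by (auto simp: cut_iff)
  show nr: "1 - 1 / c^2 \<notin> \<real>\<^sub>\<le>\<^sub>0"
  proof
    assume "1 - 1 / c^2 \<in> \<real>\<^sub>\<le>\<^sub>0"
    then obtain x :: real where x: "x \<le> 0" "1 - 1 / c^2 = of_real x" by (auto elim!: nonpos_Reals_cases)
    then have e: "c^2 = of_real (1 / (1 - x))"
      using c0 by (simp add: field_simps)
    define q where "q = sqrt (1 / (1 - x))"
    have q2: "q^2 = 1 / (1 - x)" using x(1) by (simp add: q_def)
    have "(c - of_real q) * (c + of_real q) = c^2 - of_real (q^2)"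
      by (simp add: algebra_simps power2_eq_square)
    also have "\<dots> = 0" unfolding e q2 by simp
    finally have "c = of_real q \<or> c = - of_real q"
      by (auto simp: eq_neg_iff_add_eq_0)
    moreover have "\<bar>q\<bar> \<le> 1" using x(1) by (simp add: q_def real_sqrt_le_1_iff)
    ultimately have "c \<in> cut" by (auto simp: cut_iff)
    with assms show False ..
  qed
  define q where "q = csqrt (1 - 1 / c^2)"
  have q2: "q^2 = 1 - 1 / c^2" by (simp add: q_def)
  have Re_q: "Re q > 0"
  proof (rule ccontr)
    assume "\<not> Re q > 0"
    then have "Re q = 0" using csqrt_principal[of "1 - 1 / c^2"] by (auto simp: q_def)
    then have "q^2 = of_real (- ((Im q)^2))" by (simp add: complex_eq_iff power2_eq_square)
    then have "1 - 1 / c^2 \<in> \<real>\<^sub>\<le>\<^sub>0" unfolding q2[symmetric] by (simp only: nonpos_Reals_of_real_iff) simp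
    then show False using nr by blast
  qed
  define s where "s = c * (1 - q)"
  have inv: "s * (c * (1 + q)) = 1"
  proof -
    have "s * (c * (1 + q)) = c^2 * (1 - q^2)" by (simp add: s_def algebra_simps power2_eq_square)
    also have "\<dots> = 1" unfolding q2 using c0 by simp
    finally show ?thesis .
  qed
  then have s0: "s \<noteq> 0" by auto
  have i: "1 / s = c * (1 + q)" using inv s0 by (simp add: field_simps)
  have cs: "c = (s + 1 / s) / 2" unfolding i by (simp add: s_def algebra_simps)
  have ns: "norm s < 1"
  proof -
    have "norm (1 - q) < norm (1 + q)"
    proof (rule power2_less_imp_less)
      show "(norm (1 - q))^2 < (norm (1 + q))^2"
        unfolding cmod_power2 using Re_q by (simp add: power2_eq_square algebra_simps)
    qed simp
    then have "norm s < norm (c * (1 + q))" using c0 by (simp add: s_def norm_mult)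
    moreover have "norm s * norm (c * (1 + q)) = 1" using inv by (metis norm_mult norm_one)
    ultimately show ?thesis
      using mult_right_mono[of 1 "norm s" "norm (c * (1 + q))"] by (cases "norm s < 1") auto
  qed
  have eq: "s_of c = s"
    unfolding s_of_def
  proof (rule the_equality)
    show "c = (s + 1 / s) / 2 \<and> norm s < 1" using cs ns by blast
    fix t assume t: "c = (t + 1 / t) / 2 \<and> norm t < 1"
    then have t0: "t \<noteq> 0" using c0 by auto
    have A: "2 * c = t + 1 / t" by (subst conjunct1[OF t]) simp
    have B: "2 * c = s + 1 / s" by (subst cs) simp
    show "t = s" by (rule joukowski_inj[OF trans[OF A[symmetric] B]]) (use t t0 ns s0 in auto)
  qed
  show "s_of c = c * (1 - csqrt (1 - 1 / c^2))" unfolding eq s_def q_def ..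
  show "norm (s_of c) < 1" "s_of c \<noteq> 0" unfolding eq by (fact ns s0)+
  show "c = (s_of c + 1 / s_of c) / 2" unfolding eq by (rule cs)
qed

lemma norm_power2_less_1: "norm (s :: complex) < 1 \<Longrightarrow> norm (s^2) < 1"
  by (simp add: norm_power power_less_one_iff)

section \<open>The Hill determinant\<close>

lemma det_scale_rows:
  "Determinant.det (mat M M (\<lambda>(i, j). d i * f i j)) = (\<Prod>i<M. d i :: 'a::comm_ring_1) * Determinant.det (mat M M (\<lambda>(i, j). f i j))"
proof -
  define A where "A = mat M M (\<lambda>(i, j). f i j)"
  have A: "A \<in> carrier_mat M M" by (simp add: A_def)
  have "mat M M (\<lambda>(i, j). d i * f i j) = mat_diag M d * A"
    unfolding mat_diag_mult_left[OF A] by (rule cong_mat) (auto simp: A_def)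
  moreover have "Determinant.det (mat_diag M d) = (\<Prod>i<M. d i)"
  proof -
    have "Determinant.det (mat_diag M d) = prod_list (diag_mat (mat_diag M d))"
      by (rule det_upper_triangular[of _ M]) (auto simp: upper_triangular_def mat_diag_def)
    also have "diag_mat (mat_diag M d) = map d [0..<M]"
      by (auto simp: diag_mat_def mat_diag_def intro!: map_cong)
    also have "prod_list (map d [0..<M]) = (\<Prod>i<M. d i)" by (induction M) auto
    finally show ?thesis .
  qed
  ultimately show ?thesis using A by (simp add: det_mult[of _ M] A_def)
qed

lemma prod_window:
  fixes f :: "int \<Rightarrow> complex"
  assumes "\<And>n. f (- n) = f n"
  shows "(\<Prod>i<2 * N + 1. f (int i - int N)) = f 0 * (\<Prod>k=1..N. f (int k))^2"
proof (induction N)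
  case (Suc N)
  have "(\<Prod>i<2 * Suc N + 1. f (int i - int (Suc N))) = (\<Prod>i<Suc (Suc (2 * N + 1)). f (int i - int (Suc N)))"
    by simp
  also have "\<dots> = f (- int (Suc N)) * (\<Prod>i<Suc (2 * N + 1). f (int (Suc i) - int (Suc N)))"
    by (subst prod.lessThan_Suc_shift) simp
  also have "(\<Prod>i<Suc (2 * N + 1). f (int (Suc i) - int (Suc N))) = (\<Prod>i<2 * N + 1. f (int i - int N)) * f (int (2 * N + 1) - int N)"
  proof -
    have "(\<Prod>i<Suc (2 * N + 1). f (int (Suc i) - int (Suc N))) = (\<Prod>i<Suc (2 * N + 1). f (int i - int N))" by simp
    also have "\<dots> = (\<Prod>i<2 * N + 1. f (int i - int N)) * f (int (2 * N + 1) - int N)"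
      by (rule prod.lessThan_Suc)
    finally show ?thesis .
  qed
  also have "int (2 * N + 1) - int N = int (Suc N)" by simp
  also have "f (- int (Suc N)) = f (int (Suc N))" by (rule assms)
  finally have "(\<Prod>i<2 * Suc N + 1. f (int i - int (Suc N))) =
      f (int (Suc N)) * ((\<Prod>i<2 * N + 1. f (int i - int N)) * f (int (Suc N)))" .
  moreover have "(\<Prod>k=1..Suc N. f (int k)) = (\<Prod>k=1..N. f (int k)) * f (int (Suc N))"
    by (simp del: of_nat_Suc)
  ultimately show ?case unfolding Suc by (simp only: power2_eq_square mult_ac)
qed simp

text \<open>
The factors are collected into the partial products of Euler's formula for the sine, which converge;
the divergent normalisation cancels later in a quotient.
\<close>

lemma prod_sine:
  fixes u :: complex
  shows "(\<Prod>i<2 * N + 1. (of_int (int i - int N))^2 - u^2) =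
    - (fact N ^ 4 / of_real pi ^ 2) * (of_real pi * u * (\<Prod>k=1..N. 1 - u^2 / of_nat k ^ 2))^2"
proof -
  have "(\<Prod>i<2 * N + 1. (of_int (int i - int N))^2 - u^2) = - (u^2) * (\<Prod>k=1..N. (of_nat k)^2 - u^2)^2"
    using prod_window[of "\<lambda>n. (of_int n)^2 - u^2" N] by simp
  also have "(\<Prod>k=1..N. (of_nat k)^2 - u^2) = (\<Prod>k=1..N. (of_nat k)^2 * (1 - u^2 / of_nat k ^ 2))"
    by (intro prod.cong) (auto simp: field_simps)
  also have "\<dots> = fact N ^ 2 * (\<Prod>k=1..N. 1 - u^2 / of_nat k ^ 2)"
    by (simp add: prod.distrib fact_prod prod_power_distrib)
  finally show ?thesis by (simp add: power_mult_distrib field_simps)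
qed

lemma sin2_root_indep:
  fixes u v :: complex
  assumes "u^2 = v^2"
  shows "(sin (of_real pi * u))^2 = (sin (of_real pi * v))^2"
proof -
  have "u = v \<or> u = - v" using assms by (simp add: power2_eq_iff)
  then show ?thesis by auto
qed

lemma sin_i_times: "sin (\<i> * of_real x) = \<i> * of_real (sinh x)"
proof -
  have "complex_of_real (sinh x) = (exp (of_real x) - inverse (exp (of_real x))) / 2"
    unfolding sinh_field_def exp_minus by (simp only: exp_of_real of_real_diff of_real_divide of_real_inverse of_real_numeral)
  also have "\<dots> = - \<i> * sin (\<i> * of_real x)" by (rule sinh_complex)
  finally show ?thesis by simp
qed

lemma hill_matrix_scaled:
  assumes c: "c \<notin> cut" and L: "\<And>n::int. \<Lambda> \<noteq> (of_int n)^2"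
  defines "s \<equiv> s_of c" and "w \<equiv> g c 0 - \<Lambda>"
  shows "(\<Prod>i<2 * N + 1. \<Lambda> - (of_int (int i - int N))^2) * Determinant.det (hill_matrix c \<Lambda> N) =
     Determinant.det (mat (2 * N + 1) (2 * N + 1) (\<lambda>(i, j). kappa c * geom_kernel (\<i> * s) (- \<i> * s) i j
         - (if i = j then ((of_int (int i - int N))^2 + w) - 1 else 0)))"
proof -
  let ?d = "\<lambda>i. \<Lambda> - (of_int (int i - int N) :: complex)^2"
  let ?f = "\<lambda>i j. g_tilde c (int i - int j) / ?d i + (if i = j then 1 else 0)"
  have "hill_matrix c \<Lambda> N = mat (2 * N + 1) (2 * N + 1) (\<lambda>(i, j). ?f i j)"
    by (rule eq_matI) (auto simp: hill_matrix_def Let_def)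
  then have "(\<Prod>i<2 * N + 1. ?d i) * Determinant.det (hill_matrix c \<Lambda> N) = Determinant.det (mat (2 * N + 1) (2 * N + 1) (\<lambda>(i, j). ?d i * ?f i j))"
    by (simp only: det_scale_rows)
  also have "mat (2 * N + 1) (2 * N + 1) (\<lambda>(i, j). ?d i * ?f i j) = mat (2 * N + 1) (2 * N + 1) (\<lambda>(i, j). kappa c * geom_kernel (\<i> * s) (- \<i> * s) i j
         - (if i = j then ((of_int (int i - int N))^2 + w) - 1 else 0))"
  proof (rule cong_mat)
    fix i j assume "i < 2 * N + 1" "j < 2 * N + 1"
    have d0: "?d i \<noteq> 0" using L[of "int i - int N"] by simp
    have e: "?d i * ?f i j = g_tilde c (int i - int j) + (if i = j then ?d i else 0)"
      using d0 by (simp add: distrib_left del: of_int_diff)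
    consider "i = j" | "j < i" | "i < j" by linarith
    then have "?d i * ?f i j = kappa c * geom_kernel (\<i> * s) (- \<i> * s) i j
         - (if i = j then ((of_int (int i - int N))^2 + w) - 1 else 0)"
    proof cases
      case 1
      then show ?thesis unfolding e by (simp add: g_tilde_def geom_kernel_simps w_def g_def)
    next
      case 2
      then have "int i - int j = int (i - j)" by simp
      then show ?thesis unfolding e using 2
        by (simp add: g_tilde_def g_def geom_kernel_simps power_mult_distrib s_def power_int_of_nat del: of_nat_diff)
    next
      case 3
      then have "int i - int j = - int (j - i)" by simp
      then show ?thesis unfolding e using 3
        by (simp add: g_tilde_def g_def geom_kernel_simps power_mult_distrib s_def power_int_minus power_int_of_nat del: of_nat_diff)
           (auto simp: power_minus' power_mult_distrib simp flip: power_inverse)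
    qed
    then show "(case (i, j) of (i, j) \<Rightarrow> ?d i * ?f i j) = (case (i, j) of (i, j) \<Rightarrow> kappa c * geom_kernel (\<i> * s) (- \<i> * s) i j
         - (if i = j then ((of_int (int i - int N))^2 + w) - 1 else 0))"
      by (simp only: prod.case)
  qed auto
  finally show ?thesis .
qed

lemma complex_sin_pi_eq_0:
  fixes u :: complex
  shows "sin (of_real pi * u) = 0 \<longleftrightarrow> (\<exists>n::int. u = of_int n)"
proof -
  have "sin (of_real pi * u) = 0 \<longleftrightarrow> (\<exists>n::int. of_real pi * u = of_real (of_int n * pi))"
    by (simp add: Complex_Transcendental.sin_eq_0)
  also have "\<dots> \<longleftrightarrow> (\<exists>n::int. u = of_int n)"
    by (intro ex_cong1) (auto simp: mult.commute)
  finally show ?thesis .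
qed

text \<open>
Both the product of \<Lambda> - n^2, by which the rows are scaled, and the product of the b_i = n^2
+ w are partial sine products with the same normalisation. The limit of their quotient turns the
factor sin^2(\<pi> sqrt \<Lambda>) into sin^2(\<pi> sqrt(-w)).
\<close>

lemma hill_det_evans:
  assumes c: "c \<notin> cut" and L: "\<And>n::int. \<Lambda> \<noteq> (of_int n)^2"
  defines "z \<equiv> (s_of c)^2" and "w \<equiv> g c 0 - \<Lambda>"
  assumes w: "Re w > 0"
  shows "hill_det c \<Lambda> * (sin (of_real pi * csqrt \<Lambda>))^2 = (1 - z) * evans z (complex_weight w 0) * (sin (of_real pi * csqrt (- w)))^2"
proof -
  define u v where "u = csqrt \<Lambda>" and "v = csqrt (- w)"
  have u2: "u^2 = \<Lambda>" and v2: "v^2 = - w" by (simp_all add: u_def v_def)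
  have z: "norm z < 1" using norm_power2_less_1 s_of_explicit(4)[OF c] by (simp add: z_def)
  then have z1: "z \<noteq> 1" by auto
  have admissible: "admissible2 (complex_weight w 0)" by (rule admissible2_complex_weight_0) (use w in simp)
  define b where "b N i = (of_int (int i - int N))^2 + w" for N i :: nat
  have b0: "b N i \<noteq> 0" for N i
  proof -
    have "(of_int (int i - int N) :: complex)^2 = of_real ((of_int (int i - int N))^2)" by simp
    then have "Re (b N i) = (of_int (int i - int N))^2 + Re w"
      unfolding b_def by (metis Re_complex_of_real plus_complex.sel(1))
    then have "Re (b N i) > 0" using w by (simp add: add_nonneg_pos)
    then show ?thesis by auto
  qed
  define r where "r N i = complex_weight w 0 (int i - int N)" for N i :: nat
  have r_eq: "r N = (\<lambda>i. 1 - 1 / b N i)" for N by (rule ext) (simp add: r_def b_def complex_weight_def)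
  \<comment> \<open>Y collects the continuants; S and K are the convergent and the divergent part of the sine products.\<close>
  define Y where "Y N = corner_continuant z (r N) (2 * N + 1) - z * r N (2 * N) * corner_continuant z (r N) (2 * N)" for N
  define S where "S N u = (of_real pi * u * (\<Prod>k=1..N. 1 - u^2 / of_nat k ^ 2))^2" for N and u :: complex
  define K :: "nat \<Rightarrow> complex" where "K N = fact N ^ 4 / of_real pi ^ 2" for N
  have K0: "K N \<noteq> 0" for N by (simp add: K_def)
  have pL: "(\<Prod>i<2 * N + 1. \<Lambda> - (of_int (int i - int N))^2) = K N * S N u" for N
  proof -
    have "(\<Prod>i<2 * N + 1. \<Lambda> - (of_int (int i - int N))^2) = (\<Prod>i<2 * N + 1. (-1) * ((of_int (int i - int N))^2 - u^2))"
      by (intro prod.cong) (auto simp: u2)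
    also have "\<dots> = (-1) ^ (2 * N + 1) * (\<Prod>i<2 * N + 1. (of_int (int i - int N))^2 - u^2)"
      by (simp only: prod.distrib prod_constant card_lessThan)
    also have "(\<Prod>i<2 * N + 1. (of_int (int i - int N))^2 - u^2) = - (K N * S N u)"
      unfolding prod_sine K_def S_def by simp
    finally show ?thesis by simp
  qed
  have pb: "(\<Prod>i<2 * N + 1. b N i) = - (K N * S N v)" for N
  proof -
    have "(\<Prod>i<2 * N + 1. b N i) = (\<Prod>i<2 * N + 1. (of_int (int i - int N))^2 - v^2)"
      by (simp add: b_def v2)
    then show ?thesis unfolding prod_sine K_def S_def by simp
  qed
  have fin: "(1 - z) * (S N u * Determinant.det (hill_matrix c \<Lambda> N)) = S N v * Y N" for N
  proof -
    have "(1 - z) * ((\<Prod>i<2 * N + 1. \<Lambda> - (of_int (int i - int N))^2) * Determinant.det (hill_matrix c \<Lambda> N))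
      = (-1) ^ (2 * N + 1) * (\<Prod>i<2 * N + 1. b N i) * Y N"
    proof -
      have X: "(1 - z) * Determinant.det (mat (Suc (2 * N)) (Suc (2 * N)) (\<lambda>(i, j). kappa c * geom_kernel (\<i> * s_of c) (- \<i> * s_of c) i j
          - (if i = j then b N i - 1 else 0)))
        = (-1) ^ Suc (2 * N) * (\<Prod>i<Suc (2 * N). b N i) * (corner_continuant z (r N) (Suc (2 * N)) - z * r N (2 * N) * corner_continuant z (r N) (2 * N))"
        unfolding r_eq
      proof (rule det_geom_kernel_corner)
        show "\<i> * s_of c * (- \<i> * s_of c) = z"
          by (simp add: z_def complex_eq_iff power2_eq_square algebra_simps)
      qed (use b0 z1 in \<open>auto simp: z_def kappa_def\<close>)
      show ?thesis
        unfolding hill_matrix_scaled[OF c L] w_def[symmetric] b_def[symmetric] Y_def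
        using X by (simp only: Suc_eq_plus1)
    qed
    then have "K N * ((1 - z) * (S N u * Determinant.det (hill_matrix c \<Lambda> N))) = K N * (S N v * Y N)"
      unfolding pL pb by (simp add: mult_ac)
    then show ?thesis using K0 by simp
  qed
  have Slim: "(\<lambda>N. S N u) \<longlonglongrightarrow> (sin (of_real pi * u))^2" for u
    unfolding S_def by (intro tendsto_intros sin_product_formula_complex)
  have Ylim: "Y \<longlonglongrightarrow> (1 - z)^2 * evans z (complex_weight w 0)"
  proof -
    let ?\<rho> = "complex_weight w 0"
    define W where "W M N = continuant z (\<lambda>i. ?\<rho> (int i - int M)) (M + N + 1)" for M N
    have Wl: "(\<lambda>k. W (f k) (h k)) \<longlonglongrightarrow> evans z ?\<rho>" if "filterlim f at_top sequentially" "filterlim h at_top sequentially" for f h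
      unfolding W_def by (rule window_tendsto_evans[OF z admissible that])
    have fs: "filterlim (\<lambda>k. Suc k) at_top sequentially" by (rule filterlim_Suc)
    have fi: "filterlim (\<lambda>k. k :: nat) at_top sequentially" by (rule filterlim_ident)
    \<comment> \<open>Each modified corner is a combination of the full window and the window shortened at that end.\<close>
    have Yeq: "Y (Suc k) = W (Suc k) (Suc k) - z * ?\<rho> (- int (Suc k)) * W k (Suc k)
       - z * ?\<rho> (int (Suc k)) * (W (Suc k) k - z * ?\<rho> (- int (Suc k)) * W k k)" for k
    proof -
      have 1: "corner_continuant z (r (Suc k)) (2 * Suc k + 1) = W (Suc k) (Suc k) - z * ?\<rho> (- int (Suc k)) * W k (Suc k)"
      proof -
        have "continuant z (r (Suc k)) (Suc (2 * Suc k)) = W (Suc k) (Suc k)"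
          unfolding W_def by (rule arg_cong2[where f = "continuant z"]) (simp_all add: r_def fun_eq_iff)
        moreover have "continuant z (shift 1 (r (Suc k))) (2 * Suc k) = W k (Suc k)"
          unfolding W_def by (rule arg_cong2[where f = "continuant z"]) (simp_all add: r_def fun_eq_iff)
        moreover have "r (Suc k) 0 = ?\<rho> (- int (Suc k))" by (simp add: r_def)
        ultimately show ?thesis
          using corner_continuant_eq[of z "r (Suc k)" "2 * Suc k"] by simp
      qed
      have 2: "corner_continuant z (r (Suc k)) (2 * Suc k) = W (Suc k) k - z * ?\<rho> (- int (Suc k)) * W k k"
      proof -
        have "continuant z (r (Suc k)) (Suc (Suc (2 * k))) = W (Suc k) k"
          unfolding W_def by (rule arg_cong2[where f = "continuant z"]) (simp_all add: r_def fun_eq_iff)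
        moreover have "continuant z (shift 1 (r (Suc k))) (Suc (2 * k)) = W k k"
          unfolding W_def by (rule arg_cong2[where f = "continuant z"]) (simp_all add: r_def fun_eq_iff)
        moreover have "r (Suc k) 0 = ?\<rho> (- int (Suc k))" by (simp add: r_def)
        ultimately show ?thesis
          using corner_continuant_eq[of z "r (Suc k)" "Suc (2 * k)"] by simp
      qed
      have 3: "r (Suc k) (2 * Suc k) = ?\<rho> (int (Suc k))" by (simp add: r_def)
      show ?thesis unfolding Y_def 1 2 3 ..
    qed
    have r1: "(\<lambda>k. ?\<rho> (int (Suc k))) \<longlonglongrightarrow> 1" "(\<lambda>k. ?\<rho> (- int (Suc k))) \<longlonglongrightarrow> 1"
      using admissible admissible_tendsto[of "\<lambda>n. ?\<rho> (1 + int n)"] admissible_tendsto[of "\<lambda>n. ?\<rho> (- 1 - int n)"]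
      by (simp_all add: admissible2_def)
    have "(\<lambda>k. Y (Suc k)) \<longlonglongrightarrow> evans z ?\<rho> - z * 1 * evans z ?\<rho> - z * 1 * (evans z ?\<rho> - z * 1 * evans z ?\<rho>)"
      unfolding Yeq by (intro tendsto_intros Wl fs fi r1)
    also have "evans z ?\<rho> - z * 1 * evans z ?\<rho> - z * 1 * (evans z ?\<rho> - z * 1 * evans z ?\<rho>) = (1 - z)^2 * evans z ?\<rho>"
      by (simp add: algebra_simps power2_eq_square)
    finally show ?thesis by (rule LIMSEQ_imp_Suc)
  qed
  have su: "(sin (of_real pi * u))^2 \<noteq> 0"
    using L u2 complex_sin_pi_eq_0[of u] by auto
  have evans_at: "\<forall>\<^sub>F N in sequentially. S N u \<noteq> 0"
    using tendsto_imp_eventually_ne[OF Slim su] .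
  have "(\<lambda>N. S N v * Y N / ((1 - z) * S N u)) \<longlonglongrightarrow> (sin (of_real pi * v))^2 * ((1 - z)^2 * evans z (complex_weight w 0)) / ((1 - z) * (sin (of_real pi * u))^2)"
    using z1 su by (intro tendsto_intros Slim Ylim) auto
  then have "(\<lambda>N. Determinant.det (hill_matrix c \<Lambda> N)) \<longlonglongrightarrow> (sin (of_real pi * v))^2 * ((1 - z)^2 * evans z (complex_weight w 0)) / ((1 - z) * (sin (of_real pi * u))^2)"
  proof (rule Lim_transform_eventually)
    show "\<forall>\<^sub>F N in sequentially. S N v * Y N / ((1 - z) * S N u) = Determinant.det (hill_matrix c \<Lambda> N)"
      using evans_at by eventually_elim (use z1 in \<open>simp add: fin[symmetric]\<close>)
  qed
  then have "hill_det c \<Lambda> = (sin (of_real pi * v))^2 * ((1 - z)^2 * evans z (complex_weight w 0)) / ((1 - z) * (sin (of_real pi * u))^2)"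
    unfolding hill_det_def by (rule limI)
  then show ?thesis using z1 su by (simp add: u_def v_def power2_eq_square)
qed

text \<open>
Minus the product D(\<Lambda>) sin^2(\<pi> sqrt \<Lambda>) at \<Lambda> = g_0 - d^2, as a function
of z = s^2.
\<close>

definition hill_fun :: "real \<Rightarrow> complex \<Rightarrow> complex" where
  "hill_fun d z = (1 - z) * of_real (sinh (pi * d))^2 * evans z (complex_weight (of_real (d^2)) 0)"

text \<open>
The right-hand side of the formula for non-exceptional \<Lambda> is continuous in \<Lambda>, so the
extension by continuity at squares of integers is given by the same expression.
\<close>

lemma hill_sin2_eq:
  assumes c: "c \<notin> cut" and d: "d \<noteq> 0"
  shows "hill_sin2 c (g c 0 - (of_real d)^2) = - hill_fun d ((s_of c)^2)"
proof -
  define z where "z = (s_of c)^2"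
  define \<Lambda> where "\<Lambda> = g c 0 - (of_real d)^2"
  define F where "F y = (1 - z) * evans z (complex_weight (g c 0 - y) 0) * (sin (of_real pi * csqrt (- (g c 0 - y))))^2" for y
  have z: "norm z < 1" using norm_power2_less_1 s_of_explicit(4)[OF c] by (simp add: z_def)
  have d2: "Re ((of_real d)^2) > 0" using d by (simp flip: of_real_power)
  have FL: "F \<Lambda> = - hill_fun d z"
  proof -
    have "(sin (of_real pi * csqrt (- ((of_real d)^2))))^2 = (sin (of_real pi * (\<i> * of_real d)))^2"
      by (rule sin2_root_indep) (simp only: power2_csqrt power_mult_distrib, simp)
    also have "sin (of_real pi * (\<i> * of_real d)) = \<i> * of_real (sinh (pi * d))"
    proof -
      have "sin (of_real pi * (\<i> * of_real d)) = sin (\<i> * of_real (pi * d))" by (simp add: mult_ac)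
      also have "\<dots> = \<i> * of_real (sinh (pi * d))" by (rule sin_i_times)
      finally show ?thesis .
    qed
    finally show ?thesis by (simp add: F_def \<Lambda>_def hill_fun_def power_mult_distrib mult_ac)
  qed
  have "hill_sin2 c \<Lambda> = F \<Lambda>"
  proof (cases "\<exists>n::int. \<Lambda> = (of_int n)^2")
    case False
    then have "hill_sin2 c \<Lambda> = hill_det c \<Lambda> * (sin (of_real pi * csqrt \<Lambda>))^2"
      by (simp add: hill_sin2_def)
    also have "\<dots> = F \<Lambda>"
      unfolding F_def z_def by (rule hill_det_evans[OF c]) (use False d2 in \<open>auto simp: \<Lambda>_def\<close>)
    finally show ?thesis .
  next
    case True
    then obtain n :: int where n: "\<Lambda> = (of_int n)^2" by blast
    \<comment> \<open>Squares of integers are isolated, so the formula holds in a punctured neighbourhood.\<close>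
    have sq: "\<forall>\<^sub>F y in at \<Lambda>. \<forall>m::int. y \<noteq> (of_int m)^2"
    proof -
      have "\<forall>\<^sub>F y in at \<Lambda>. dist y \<Lambda> < 1 \<and> y \<noteq> \<Lambda>"
        unfolding eventually_at by (intro exI[of _ 1]) auto
      then show ?thesis
      proof eventually_elim
        case (elim y)
        show ?case
        proof (intro allI notI)
          fix m :: int assume m: "y = (of_int m)^2"
          have "dist y \<Lambda> = \<bar>real_of_int (m^2 - n^2)\<bar>"
            unfolding m n dist_norm by (simp flip: of_int_power of_int_diff)
          then have "m^2 = n^2" using elim by (simp only: flip: of_int_abs) linarith
          then have "y = \<Lambda>" unfolding m n by (simp flip: of_int_power)
          then show False using elim by simp
        qed
      qed
    qed
    have re: "\<forall>\<^sub>F y in at \<Lambda>. Re (g c 0 - y) > 0"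
    proof -
      have "((\<lambda>y. Re (g c 0 - y)) \<longlongrightarrow> Re (g c 0 - \<Lambda>)) (at \<Lambda>)" by (intro tendsto_intros)
      then show ?thesis using d2 by (intro order_tendstoD(1)) (auto simp: \<Lambda>_def)
    qed
    have evans_at: "\<forall>\<^sub>F y in at \<Lambda>. F y = hill_det c y * (sin (of_real pi * csqrt y))^2"
      using sq re by eventually_elim (use hill_det_evans[OF c] in \<open>simp add: F_def z_def\<close>)
    have cF: "(F \<longlongrightarrow> F \<Lambda>) (at \<Lambda>)"
    proof -
      define A where "A = {w::complex. Re w > 0}"
      have A: "open A" unfolding A_def by (rule open_halfspace_Re_gt)
      have "(\<lambda>w. evans z (complex_weight w 0)) holomorphic_on A"
      proof (rule evans_holomorphic[OF A z])
        fix m :: int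
        have "(of_int m :: complex)^2 + w \<noteq> 0" if "w \<in> A" for w
        proof -
          have "(of_int m :: complex)^2 = of_real (m^2)" by simp
          then have "Re ((of_int m)^2 + w) = m^2 + Re w" by (metis Re_complex_of_real plus_complex.sel(1))
          then have "Re ((of_int m)^2 + w) > 0" using that by (simp add: A_def add_nonneg_pos)
          then show ?thesis by (metis less_irrefl zero_complex.sel(1))
        qed
        then show "(\<lambda>w. complex_weight w 0 m) holomorphic_on A"
          unfolding complex_weight_def by (intro holomorphic_intros) auto
      qed (auto simp: A_def intro!: admissible2_complex_weight_0 holomorphic_intros)
      moreover have "(of_real d)^2 \<in> A" using d2 by (simp add: A_def)
      ultimately have "isCont (\<lambda>w. evans z (complex_weight w 0)) ((of_real d)^2)"
        using A holomorphic_on_imp_continuous_on continuous_on_eq_continuous_at by blast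
      then have "isCont (\<lambda>w. evans z (complex_weight w 0)) (g c 0 - \<Lambda>)" by (simp add: \<Lambda>_def)
      moreover have aff: "isCont (\<lambda>y. g c 0 - y) \<Lambda>" by (intro continuous_intros)
      ultimately have e1: "isCont (\<lambda>y. evans z (complex_weight (g c 0 - y) 0)) \<Lambda>"
        by (rule isCont_o2[rotated])
      have "(\<lambda>y. (sin (of_real pi * csqrt (- (g c 0 - y))))^2) = (\<lambda>y. (sin (of_real pi * (\<i> * csqrt (g c 0 - y))))^2)"
        by (intro ext sin2_root_indep) (simp add: power_mult_distrib)
      moreover have "isCont (\<lambda>y. (sin (of_real pi * (\<i> * csqrt (g c 0 - y))))^2) \<Lambda>"
      proof -
        have "g c 0 - \<Lambda> \<notin> \<real>\<^sub>\<le>\<^sub>0" using d2 by (auto simp: \<Lambda>_def complex_nonpos_Reals_iff)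
        then have "isCont csqrt (g c 0 - \<Lambda>)" by (rule continuous_at_csqrt)
        then have "isCont (\<lambda>y. csqrt (g c 0 - y)) \<Lambda>" by (rule isCont_o2[OF aff])
        then show ?thesis by (intro continuous_intros)
      qed
      ultimately have e2: "isCont (\<lambda>y. (sin (of_real pi * csqrt (- (g c 0 - y))))^2) \<Lambda>" by simp
      have "isCont F \<Lambda>" unfolding F_def by (intro continuous_intros e1 e2)
      then show ?thesis by (simp add: isCont_def)
    qed
    have "((\<lambda>y. hill_det c y * (sin (of_real pi * csqrt y))^2) \<longlongrightarrow> F \<Lambda>) (at \<Lambda>)"
      by (rule Lim_transform_eventually[OF cF evans_at])
    then have "Lim (at \<Lambda>) (\<lambda>y. hill_det c y * (sin (of_real pi * csqrt y))^2) = F \<Lambda>"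
      by (intro tendsto_Lim) auto
    then show ?thesis using True by (simp add: hill_sin2_def)
  qed
  then show ?thesis using FL by (simp add: \<Lambda>_def z_def)
qed

lemma E_eq:
  assumes c: "c \<notin> cut" and d: "d \<noteq> 0"
  shows "E c \<theta> d = - 4 * (of_real ((sin (pi * \<theta>))^2) + hill_fun d ((s_of c)^2))"
proof -
  have h: "cos (2 * pi * \<theta>) = 1 - 2 * (sin (pi * \<theta>))^2"
    using cos_double_sin[of "pi * \<theta>"] by (simp add: mult.assoc)
  show ?thesis unfolding E_def hill_sin2_eq[OF c d] h by (simp add: algebra_simps)
qed

section \<open>Dependence on the Floquet exponent\<close>

definition sinc_pi :: "complex \<Rightarrow> complex" where
  "sinc_pi y = (if y = 0 then of_real pi else sin (of_real pi * y) / y)"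

lemma sinc_pi_holomorphic: "sinc_pi holomorphic_on S"
proof -
  have "((\<lambda>y. sin (of_real pi * y)) has_field_derivative of_real pi) (at 0)"
    by (auto intro!: derivative_eq_intros)
  then have d: "deriv (\<lambda>y. sin (of_real pi * y)) 0 = of_real pi" by (rule DERIV_imp_deriv)
  have "(\<lambda>y. if y = 0 then deriv (\<lambda>y. sin (of_real pi * y)) 0
       else (sin (of_real pi * y) - sin (of_real pi * 0)) / (y - 0)) holomorphic_on UNIV"
    by (rule pole_lemma) (auto intro!: holomorphic_intros)
  also have "(\<lambda>y. if y = 0 then deriv (\<lambda>y. sin (of_real pi * y)) 0
       else (sin (of_real pi * y) - sin (of_real pi * 0)) / (y - 0)) = sinc_pi"
    by (rule ext) (simp add: sinc_pi_def d)
  finally show ?thesis by (rule holomorphic_on_subset) simp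
qed

lemma sinc_pi_minus: "sinc_pi (- y) = sinc_pi y"
  by (simp add: sinc_pi_def)

lemma sinc_pi_mult: "y * sinc_pi y = sin (of_real pi * y)"
  by (simp add: sinc_pi_def)

lemma sinc_pi_nonzero: "\<bar>Re y\<bar> < 1 \<Longrightarrow> sinc_pi y \<noteq> 0"
proof
  assume y: "\<bar>Re y\<bar> < 1" "sinc_pi y = 0"
  then have "y \<noteq> 0" by (auto simp: sinc_pi_def)
  moreover have "sin (of_real pi * y) = 0" using y(2) sinc_pi_mult[of y] by simp
  then obtain n :: int where "of_real pi * y = of_real (of_int n * pi)"
    by (auto simp: Complex_Transcendental.sin_eq_0)
  then have "y = of_int n" by (simp add: mult.commute)
  ultimately show False using y(1) by auto
qed

text \<open>
A crude linear bound is enough: it is only used to see that 1 / sin tends to 0 towards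
\<plusminus>i\<infinity>.
\<close>

lemma norm_sin_lower:
  assumes "\<bar>Im y\<bar> \<ge> 1"
  shows "\<bar>Im y\<bar> \<le> norm (sin (of_real pi * y))^2"
proof -
  define t where "t = \<bar>Im y\<bar>"
  have "norm (sin (of_real pi * y))^2 = (exp (2 * (pi * Im y)) + inverse (exp (2 * (pi * Im y))) - 2 * cos (2 * (pi * Re y))) / 4"
    using norm_sin_squared[of "of_real pi * y"] by simp
  also have "exp (2 * (pi * Im y)) + inverse (exp (2 * (pi * Im y))) = exp (2 * (pi * t)) + exp (- (2 * (pi * t)))"
    by (cases "Im y \<ge> 0") (auto simp: t_def exp_minus)
  also have "exp (2 * (pi * t)) + exp (- (2 * (pi * t))) - 2 * cos (2 * (pi * Re y)) \<ge> (1 + 2 * (pi * t)) - 2"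
    using exp_ge_add_one_self[of "2 * (pi * t)"] cos_le_one[of "2 * (pi * Re y)"] exp_gt_zero[of "- (2 * (pi * t))"]
    by linarith
  moreover have "(1 + 2 * (pi * t)) - 2 \<ge> 4 * t"
  proof -
    have "3 * t \<le> pi * t" using pi_gt3 assms by (intro mult_right_mono) (auto simp: t_def)
    then show ?thesis using assms by (simp add: t_def)
  qed
  ultimately show ?thesis by (simp add: t_def)
qed

text \<open>
As a function of x the left-hand side is periodic with period 1, tends to 1/(1-z) towards
\<plusminus>i\<infinity>, and has in the strip at most simple poles at \<plusminus>id, which come
from the weight with index 0 alone. By symmetry under x \<mapsto> -x one constant C removes both
poles, and the maximum principle on one period strip shows that the function is constant.
\<close>

lemma evans_periodic_constant:
  fixes z :: complex and d :: real
  assumes z: "norm z < 1" and d: "d \<noteq> 0"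
  obtains C where "\<And>x. \<bar>Re x\<bar> < 3 / 4 \<Longrightarrow> x^2 + of_real (d^2) \<noteq> 0 \<Longrightarrow>
     evans z (complex_weight (of_real (d^2)) x) + C / (sin (of_real pi * (x - \<i> * of_real d)) * sin (of_real pi * (x + \<i> * of_real d))) = 1 / (1 - z)"
proof -
  define w where "w = complex_of_real (d^2)"
  define p where "p = \<i> * complex_of_real d"
  define S where "S = {x::complex. \<bar>Re x\<bar> < 3 / 4}"
  have S_eq: "S = {x. Re x < 3/4} \<inter> {x. Re x > -3/4}" by (auto simp: S_def abs_less_iff)
  have S: "open S" unfolding S_eq by (intro open_Int open_halfspace_Re_lt open_halfspace_Re_gt)
  have Sc: "connected S" unfolding S_eq
    by (intro convex_connected convex_Int convex_halfspace_Re_lt convex_halfspace_Re_gt)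
  have pS: "p \<in> S" "-p \<in> S" by (auto simp: S_def p_def)
  have p0: "p \<noteq> 0" using d by (simp add: p_def)
  have b_fac: "x^2 + w = (x - p) * (x + p)" for x
    by (simp add: w_def p_def algebra_simps power2_eq_square)
  have admissible: "admissible2 (complex_weight w x)" if "x \<in> S" for x
    unfolding w_def using that by (intro admissible2_complex_weight_strip) (auto simp: S_def)
  have bn0: "(x + of_int n)^2 + w \<noteq> 0" if "x \<in> S" "n \<noteq> 0" for x n
  proof -
    have "Re x + of_int n \<noteq> 0" using that by (auto simp: S_def abs_if split: if_splits)
    then have "(Re (x + of_int n))^2 > 0" by simp
    also have "(Re (x + of_int n))^2 \<le> norm ((x + of_int n)^2 + w)"
      unfolding w_def by (rule norm_sq_plus_real)
    finally show ?thesis by auto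
  qed
  have rho_hol: "(\<lambda>x. complex_weight w x n) holomorphic_on S" if "n \<noteq> 0" for n
    unfolding complex_weight_def using bn0 that by (intro holomorphic_intros) auto
  have R_hol: "(\<lambda>x. jost_right z (complex_weight w x) k) holomorphic_on S" if "k \<ge> 1" for k
    unfolding jost_right_def
    by (rule jost_holomorphic[OF S]) (use z that in \<open>auto intro!: admissible2_jost_right admissible rho_hol\<close>)
  have L_hol: "(\<lambda>x. jost_left z (complex_weight w x) k) holomorphic_on S" if "k \<le> -1" for k
    unfolding jost_left_def
    by (rule jost_holomorphic[OF S]) (use z that in \<open>auto intro!: admissible2_jost_left admissible rho_hol\<close>)
  define A where "A x = (1 + z) * jost_left z (complex_weight w x) (-1) * jost_right z (complex_weight w x) 1" for x
  define B where "B x = z * (complex_weight w x (-1) * jost_left z (complex_weight w x) (-2) * jost_right z (complex_weight w x) 1 + complex_weight w x 1 * jost_left z (complex_weight w x) (-1) * jost_right z (complex_weight w x) 2)" for x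
  have A_hol: "A holomorphic_on S" unfolding A_def by (intro holomorphic_intros R_hol L_hol) auto
  have B_hol: "B holomorphic_on S" unfolding B_def by (intro holomorphic_intros R_hol L_hol rho_hol) auto
  \<comment> \<open>Only the weight with index 0 has poles in the strip, and it enters affinely.\<close>
  have U_eq: "evans z (complex_weight w x) = A x - complex_weight w x 0 * B x" for x
    by (simp add: evans_def A_def B_def algebra_simps)
  have B_even: "B (- x) = B x" for x
  proof -
    have "complex_weight w (- x) n = complex_weight w x (- n)" for n
    proof -
      have "(- x + of_int n)^2 = (x + of_int (- n))^2" by (simp add: power2_eq_square algebra_simps)
      then show ?thesis by (simp add: complex_weight_def)
    qed
    then have "complex_weight w (- x) = (\<lambda>n. complex_weight w x (- n))" by blast
    then show ?thesis by (simp add: B_def jost_left_reflect algebra_simps)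
  qed
  define e where "e x = sinc_pi (x - p) * sinc_pi (x + p)" for x
  have e_hol: "e holomorphic_on S"
    unfolding e_def
    by (intro holomorphic_intros holomorphic_on_compose_gen[of _ S sinc_pi UNIV, unfolded o_def] sinc_pi_holomorphic) auto
  have e0: "e x \<noteq> 0" if "x \<in> S" for x
    using that sinc_pi_nonzero[of "x - p"] sinc_pi_nonzero[of "x + p"] by (auto simp: e_def S_def p_def)
  have e_even: "e (- x) = e x" for x
    using sinc_pi_minus[of "x + p"] sinc_pi_minus[of "x - p"] by (simp add: e_def)
  define q where "q x = sin (of_real pi * (x - p)) * sin (of_real pi * (x + p))" for x
  have q_eq: "q x = (x^2 + w) * e x" for x
    unfolding q_def b_fac e_def by (simp flip: sinc_pi_mult)
  \<comment> \<open>C is chosen to make h vanish at p, and then at -p as well because B and e are even.\<close>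
  define C where "C = - B p * e p"
  define h where "h x = B x + C / e x" for x
  have h_hol: "h holomorphic_on S" unfolding h_def by (intro holomorphic_intros B_hol e_hol) (use e0 in auto)
  have hp: "h p = 0" using e0[OF pS(1)] by (simp add: h_def C_def)
  have hmp: "h (- p) = 0" using hp by (simp add: h_def B_even e_even)
  \<comment> \<open>The two zeros of h are divided out one after the other.\<close>
  define h1 where "h1 x = (if x = p then deriv h p else (h x - h p) / (x - p))" for x
  have h1_hol: "h1 holomorphic_on S"
    unfolding h1_def using pole_lemma[OF h_hol, of p] S pS(1) by (simp add: interior_open)
  have h1mp: "h1 (- p) = 0" using p0 hp hmp by (simp add: h1_def)
  define h2 where "h2 x = (if x = - p then deriv h1 (- p) else (h1 x - h1 (- p)) / (x - (- p)))" for x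
  have h2_hol: "h2 holomorphic_on S"
    unfolding h2_def using pole_lemma[OF h1_hol, of "- p"] S pS(2) by (simp add: interior_open)
  have h2_eq: "h2 x = h x / (x^2 + w)" if "x^2 + w \<noteq> 0" for x
  proof -
    have "x \<noteq> p" "x \<noteq> - p" using that by (auto simp: b_fac)
    then have "h1 x = h x / (x - p)" "h2 x = h1 x / (x + p)"
      by (simp add: h1_def hp, simp add: h2_def h1mp)
    then show ?thesis by (simp add: b_fac)
  qed
  define G where "G x = A x - B x + h2 x" for x
  have G_hol: "G holomorphic_on S" unfolding G_def by (intro holomorphic_intros A_hol B_hol h2_hol)
  have G_eq: "G x = evans z (complex_weight w x) + C / q x" if "x \<in> S" "x^2 + w \<noteq> 0" for x
  proof -
    have "h2 x = B x / (x^2 + w) + C / ((x^2 + w) * e x)"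
      using h2_eq[OF that(2)] by (simp add: h_def add_divide_distrib mult.commute)
    moreover have "complex_weight w x 0 * B x = B x - B x / (x^2 + w)" by (simp add: complex_weight_def algebra_simps)
    ultimately show ?thesis unfolding G_def U_eq q_eq by simp
  qed
  have G_per: "G (x + 1) = G x" if "x \<in> S" "x + 1 \<in> S" for x
  proof -
    have "Re x \<noteq> 0" "Re (x + 1) \<noteq> 0" using that by (auto simp: S_def abs_if split: if_splits)
    then have "(Re x)^2 > 0" "(Re (x+1))^2 > 0" by auto
    moreover have "(Re x)^2 \<le> norm (x^2 + w)" "(Re (x+1))^2 \<le> norm ((x+1)^2 + w)"
      unfolding w_def by (rule norm_sq_plus_real)+
    ultimately have n0: "x^2 + w \<noteq> 0" "(x+1)^2 + w \<noteq> 0" by (metis norm_zero not_le)+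
    have rs: "complex_weight w (x + 1) = (\<lambda>n. complex_weight w x (n + 1))"
      by (rule ext) (simp add: complex_weight_def add_ac)
    have "evans z (complex_weight w (x + 1)) = evans z (complex_weight w x)"
      unfolding rs by (rule evans_shift[OF z admissible[OF that(1)]]) (use admissible[OF that(2)] in \<open>simp add: rs\<close>)
    moreover have "q (x + 1) = q x"
    proof -
      have "sin (of_real pi * (x + 1 - p)) = - sin (of_real pi * (x - p))"
        "sin (of_real pi * (x + 1 + p)) = - sin (of_real pi * (x + p))"
        using sin_plus_pi[of "of_real pi * (x - p)"] sin_plus_pi[of "of_real pi * (x + p)"]
        by (simp_all add: algebra_simps)
      then show ?thesis by (simp add: q_def)
    qed
    ultimately show ?thesis using G_eq that n0 by simp
  qed
  \<comment> \<open>F is the filter of points of the strip with large imaginary part.\<close>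
  define F where "F = inf (filtercomap (\<lambda>x::complex. \<bar>Im x\<bar>) at_top) (principal S)"
  have evF: "eventually P F \<longleftrightarrow> (\<exists>Y. \<forall>x. \<bar>Im x\<bar> \<ge> Y \<longrightarrow> x \<in> S \<longrightarrow> P x)" for P
    unfolding F_def eventually_inf_principal eventually_filtercomap_at_top_linorder by simp
  have F0: "F \<noteq> bot"
  proof
    assume "F = bot"
    then have "eventually (\<lambda>_. False) F" by simp
    then obtain Y where "\<And>x. \<bar>Im x\<bar> \<ge> Y \<Longrightarrow> x \<notin> S" unfolding evF by blast
    from this[of "\<i> * of_real \<bar>Y\<bar>"] show False using abs_ge_self[of Y] by (simp add: S_def)
  qed
  have ImF: "filterlim (\<lambda>x. \<bar>Im x\<bar> - \<bar>d\<bar>) at_top F"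
    unfolding filterlim_at_top
  proof
    fix Z :: real
    show "\<forall>\<^sub>F x in F. Z \<le> \<bar>Im x\<bar> - \<bar>d\<bar>"
      unfolding evF by (intro exI[of _ "Z + \<bar>d\<bar>"]) auto
  qed
  have ImF1: "\<forall>\<^sub>F x in F. \<bar>Im x\<bar> - \<bar>d\<bar> \<ge> 1" using ImF by (simp add: filterlim_at_top)
  have inv0: "((\<lambda>x. K / (\<bar>Im x\<bar> - \<bar>d\<bar>)) \<longlongrightarrow> 0) F" for K :: real
    using tendsto_divide_0[OF tendsto_const filterlim_at_top_imp_at_infinity[OF ImF]] by blast
  have rho_lim: "((\<lambda>x. complex_weight w x n) \<longlongrightarrow> 1) F" for n
  proof -
    have "((\<lambda>x. 1 / ((x + of_int n)^2 + w)) \<longlongrightarrow> 0) F"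
    proof (rule Lim_null_comparison[OF _ inv0[of 1]])
      show "\<forall>\<^sub>F x in F. norm (1 / ((x + of_int n)^2 + w)) \<le> 1 / (\<bar>Im x\<bar> - \<bar>d\<bar>)"
        using ImF1
      proof eventually_elim
        case (elim x)
        define t where "t = \<bar>Im x\<bar> - \<bar>d\<bar>"
        have "t \<le> norm (x + of_int n - p)" "t \<le> norm (x + of_int n + p)"
          using abs_Im_le_cmod[of "x + of_int n - p"] abs_Im_le_cmod[of "x + of_int n + p"]
          by (auto simp: t_def p_def)
        then have "t * t \<le> norm ((x + of_int n)^2 + w)"
          unfolding b_fac norm_mult using elim by (intro mult_mono) (auto simp: t_def)
        moreover have "t \<le> t * t" using elim mult_left_mono[of 1 t t] by (simp add: t_def)
        ultimately have "t \<le> norm ((x + of_int n)^2 + w)" by linarith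
        then have "1 / norm ((x + of_int n)^2 + w) \<le> 1 / t"
          using elim by (intro divide_left_mono mult_pos_pos) (auto simp: t_def)
        then show ?case by (simp add: norm_divide t_def)
      qed
    qed
    then have "((\<lambda>x. 1 - 1 / ((x + of_int n)^2 + w)) \<longlongrightarrow> 1 - 0) F" by (intro tendsto_intros)
    then show ?thesis by (simp add: complex_weight_def)
  qed
  have SF: "\<forall>\<^sub>F x in F. x \<in> S" unfolding evF by auto
  have U_lim: "((\<lambda>x. evans z (complex_weight w x)) \<longlongrightarrow> 1 / (1 - z)) F"
    by (rule evans_tendsto_1[OF z _ rho_lim F0]) (use SF admissible in \<open>auto elim!: eventually_mono\<close>)
  have q_lim: "((\<lambda>x. C / q x) \<longlongrightarrow> 0) F"
  proof (rule Lim_null_comparison[OF _ inv0[of "norm C"]])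
    show "\<forall>\<^sub>F x in F. norm (C / q x) \<le> norm C / (\<bar>Im x\<bar> - \<bar>d\<bar>)"
      using ImF1
    proof eventually_elim
      case (elim x)
      define t where "t = \<bar>Im x\<bar> - \<bar>d\<bar>"
      have "t \<le> \<bar>Im (x - p)\<bar>" "t \<le> \<bar>Im (x + p)\<bar>" by (auto simp: t_def p_def)
      then have "t \<le> norm (sin (of_real pi * (x - p)))^2" "t \<le> norm (sin (of_real pi * (x + p)))^2"
        using norm_sin_lower[of "x - p"] norm_sin_lower[of "x + p"] elim by (auto simp: t_def)
      then have "t * t \<le> norm (sin (of_real pi * (x - p)))^2 * norm (sin (of_real pi * (x + p)))^2"
        using elim by (intro mult_mono) (auto simp: t_def)
      then have "t^2 \<le> norm (q x)^2" by (simp add: q_def norm_mult power_mult_distrib power2_eq_square[of t])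
      then have "t \<le> norm (q x)" by (rule power2_le_imp_le) simp
      then show ?case unfolding norm_divide t_def[symmetric]
        using elim by (intro divide_left_mono mult_pos_pos) (auto simp: t_def)
    qed
  qed
  have G_lim: "(G \<longlongrightarrow> 1 / (1 - z)) F"
  proof -
    have "((\<lambda>x. evans z (complex_weight w x) + C / q x) \<longlongrightarrow> 1 / (1 - z) + 0) F"
      by (intro tendsto_add U_lim q_lim)
    then have "((\<lambda>x. evans z (complex_weight w x) + C / q x) \<longlongrightarrow> 1 / (1 - z)) F" by simp
    then show ?thesis
    proof (rule Lim_transform_eventually)
      show "\<forall>\<^sub>F x in F. evans z (complex_weight w x) + C / q x = G x"
        using ImF1 SF
      proof eventually_elim
        case (elim x)
        have "x \<noteq> p" "x \<noteq> - p" using elim(1) by (auto simp: p_def)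
        then have "x^2 + w \<noteq> 0" by (simp add: b_fac eq_neg_iff_add_eq_0)
        then show ?case using G_eq elim(2) by simp
      qed
    qed
  qed
  define H where "H x = G x - 1 / (1 - z)" for x
  have H_hol: "H holomorphic_on S" unfolding H_def by (intro holomorphic_intros G_hol)
  have H_lim: "(H \<longlongrightarrow> 0) F" unfolding H_def using G_lim by (simp add: LIM_zero)
  \<comment> \<open>By periodicity every value is taken in the closed strip of width 1, where the maximum is attained.\<close>
  have shift: "\<exists>y. y \<in> S \<and> \<bar>Re y\<bar> \<le> 1 / 2 \<and> Im y = Im x \<and> H y = H x" if "x \<in> S" for x
  proof -
    consider "\<bar>Re x\<bar> \<le> 1 / 2" | "Re x > 1 / 2" | "Re x < - 1 / 2" by linarith
    then show ?thesis
    proof cases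
      case 1 then show ?thesis using that by blast
    next
      case 2
      then have "x - 1 \<in> S" "\<bar>Re (x - 1)\<bar> \<le> 1 / 2" using that by (auto simp: S_def)
      then show ?thesis using G_per[of "x - 1"] that by (intro exI[of _ "x - 1"]) (auto simp: H_def)
    next
      case 3
      then have "x + 1 \<in> S" "\<bar>Re (x + 1)\<bar> \<le> 1 / 2" using that by (auto simp: S_def)
      then show ?thesis using G_per[of x] that by (intro exI[of _ "x + 1"]) (auto simp: H_def)
    qed
  qed
  have H0: "H x1 = 0" if x1: "x1 \<in> S" for x1
  proof (rule ccontr)
    assume nz: "H x1 \<noteq> 0"
    have "\<forall>\<^sub>F x in F. norm (H x) < norm (H x1)"
      using order_tendstoD(2)[OF tendsto_norm[OF H_lim], of "norm (H x1)"] nz by simp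
    then obtain Y where Y: "\<And>x. \<bar>Im x\<bar> \<ge> Y \<Longrightarrow> x \<in> S \<Longrightarrow> norm (H x) < norm (H x1)"
      unfolding evF by blast
    define K where "K = cbox (Complex (- 1 / 2) (- Y)) (Complex (1 / 2) Y)"
    have Kmem: "x \<in> K \<longleftrightarrow> \<bar>Re x\<bar> \<le> 1 / 2 \<and> \<bar>Im x\<bar> \<le> Y" for x
      by (auto simp: K_def in_cbox_complex_iff abs_le_iff)
    have KS: "K \<subseteq> S" by (auto simp: Kmem S_def)
    obtain y1 where y1: "y1 \<in> S" "\<bar>Re y1\<bar> \<le> 1 / 2" "H y1 = H x1" using shift[OF x1] by blast
    have "\<not> Y \<le> \<bar>Im y1\<bar>" using Y[of y1] y1 by auto
    then have "y1 \<in> K" using y1 by (simp add: Kmem)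
    have "continuous_on K (\<lambda>x. norm (H x))"
      using holomorphic_on_imp_continuous_on[OF H_hol] KS by (intro continuous_intros) (rule continuous_on_subset)
    then obtain \<xi> where \<xi>: "\<xi> \<in> K" "\<And>x. x \<in> K \<Longrightarrow> norm (H x) \<le> norm (H \<xi>)"
      using continuous_attains_sup[of K "\<lambda>x. norm (H x)"] \<open>y1 \<in> K\<close> by (auto simp: K_def)
    have max: "norm (H x) \<le> norm (H \<xi>)" if xS: "x \<in> S" for x
    proof -
      obtain y where y: "y \<in> S" "\<bar>Re y\<bar> \<le> 1 / 2" "H y = H x" using shift[OF xS] by blast
      have "norm (H y) \<le> norm (H \<xi>)"
      proof (cases "\<bar>Im y\<bar> \<le> Y")
        case True
        then have "y \<in> K" using y by (simp add: Kmem)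
        then show ?thesis by (rule \<xi>(2))
      next
        case False
        then have "norm (H y) < norm (H y1)" using Y[of y] y y1 by simp
        also have "\<dots> \<le> norm (H \<xi>)" using \<xi>(2) \<open>y1 \<in> K\<close> by blast
        finally show ?thesis by simp
      qed
      then show ?thesis by (simp add: y)
    qed
    have "H constant_on S"
      by (rule maximum_modulus_principle[OF H_hol S Sc S order_refl]) (use max \<xi> KS in auto)
    then obtain k where k: "\<And>x. x \<in> S \<Longrightarrow> H x = k" by (auto simp: constant_on_def)
    have "(H \<longlongrightarrow> k) F"
      by (rule tendsto_eventually) (use SF k in \<open>auto elim!: eventually_mono\<close>)
    then have "k = 0" using H_lim tendsto_unique[OF F0] by blast
    then show False using k[OF x1] nz by simp
  qed
  show thesis
  proof (rule that[of C])
    fix x :: complex assume "\<bar>Re x\<bar> < 3 / 4" "x^2 + of_real (d^2) \<noteq> 0"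
    then have "x \<in> S" "x^2 + w \<noteq> 0" by (auto simp: S_def w_def)
    then show "evans z (complex_weight (of_real (d^2)) x) + C / (sin (of_real pi * (x - \<i> * of_real d)) * sin (of_real pi * (x + \<i> * of_real d))) = 1 / (1 - z)"
      using H0[of x] G_eq[of x] by (simp add: H_def q_def p_def w_def)
  qed
qed

section \<open>The characteristic function at real parameters\<close>

definition weight :: "real \<Rightarrow> real \<Rightarrow> int \<Rightarrow> real" where
  "weight \<theta> d n = 1 - 1 / ((\<theta> + of_int n)^2 + d^2)"

definition evans_at :: "real \<Rightarrow> real \<Rightarrow> complex \<Rightarrow> complex" where
  "evans_at \<theta> d z = evans z (\<lambda>n. of_real (weight \<theta> d n))"

lemma complex_weight_of_real: "complex_weight (of_real (d^2)) (of_real \<theta>) = (\<lambda>n. of_real (weight \<theta> d n))"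
  by (rule ext) (simp add: complex_weight_def weight_def)

lemma admissible2_weight: "\<bar>\<theta>\<bar> \<le> 3 / 4 \<Longrightarrow> admissible2 (\<lambda>n. of_real (weight \<theta> d n))"
  using admissible2_complex_weight_strip[of "of_real \<theta>" d] unfolding complex_weight_of_real by simp

lemma hill_fun_evans_at: "hill_fun d z = (1 - z) * of_real (sinh (pi * d))^2 * evans_at 0 d z"
  using complex_weight_of_real[of d 0] by (simp add: hill_fun_def evans_at_def)

text \<open>
Eliminating the constant C between x = \<theta> and x = 0 expresses the characteristic function, in
which \<theta> enters only through an additive term, by the two-sided limit at \<theta>, in which
\<theta> enters through the weights.
\<close>

lemma theta_dependence:
  assumes \<theta>: "\<bar>\<theta>\<bar> < 3 / 4" and d: "d \<noteq> 0" and z: "norm z < 1"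
  shows "of_real ((sin (pi * \<theta>))^2) + hill_fun d z = (1 - z) * of_real ((sin (pi * \<theta>))^2 + (sinh (pi * d))^2) * evans_at \<theta> d z"
proof -
  obtain C where C: "\<And>x. \<bar>Re x\<bar> < 3 / 4 \<Longrightarrow> x^2 + of_real (d^2) \<noteq> 0 \<Longrightarrow>
     evans z (complex_weight (of_real (d^2)) x) + C / (sin (of_real pi * (x - \<i> * of_real d)) * sin (of_real pi * (x + \<i> * of_real d))) = 1 / (1 - z)"
    using evans_periodic_constant[OF z d] by blast
  have z1: "1 - z \<noteq> 0" using z by auto
  have main: "(1 - z) * of_real ((sin (pi * t))^2 + (sinh (pi * d))^2) * evans_at t d z =
     of_real ((sin (pi * t))^2 + (sinh (pi * d))^2) - (1 - z) * C" if t: "\<bar>t\<bar> < 3 / 4" for t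
  proof -
    have n0: "t^2 + d^2 \<noteq> 0" using d by (simp add: sum_power2_eq_zero_iff)
    have "(complex_of_real t)^2 + of_real (d^2) = of_real (t^2 + d^2)" by simp
    also have "\<dots> \<noteq> 0" using n0 by (simp only: of_real_eq_0_iff not_False_eq_True)
    finally have nz: "(complex_of_real t)^2 + of_real (d^2) \<noteq> 0" .
    define Q where "Q = (sin (pi * t))^2 + (sinh (pi * d))^2"
    have Q0: "Q \<noteq> 0"
    proof -
      have "sinh (pi * d) \<noteq> 0" using d by simp
      then have "(sinh (pi * d))^2 > 0" by simp
      then show ?thesis unfolding Q_def by (smt (verit) zero_le_power2)
    qed
    note sh = sin_i_times[of "pi * d"]
    have prod: "sin (a - b) * sin (a + b) = (sin a)^2 - (sin b)^2" for a b :: complex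
    proof -
      have "sin (a - b) * sin (a + b) = (sin a)^2 * (cos b)^2 - (cos a)^2 * (sin b)^2"
        by (simp add: sin_add sin_diff algebra_simps power2_eq_square)
      then show ?thesis unfolding cos_squared_eq by (simp add: algebra_simps)
    qed
    have q: "sin (of_real pi * (of_real t - \<i> * of_real d)) * sin (of_real pi * (of_real t + \<i> * of_real d)) = of_real Q"
    proof -
      have "sin (of_real pi * (of_real t - \<i> * of_real d)) * sin (of_real pi * (of_real t + \<i> * of_real d))
         = sin (of_real (pi * t) - \<i> * of_real (pi * d)) * sin (of_real (pi * t) + \<i> * of_real (pi * d))"
        by (simp add: algebra_simps)
      also have "\<dots> = (sin (of_real (pi * t)))^2 - (\<i> * of_real (sinh (pi * d)))^2"
        unfolding prod sh ..
      finally show ?thesis by (simp only: Q_def power_mult_distrib i_squared sin_of_real) simp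
    qed
    have "evans_at t d z + C / of_real Q = 1 / (1 - z)"
      using C[of "of_real t"] t nz unfolding q complex_weight_of_real evans_at_def by simp
    then have "(1 - z) * of_real Q * (evans_at t d z + C / of_real Q) = of_real Q"
      using z1 by simp
    then show ?thesis using Q0 unfolding Q_def[symmetric] by (simp add: algebra_simps)
  qed
  have "hill_fun d z = of_real ((sinh (pi * d))^2) - (1 - z) * C"
    using main[of 0] by (simp add: hill_fun_evans_at)
  then show ?thesis using main[OF \<theta>] by simp
qed

lemma evans_at_holomorphic: "\<bar>\<theta>\<bar> \<le> 3 / 4 \<Longrightarrow> evans_at \<theta> d holomorphic_on ball 0 1"
  unfolding evans_at_def by (rule evans_holomorphic) (auto intro!: admissible2_weight)

lemma hill_fun_holomorphic: "hill_fun d holomorphic_on ball 0 1"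
proof -
  have "(\<lambda>z. (1 - z) * of_real (sinh (pi * d))^2 * evans_at 0 d z) holomorphic_on ball 0 1"
    by (intro holomorphic_intros evans_at_holomorphic) auto
  then show ?thesis by (simp add: hill_fun_evans_at[abs_def])
qed

lemma evans_at_cnj: "\<bar>\<theta>\<bar> \<le> 3 / 4 \<Longrightarrow> norm z < 1 \<Longrightarrow> evans_at \<theta> d (cnj z) = cnj (evans_at \<theta> d z)"
  using evans_cnj[OF _ admissible2_weight] by (simp add: evans_at_def)

lemma hill_fun_cnj: "norm z < 1 \<Longrightarrow> hill_fun d (cnj z) = cnj (hill_fun d z)"
  by (simp add: hill_fun_evans_at evans_at_cnj)

section \<open>Signs on the real axis\<close>

definition jost_real :: "real \<Rightarrow> (int \<Rightarrow> real) \<Rightarrow> int \<Rightarrow> real" where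
  "jost_real x \<rho> k = Re (jost_right (of_real x) (\<lambda>n. of_real (\<rho> n)) k)"

lemma jost_right_of_real:
  assumes "\<bar>x\<bar> < 1" "admissible2 (\<lambda>n. of_real (\<rho> n))" "k \<ge> 1"
  shows "jost_right (of_real x) (\<lambda>n. of_real (\<rho> n)) k = of_real (jost_real x \<rho> k)"
proof -
  have "cnj (jost_right (of_real x) (\<lambda>n. of_real (\<rho> n)) k) = jost_right (of_real x) (\<lambda>n. of_real (\<rho> n)) k"
    unfolding jost_right_def using jost_cnj[of "of_real x", OF _ admissible2_jost_right[OF assms(2,3)]] assms(1) by simp
  then have "jost_right (of_real x) (\<lambda>n. of_real (\<rho> n)) k \<in> \<real>" by (simp add: Reals_cnj_iff)
  then show ?thesis by (simp add: jost_real_def)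
qed

lemma jost_left_of_real:
  assumes "\<bar>x\<bar> < 1" "admissible2 (\<lambda>n. of_real (\<rho> n))" "k \<ge> 1"
  shows "jost_left (of_real x) (\<lambda>n. of_real (\<rho> n)) (- k) = of_real (jost_real x (\<lambda>n. \<rho> (- n)) k)"
  using jost_right_of_real[OF assms(1) admissible2_reflect[OF assms(2)] assms(3)] by (simp add: jost_left_reflect)

lemma evans_of_real:
  assumes "\<bar>x\<bar> < 1" "admissible2 (\<lambda>n. of_real (\<rho> n))"
  defines "R \<equiv> jost_real x \<rho>" and "L \<equiv> jost_real x (\<lambda>n. \<rho> (- n))"
  shows "evans (of_real x) (\<lambda>n. of_real (\<rho> n)) =
    of_real ((1 + x) * L 1 * R 1 - x * \<rho> 0 * (\<rho> (-1) * L 2 * R 1 + \<rho> 1 * L 1 * R 2))"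
  using jost_right_of_real[OF assms(1,2), of 1] jost_right_of_real[OF assms(1,2), of 2]
    jost_left_of_real[OF assms(1,2), of 1] jost_left_of_real[OF assms(1,2), of 2]
  by (simp add: evans_def R_def L_def)

lemma jost_real_rec:
  assumes "\<bar>x\<bar> < 1" "admissible2 (\<lambda>n. of_real (\<rho> n))" "k \<ge> 1"
  shows "jost_real x \<rho> k = (1 + x) * jost_real x \<rho> (k + 1) - x * \<rho> k * \<rho> (k + 1) * jost_real x \<rho> (k + 2)"
proof -
  have "complex_of_real (jost_real x \<rho> k) = of_real ((1 + x) * jost_real x \<rho> (k + 1) - x * \<rho> k * \<rho> (k + 1) * jost_real x \<rho> (k + 2))"
    using jost_right_rec[of "of_real x", OF _ assms(2,3)] jost_right_of_real[OF assms(1,2)] assms(1,3) by simp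
  then show ?thesis by (simp only: of_real_eq_iff)
qed

lemma jost_real_tendsto:
  assumes "\<bar>x\<bar> < 1" "admissible2 (\<lambda>n. of_real (\<rho> n))"
  shows "(\<lambda>k. jost_real x \<rho> (int k)) \<longlonglongrightarrow> 1 / (1 - x)"
proof -
  have "(\<lambda>k. jost_real x \<rho> (int k)) \<longlonglongrightarrow> Re (1 / (1 - of_real x))"
    unfolding jost_real_def by (intro tendsto_intros jost_right_tendsto) (use assms in auto)
  moreover have "1 / (1 - complex_of_real x) = of_real (1 / (1 - x))" by simp
  ultimately show ?thesis by (metis Re_complex_of_real)
qed

lemma continuant_tendsto_jost_real:
  assumes "\<bar>x\<bar> < 1" "admissible2 (\<lambda>n. of_real (\<rho> n))" "k \<ge> 1"
  shows "continuant x (\<lambda>n. \<rho> (k + int n)) \<longlonglongrightarrow> jost_real x \<rho> k"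
proof -
  have "(\<lambda>n. Re (continuant (of_real x) (\<lambda>n. of_real (\<rho> (k + int n))) n)) \<longlonglongrightarrow> jost_real x \<rho> k"
    unfolding jost_real_def jost_right_def by (intro tendsto_intros continuant_tendsto_jost admissible2_jost_right[OF assms(2,3)]) (use assms in auto)
  then show ?thesis unfolding continuant_of_real by simp
qed

lemma continuant_increasing:
  fixes x :: real
  assumes x: "0 \<le> x" and r: "\<And>n. 0 \<le> r n" "\<And>n. r n \<le> 1"
  shows "1 \<le> continuant x r n \<and> continuant x r n \<le> continuant x r (Suc n)"
proof (induction n)
  case (Suc n)
  have "r n * r (Suc n) * continuant x r n \<le> 1 * continuant x r n"
    using r Suc by (intro mult_right_mono) (auto simp: mult_le_one)
  then have "r n * r (Suc n) * continuant x r n \<le> continuant x r (Suc n)" using Suc by linarith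
  then have "x * (r n * r (Suc n) * continuant x r n) \<le> x * continuant x r (Suc n)"
    using x by (rule mult_left_mono)
  then show ?case using Suc by (simp add: algebra_simps)
qed (use x in simp)

lemma continuant_shift_le:
  fixes x :: real
  assumes x: "0 \<le> x" and r: "\<And>n. 0 \<le> r n" "\<And>n. r n \<le> 1"
  shows "continuant x (shift 1 r) n \<le> continuant x r (Suc n)"
  using r
proof (induction n arbitrary: r)
  case (Suc n)
  have IH: "continuant x (shift 2 r) n \<le> continuant x (shift 1 r) (Suc n)"
    using Suc.IH[of "shift 1 r"] Suc.prems by (simp add: numeral_2_eq_2)
  have "continuant x (shift 2 r) n \<ge> 1" using continuant_increasing[OF x, of "shift 2 r"] Suc.prems by blast
  then have "r 0 * r 1 * continuant x (shift 2 r) n \<le> 1 * continuant x (shift 2 r) n"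
    using Suc.prems by (intro mult_right_mono) (auto simp: mult_le_one)
  then have "r 0 * r 1 * continuant x (shift 2 r) n \<le> continuant x (shift 1 r) (Suc n)" using IH by linarith
  then have "x * (r 0 * r 1 * continuant x (shift 2 r) n) \<le> x * continuant x (shift 1 r) (Suc n)"
    using x by (rule mult_left_mono)
  then show ?case unfolding continuant_jost_left[of x r n] by (simp add: algebra_simps)
qed (use x in simp)

text \<open>
The only weight that can be negative is \<rho>_0, and for \<theta> = 0 and z in [0,1) the
continuants grow monotonically, so the two-sided limit is bounded below by (1-x) times a positive
number.
\<close>

lemma hill_fun_pos:
  assumes x: "0 \<le> x" "x < 1" and d: "d \<noteq> 0"
  obtains y where "hill_fun d (of_real x) = of_real y" "y > 0"
proof -
  define \<rho> where "\<rho> = weight 0 d"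
  have admissible: "admissible2 (\<lambda>n. of_real (\<rho> n))" unfolding \<rho>_def by (rule admissible2_weight) simp
  have ax: "\<bar>x\<bar> < 1" using x by simp
  have sym: "(\<lambda>n. \<rho> (- n)) = \<rho>" by (rule ext) (simp add: \<rho>_def weight_def)
  have d2: "d^2 > 0" using d by simp
  have r1: "\<rho> n \<le> 1" for n unfolding \<rho>_def weight_def using d2 by (simp add: add_nonneg_pos)
  have r0: "0 \<le> \<rho> n" if "n \<noteq> 0" for n
  proof -
    have "1 \<le> \<bar>n\<bar>" using that by simp
    then have "1 \<le> \<bar>real_of_int n\<bar>" by linarith
    then have "1 \<le> (real_of_int n)^2" using abs_le_square_iff[of 1 "real_of_int n"] by simp
    then have "1 \<le> (real_of_int n)^2 + d^2" using d2 by linarith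
    then have "1 / ((real_of_int n)^2 + d^2) \<le> 1" by (simp add: divide_le_eq_1)
    then show ?thesis by (simp add: \<rho>_def weight_def)
  qed
  define R1 R2 where "R1 = jost_real x \<rho> 1" and "R2 = jost_real x \<rho> 2"
  have c1: "continuant x (\<lambda>n. \<rho> (1 + int n)) \<longlonglongrightarrow> R1" and c2: "continuant x (\<lambda>n. \<rho> (2 + int n)) \<longlonglongrightarrow> R2"
    unfolding R1_def R2_def by (rule continuant_tendsto_jost_real[OF ax admissible]; simp)+
  have R1: "R1 \<ge> 1"
    by (rule LIMSEQ_le_const[OF c1]) (use continuant_increasing[OF x(1)] r0 r1 in auto)
  have R2: "R2 \<ge> 1"
    by (rule LIMSEQ_le_const[OF c2]) (use continuant_increasing[OF x(1)] r0 r1 in auto)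
  have R12: "R2 \<le> R1"
  proof (rule LIMSEQ_le[OF c2 LIMSEQ_Suc[OF c1]])
    have "continuant x (\<lambda>n. \<rho> (2 + int n)) n \<le> continuant x (\<lambda>n. \<rho> (1 + int n)) (Suc n)" for n
      using continuant_shift_le[OF x(1), of "\<lambda>n. \<rho> (1 + int n)" n] r0 r1 by (simp add: algebra_simps)
    then show "\<exists>N. \<forall>n\<ge>N. continuant x (\<lambda>n. \<rho> (2 + int n)) n \<le> continuant x (\<lambda>n. \<rho> (1 + int n)) (Suc n)" by blast
  qed
  define y where "y = (1 + x) * R1 * R1 - x * \<rho> 0 * (\<rho> (-1) * R2 * R1 + \<rho> 1 * R1 * R2)"
  have e: "evans_at 0 d (of_real x) = of_real y"
    unfolding evans_at_def \<rho>_def[symmetric] evans_of_real[OF ax admissible] sym R1_def R2_def y_def ..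
  have "\<rho> (-1) = \<rho> 1" using fun_cong[OF sym, of 1] by simp
  then have y_eq: "y = R1 * ((1 + x) * R1 - 2 * x * (\<rho> 0 * \<rho> 1 * R2))" by (simp add: y_def algebra_simps)
  have "\<rho> 0 * \<rho> 1 \<le> 1"
    using r1[of 0] r1[of 1] r0[of 1] mult_mono[of "\<rho> 0" 1 "\<rho> 1" 1] by simp
  then have "\<rho> 0 * \<rho> 1 * R2 \<le> 1 * R2" using R2 by (intro mult_right_mono) auto
  then have "2 * x * (\<rho> 0 * \<rho> 1 * R2) \<le> 2 * x * R1" using R12 x by (intro mult_left_mono) auto
  then have "(1 + x) * R1 - 2 * x * (\<rho> 0 * \<rho> 1 * R2) \<ge> (1 - x) * R1" by (simp add: algebra_simps)
  moreover have "(1 - x) * R1 > 0" using x R1 by simp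
  ultimately have y: "y > 0" unfolding y_eq using R1 by (intro mult_pos_pos) auto
  show thesis
  proof (rule that)
    show "hill_fun d (of_real x) = of_real ((1 - x) * (sinh (pi * d))^2 * y)"
      by (simp add: hill_fun_evans_at e)
    have "sinh (pi * d) \<noteq> 0" using d by simp
    then show "(1 - x) * (sinh (pi * d))^2 * y > 0" using x y by simp
  qed
qed

text \<open>
Positivity holds far out, where the value is close to 1/(1+v), and the recurrence at z = -v has
nonnegative coefficients, so it can be run backwards.
\<close>

lemma jost_real_pos:
  assumes v: "0 \<le> v" "v < 1" and admissible: "admissible2 (\<lambda>n. of_real (\<rho> n))"
    and k0: "k0 \<ge> 1" "\<And>n. n \<ge> k0 \<Longrightarrow> \<rho> n \<ge> 0" and k: "k \<ge> k0"
  shows "jost_real (- v) \<rho> k > 0"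
proof -
  have av: "\<bar>- v\<bar> < 1" using v by simp
  have "\<forall>\<^sub>F n in sequentially. jost_real (- v) \<rho> (int n) > 0"
    using order_tendstoD(1)[OF jost_real_tendsto[OF av admissible], of 0] v by simp
  then obtain N where N: "\<And>n. n \<ge> N \<Longrightarrow> jost_real (- v) \<rho> (int n) > 0"
    by (auto simp: eventually_sequentially)
  have N': "jost_real (- v) \<rho> m > 0" if "m \<ge> int N" for m
    using N[of "nat m"] that by simp
  define K where "K = int N + k0"
  have "K - int j \<ge> k0 \<Longrightarrow> jost_real (- v) \<rho> (K - int j) > 0 \<and> jost_real (- v) \<rho> (K - int j + 1) > 0" for j
  proof (induction j)
    case 0
    then show ?case using N'[of K] N'[of "K + 1"] k0(1) by (simp add: K_def)
  next
    case (Suc j)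
    define m where "m = K - int (Suc j)"
    have m: "m \<ge> k0" using Suc.prems by (simp add: m_def)
    have m1: "K - int j = m + 1" by (simp add: m_def)
    have IH: "jost_real (- v) \<rho> (m + 1) > 0 \<and> jost_real (- v) \<rho> (m + 2) > 0"
      using Suc.IH m unfolding m1 by (simp add: add.assoc)
    have "jost_real (- v) \<rho> m = (1 - v) * jost_real (- v) \<rho> (m + 1) + v * \<rho> m * \<rho> (m + 1) * jost_real (- v) \<rho> (m + 2)"
      using jost_real_rec[OF av admissible, of m] m k0 by simp
    also have "\<dots> > 0"
      using IH v k0(2)[of m] k0(2)[of "m + 1"] m by (intro add_pos_nonneg mult_pos_pos mult_nonneg_nonneg) auto
    finally show ?case using IH unfolding m_def[symmetric] by simp
  qed
  from this[of "nat (K - k)"] show ?thesis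
    using k N'[of k] k0(1) by (cases "k \<le> K") (auto simp: K_def)
qed

text \<open>
At z = -1 the recurrence loses its middle term. As v tends to 1, the value at k becomes small
compared with the value at k + 1 divided by 1 - v: the factor C that is known at k + 2 improves to C
+ 1/2 at k.
\<close>

lemma jost_real_ratio_large:
  assumes admissible: "admissible2 (\<lambda>n. of_real (\<rho> n))"
    and k0: "k0 \<ge> 1" "\<And>n. n \<ge> k0 \<Longrightarrow> 0 < \<rho> n" "\<And>n. n \<ge> k0 \<Longrightarrow> \<rho> n \<le> 1" and k: "k \<ge> k0"
  shows "\<exists>v0<1. \<forall>v. v0 < v \<and> 0 < v \<and> v < 1 \<longrightarrow> C * (1 - v) * jost_real (- v) \<rho> k \<le> \<rho> k * jost_real (- v) \<rho> (k + 1)"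
proof -
  have pos: "jost_real (- v) \<rho> n > 0" if "0 < v" "v < 1" "n \<ge> k0" for v n
    by (rule jost_real_pos[OF _ _ admissible k0(1)]) (use that k0(2) in \<open>auto intro: less_imp_le\<close>)
  have *: "\<exists>v0<1. \<forall>v. v0 < v \<and> 0 < v \<and> v < 1 \<longrightarrow> (real j / 2) * (1 - v) * jost_real (- v) \<rho> k \<le> \<rho> k * jost_real (- v) \<rho> (k + 1)"
    if "k \<ge> k0" for j k
    using that
  proof (induction j arbitrary: k)
    case 0
    show ?case
    proof (intro exI[of _ 0] conjI allI impI)
      fix v :: real assume v: "0 < v \<and> 0 < v \<and> v < 1"
      then show "real 0 / 2 * (1 - v) * jost_real (- v) \<rho> k \<le> \<rho> k * jost_real (- v) \<rho> (k + 1)"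
        using pos[of v "k+1"] k0(2)[of k] 0 by simp
    qed simp
  next
    case (Suc j)
    define C where "C = real j / 2"
    have C: "C \<ge> 0" by (simp add: C_def)
    obtain v0 where v0: "v0 < 1" "\<And>v. v0 < v \<Longrightarrow> 0 < v \<Longrightarrow> v < 1 \<Longrightarrow> C * (1 - v) * jost_real (- v) \<rho> (k + 2) \<le> \<rho> (k + 2) * jost_real (- v) \<rho> (k + 3)"
      using Suc.IH[of "k + 2"] Suc.prems by (auto simp: C_def add.assoc)
    \<comment> \<open>The second bound makes (1 + C) (1 - v) at most \<rho>_k / (2 (1 + C)), which is what the estimate D needs.\<close>
    define v1 where "v1 = max v0 (1 - \<rho> k / (2 * (1 + C)^2))"
    have rk: "0 < \<rho> k" "\<rho> k \<le> 1" using k0 Suc.prems by auto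
    have "v1 < 1" using v0 rk C by (simp add: v1_def)
    moreover have "(C + 1/2) * (1 - v) * jost_real (- v) \<rho> k \<le> \<rho> k * jost_real (- v) \<rho> (k + 1)"
      if v: "v1 < v" "0 < v" "v < 1" for v
    proof -
      define \<delta> where "\<delta> = 1 - v"
      define t0 t1 t2 t3 where "t0 = jost_real (- v) \<rho> k" and "t1 = jost_real (- v) \<rho> (k + 1)"
        and "t2 = jost_real (- v) \<rho> (k + 2)" and "t3 = jost_real (- v) \<rho> (k + 3)"
      have av: "\<bar>- v\<bar> < 1" using v by simp
      have tp: "t0 > 0" "t1 > 0" "t2 > 0" "t3 > 0"
        using pos[OF v(2,3)] Suc.prems by (auto simp: t0_def t1_def t2_def t3_def)
      define p where "p = \<rho> (k + 1)"
      have p: "0 < p" "p \<le> 1" using k0 Suc.prems by (auto simp: p_def)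
      have e0: "t0 = \<delta> * t1 + v * \<rho> k * p * t2"
        using jost_real_rec[OF av admissible, of k] Suc.prems k0 by (simp add: t0_def t1_def t2_def \<delta>_def p_def)
      have e1: "t1 = \<delta> * t2 + v * p * (\<rho> (k + 2) * t3)"
        using jost_real_rec[OF av admissible, of "k + 1"] Suc.prems k0
        by (simp add: t3_def t1_def t2_def \<delta>_def p_def add.assoc mult.assoc)
      define y where "y = v * p"
      have y: "0 < y" "y \<le> 1" using v p by (auto simp: y_def mult_le_one)
      have "y * (C * \<delta> * t2) \<le> y * (\<rho> (k + 2) * t3)"
        using v0(2)[of v] v y by (intro mult_left_mono) (auto simp: v1_def \<delta>_def t2_def t3_def)
      then have A: "\<delta> * (1 + y * C) * t2 \<le> t1" unfolding e1 y_def[symmetric] by (simp add: algebra_simps)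
      have den: "1 + y * C > 0" using y C by (simp add: add_pos_nonneg)
      have \<delta>: "0 < \<delta>" "\<delta> < 1" using v by (auto simp: \<delta>_def)
      have B: "y * (C + 1/2) \<le> (C + 1/2) / (1 + C) * (1 + y * C)"
      proof -
        have "y * (C + 1/2) * (1 + C) \<le> (C + 1/2) * (1 + y * C)"
        proof -
          have "(C + 1/2) * (1 + y * C) - y * (C + 1/2) * (1 + C) = (C + 1/2) * (1 - y)"
            by (simp add: field_simps)
          moreover have "(C + 1/2) * (1 - y) \<ge> 0" using C y by simp
          ultimately show ?thesis by linarith
        qed
        then show ?thesis using C by (simp add: field_simps)
      qed
      have D: "(C + 1/2) * \<delta> * \<delta> \<le> \<rho> k * (1 - (C + 1/2) / (1 + C))"
      proof -
        have "\<delta> \<le> \<rho> k / (2 * (1 + C)^2)" using v by (simp add: v1_def \<delta>_def)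
        then have "(1 + C) * \<delta> \<le> (1 + C) * (\<rho> k / (2 * (1 + C)^2))" using C by (intro mult_left_mono) auto
        also have "\<dots> = \<rho> k * (1 / (2 * (1 + C)))" using C by (simp add: power2_eq_square)
        also have "1 / (2 * (1 + C)) = 1 - (C + 1/2) / (1 + C)" using C by (simp add: field_simps)
        finally have "(1 + C) * \<delta> \<le> \<rho> k * (1 - (C + 1/2) / (1 + C))" .
        moreover have "(C + 1/2) * \<delta> * \<delta> \<le> (1 + C) * \<delta> * 1" using C \<delta> by (intro mult_mono) auto
        ultimately show ?thesis by simp
      qed
      have "(C + 1/2) * \<delta> * t0 = (C + 1/2) * \<delta> * \<delta> * t1 + \<rho> k * (y * (C + 1/2)) * (\<delta> * t2)"
        unfolding e0 y_def by (simp add: algebra_simps)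
      also have "\<dots> \<le> \<rho> k * (1 - (C + 1/2) / (1 + C)) * t1 + \<rho> k * ((C + 1/2) / (1 + C) * (1 + y * C)) * (\<delta> * t2)"
        using D B tp rk \<delta> by (intro add_mono mult_right_mono mult_left_mono) auto
      also have "\<rho> k * ((C + 1/2) / (1 + C) * (1 + y * C)) * (\<delta> * t2) = \<rho> k * ((C + 1/2) / (1 + C)) * (\<delta> * (1 + y * C) * t2)"
        by (simp add: mult_ac)
      also have "\<dots> \<le> \<rho> k * ((C + 1/2) / (1 + C)) * t1"
        using A rk C by (intro mult_left_mono) auto
      finally show ?thesis by (simp add: t0_def t1_def \<delta>_def algebra_simps)
    qed
    moreover have e: "real (Suc j) / 2 = C + 1/2" by (simp add: C_def add_divide_distrib)
    ultimately show ?case unfolding e by blast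
  qed
  obtain j :: nat where "2 * C \<le> real j"
    using real_arch_simple by blast
  then have j: "real j / 2 \<ge> C" by simp
  obtain v0 where v0: "v0 < 1" "\<And>v. v0 < v \<Longrightarrow> 0 < v \<Longrightarrow> v < 1 \<Longrightarrow> (real j / 2) * (1 - v) * jost_real (- v) \<rho> k \<le> \<rho> k * jost_real (- v) \<rho> (k + 1)"
    using *[OF k, of j] by blast
  have "C * (1 - v) * jost_real (- v) \<rho> k \<le> \<rho> k * jost_real (- v) \<rho> (k + 1)" if "v0 < v" "0 < v" "v < 1" for v
  proof -
    have "C * (1 - v) * jost_real (- v) \<rho> k \<le> (real j / 2) * (1 - v) * jost_real (- v) \<rho> k"
      using j that pos[of v k] k by (intro mult_right_mono) auto
    then show ?thesis using v0(2)[OF that] by linarith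
  qed
  then show ?thesis using v0(1) by blast
qed

text \<open>
Near z = -1 the term with the negative weight \<rho>_0 dominates the term with the factor 1 + z = 1
- v.
\<close>

lemma evans_negative_near:
  assumes admissible: "admissible2 (\<lambda>n. of_real (\<rho> n))"
    and 0: "\<rho> 0 < 0" and p: "\<And>n. n \<ge> 1 \<Longrightarrow> 0 < \<rho> n" "\<And>n. n \<ge> 1 \<Longrightarrow> \<rho> n \<le> 1"
    and m: "\<And>n. n \<le> -1 \<Longrightarrow> 0 \<le> \<rho> n"
  obtains v where "0 < v" "v < 1" "Re (evans (of_real (- v)) (\<lambda>n. of_real (\<rho> n))) < 0"
proof -
  obtain v0 where v0: "v0 < 1" "\<And>v. v0 < v \<Longrightarrow> 0 < v \<Longrightarrow> v < 1 \<Longrightarrow> (4 / (- \<rho> 0)) * (1 - v) * jost_real (- v) \<rho> 1 \<le> \<rho> 1 * jost_real (- v) \<rho> 2"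
    using jost_real_ratio_large[OF admissible _ p, of 1 1 "4 / (- \<rho> 0)"] by auto
  define v where "v = max (1/2) ((v0 + 1) / 2)"
  have v: "1/2 \<le> v" "v < 1" "v0 < v" using v0(1) by (auto simp: v_def max_def)
  define R L where "R = jost_real (- v) \<rho>" and "L = jost_real (- v) (\<lambda>n. \<rho> (- n))"
  have Rp: "R k > 0" if "k \<ge> 1" for k unfolding R_def
    by (rule jost_real_pos[OF _ _ admissible order_refl]) (use v that p in \<open>auto intro: less_imp_le\<close>)
  have Lp: "L k > 0" if "k \<ge> 1" for k unfolding L_def
    by (rule jost_real_pos[OF _ _ admissible2_reflect[OF admissible] order_refl]) (use v that m in auto)
  have "(4 / (- \<rho> 0)) * (1 - v) * R 1 \<le> \<rho> 1 * R 2" using v0(2)[of v] v by (simp add: R_def)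
  then have "(- \<rho> 0) * ((4 / (- \<rho> 0)) * (1 - v) * R 1) \<le> (- \<rho> 0) * (\<rho> 1 * R 2)"
    using 0 by (intro mult_left_mono) auto
  then have "4 * (1 - v) * R 1 \<le> (- \<rho> 0) * (\<rho> 1 * R 2)" using 0 by simp
  then have "(1/2) * (4 * (1 - v) * R 1) \<le> v * ((- \<rho> 0) * (\<rho> 1 * R 2))"
    by (rule mult_mono[rotated]) (use v Rp[of 1] in auto)
  moreover have "(1 - v) * R 1 > 0" using v Rp[of 1] by simp
  ultimately have "(1 - v) * R 1 + v * \<rho> 0 * \<rho> 1 * R 2 < 0" by (simp add: algebra_simps)
  then have "((1 - v) * R 1 + v * \<rho> 0 * \<rho> 1 * R 2) * L 1 < 0" using Lp[of 1] by (simp add: mult_neg_pos)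
  moreover have "v * \<rho> 0 * (\<rho> (-1) * L 2 * R 1) \<le> 0"
    using v 0 m[of "-1"] Lp[of 2] Rp[of 1] by (intro mult_nonpos_nonneg mult_nonneg_nonneg mult_nonneg_nonpos) auto
  ultimately have "(1 - v) * L 1 * R 1 + v * \<rho> 0 * (\<rho> (-1) * L 2 * R 1 + \<rho> 1 * L 1 * R 2) < 0"
    by (simp add: algebra_simps)
  moreover have "Re (evans (of_real (- v)) (\<lambda>n. of_real (\<rho> n))) = (1 - v) * L 1 * R 1 + v * \<rho> 0 * (\<rho> (-1) * L 2 * R 1 + \<rho> 1 * L 1 * R 2)"
    by (subst evans_of_real[OF _ admissible]) (use v in \<open>auto simp: R_def L_def\<close>)
  ultimately show thesis using v by (intro that[of v]) auto
qed

text \<open>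
With two adjacent negative weights the left half-line limit at -1 is negative as well, so two
negative factors multiply to a positive leading term.
\<close>

lemma evans_positive_near:
  assumes admissible: "admissible2 (\<lambda>n. of_real (\<rho> n))"
    and 0: "\<rho> 0 < 0" "\<rho> (-1) < 0" and p: "\<And>n. n \<noteq> 0 \<Longrightarrow> n \<noteq> -1 \<Longrightarrow> 0 < \<rho> n" "\<And>n. n \<noteq> 0 \<Longrightarrow> n \<noteq> -1 \<Longrightarrow> \<rho> n \<le> 1"
  obtains v0 where "v0 < 1" "\<And>v. v0 < v \<Longrightarrow> 0 < v \<Longrightarrow> v < 1 \<Longrightarrow> Re (evans (of_real (- v)) (\<lambda>n. of_real (\<rho> n))) > 0"
proof -
  define \<rho>' where "\<rho>' n = \<rho> (- n)" for n
  have adm': "admissible2 (\<lambda>n. of_real (\<rho>' n))" using admissible2_reflect[OF admissible] by (simp add: \<rho>'_def)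
  obtain v1 where v1: "v1 < 1" "\<And>v. v1 < v \<Longrightarrow> 0 < v \<Longrightarrow> v < 1 \<Longrightarrow> (4 / (- \<rho> 0)) * (1 - v) * jost_real (- v) \<rho> 1 \<le> \<rho> 1 * jost_real (- v) \<rho> 2"
    using jost_real_ratio_large[OF admissible order_refl p, of 1 "4 / (- \<rho> 0)"] by auto
  define c2 where "c2 = 4 / (- \<rho>' 1)"
  have "\<exists>v0<1. \<forall>v. v0 < v \<and> 0 < v \<and> v < 1 \<longrightarrow> c2 * (1 - v) * jost_real (- v) \<rho>' 2 \<le> \<rho>' 2 * jost_real (- v) \<rho>' (2 + 1)"
    by (rule jost_real_ratio_large[OF adm', of 2]) (use p in \<open>auto simp: \<rho>'_def\<close>)
  then obtain v2 where v2: "v2 < 1" "\<And>v. v2 < v \<Longrightarrow> 0 < v \<Longrightarrow> v < 1 \<Longrightarrow> c2 * (1 - v) * jost_real (- v) \<rho>' 2 \<le> \<rho>' 2 * jost_real (- v) \<rho>' 3"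
    by auto
  have "Re (evans (of_real (- v)) (\<lambda>n. of_real (\<rho> n))) > 0"
    if v: "max (1/2) (max v1 v2) < v" "v < 1" for v
  proof -
    have v': "1/2 < v" "v1 < v" "v2 < v" "0 < v" using v by auto
    define R L where "R = jost_real (- v) \<rho>" and "L = jost_real (- v) \<rho>'"
    have Rp: "R k > 0" if "k \<ge> 1" for k unfolding R_def
      by (rule jost_real_pos[OF _ _ admissible order_refl]) (use v v' that p in \<open>auto intro: less_imp_le\<close>)
    have Lp: "L k > 0" if "k \<ge> 2" for k unfolding L_def
      by (rule jost_real_pos[OF _ _ adm', of _ 2]) (use v v' that p in \<open>auto intro!: less_imp_le simp: \<rho>'_def\<close>)
    have neg: "(1 - v) * a + v * e * b < 0"
      if "(4 / (- e)) * (1 - v) * a \<le> b" "e < 0" "a > 0" "b > 0" for a b e :: real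
    proof -
      have "(- e) * ((4 / (- e)) * (1 - v) * a) \<le> (- e) * b" using that by (intro mult_left_mono) auto
      then have "4 * (1 - v) * a \<le> (- e) * b" using that by simp
      then have "(1/2) * (4 * (1 - v) * a) \<le> v * ((- e) * b)" by (rule mult_mono[rotated]) (use v v' that in auto)
      moreover have "(1 - v) * a > 0" using v that by simp
      ultimately show ?thesis by (simp add: algebra_simps)
    qed
    have N1: "(1 - v) * R 1 + v * \<rho> 0 * (\<rho> 1 * R 2) < 0"
      by (rule neg) (use v1(2)[of v] v v' 0 p(1)[of 1] Rp[of 1] Rp[of 2] in \<open>auto simp: R_def\<close>)
    have N2: "(1 - v) * L 2 + v * \<rho>' 1 * (\<rho>' 2 * L 3) < 0"
      by (rule neg) (use v2(2)[of v] v v' 0 p(1)[of "-2"] Lp[of 2] Lp[of 3] in \<open>auto simp: L_def \<rho>'_def c2_def\<close>)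
    have "L 1 = (1 - v) * L 2 + v * \<rho>' 1 * (\<rho>' 2 * L 3)"
      unfolding L_def using jost_real_rec[OF _ adm', of "- v" 1] v v' by simp
    then have L1: "L 1 < 0" using N2 by simp
    have a: "L 1 * ((1 - v) * R 1 + v * \<rho> 0 * (\<rho> 1 * R 2)) > 0" using L1 N1 by (simp add: mult_neg_neg)
    have b: "v * (\<rho> 0 * \<rho> (-1)) * (L 2 * R 1) > 0"
      using v' 0 Lp[of 2] Rp[of 1] by (intro mult_pos_pos mult_neg_neg) auto
    have "Re (evans (of_real (- v)) (\<lambda>n. of_real (\<rho> n))) = (1 - v) * L 1 * R 1 + v * \<rho> 0 * (\<rho> (-1) * L 2 * R 1 + \<rho> 1 * L 1 * R 2)"
      by (subst evans_of_real[OF _ admissible]) (use v v' in \<open>auto simp: R_def L_def \<rho>'_def[abs_def]\<close>)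
    also have "\<dots> = L 1 * ((1 - v) * R 1 + v * \<rho> 0 * (\<rho> 1 * R 2)) + v * (\<rho> 0 * \<rho> (-1)) * (L 2 * R 1)"
      by (simp add: algebra_simps)
    finally show ?thesis using a b by linarith
  qed
  then show thesis using v1(1) v2(1) by (intro that[of "max (1/2) (max v1 v2)"]) auto
qed

section \<open>Decaying solutions and an indefinite Hermitian form\<close>

text \<open>
A decaying solution of the eigenvalue equation in the Fourier representation. Decay is meant in the
weak sense of convergence to 0, so that limits of solutions are easily seen to belong to it.
\<close>

definition eigvec :: "(int \<Rightarrow> real) \<Rightarrow> complex \<Rightarrow> (int \<Rightarrow> complex) \<Rightarrow> bool" where
  "eigvec \<rho> c y \<longleftrightarrow> (\<forall>n. 2 * c * y n = of_real (\<rho> n) * (y (n - 1) + y (n + 1))) \<and>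
     (\<lambda>k. y (int k)) \<longlonglongrightarrow> 0 \<and> (\<lambda>k. y (- int k)) \<longlonglongrightarrow> 0 \<and> (\<exists>n. y n \<noteq> 0)"

text \<open>
The solution that decays to the right, expressed by the half-line limits; s^n gives the exponential
decay.
\<close>

definition half_sol :: "complex \<Rightarrow> (int \<Rightarrow> real) \<Rightarrow> nat \<Rightarrow> complex" where
  "half_sol s \<rho> n = s ^ n * (\<Prod>j=1..n. of_real (\<rho> (int j))) * jost_right (s^2) (\<lambda>n. of_real (\<rho> n)) (int n + 1)"

lemma half_sol_rec:
  assumes s: "s \<noteq> 0" "norm s < 1" and c: "c = (s + 1 / s) / 2"
    and admissible: "admissible2 (\<lambda>n. of_real (\<rho> n))"
  shows "2 * c * half_sol s \<rho> (Suc m) = of_real (\<rho> (int (Suc m))) * (half_sol s \<rho> m + half_sol s \<rho> (Suc (Suc m)))"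
proof -
  define R where "R = jost_right (s^2) (\<lambda>n. of_real (\<rho> n))"
  define P where "P n = (\<Prod>j=1..n. complex_of_real (\<rho> (int j)))" for n :: nat
  have P: "P (Suc n) = P n * of_real (\<rho> (int (Suc n)))" for n
    by (simp add: P_def)
  have cs: "2 * c * s = 1 + s^2" using s c by (simp add: field_simps power2_eq_square)
  have rec: "R (int m + 1) = (1 + s^2) * R (int m + 2) - s^2 * of_real (\<rho> (int m + 1)) * of_real (\<rho> (int m + 2)) * R (int m + 3)"
    using jost_right_rec[of "s^2", OF norm_power2_less_1[OF s(2)] admissible, of "int m + 1"] by (simp add: R_def add.assoc)
  have h: "half_sol s \<rho> n = s ^ n * P n * R (int n + 1)" for n by (simp add: half_sol_def P_def R_def)
  have i: "int (Suc m) = int m + 1" "int (Suc (Suc m)) = int m + 2" "int m + 1 + 1 = int m + 2" "int m + 2 + 1 = int m + 3" by simp_all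
  have "of_real (\<rho> (int (Suc m))) * (half_sol s \<rho> m + half_sol s \<rho> (Suc (Suc m)))
      = s ^ m * P (Suc m) * (R (int m + 1) + s^2 * of_real (\<rho> (int m + 1)) * of_real (\<rho> (int m + 2)) * R (int m + 3))"
    unfolding h P i by (simp add: power2_eq_square algebra_simps)
  also have "\<dots> = s ^ m * P (Suc m) * ((2 * c * s) * R (int m + 2))"
    unfolding rec cs by (simp add: algebra_simps)
  also have "\<dots> = 2 * c * half_sol s \<rho> (Suc m)" unfolding h i by (simp add: algebra_simps)
  finally show ?thesis by simp
qed

lemma half_sol_tendsto_0:
  assumes s: "norm s < 1" and admissible: "admissible2 (\<lambda>n. of_real (\<rho> n))"
    and r: "\<And>n. \<bar>n\<bar> \<ge> 2 \<Longrightarrow> \<bar>\<rho> n\<bar> \<le> 1"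
  shows "half_sol s \<rho> \<longlonglongrightarrow> 0"
proof -
  have "\<bar>\<Prod>j=1..n. \<rho> (int j)\<bar> \<le> max 1 \<bar>\<rho> 1\<bar>" for n :: nat
  proof (induction n)
    case (Suc n)
    show ?case
    proof (cases "n = 0")
      case False
      have "\<bar>\<Prod>j=1..Suc n. \<rho> (int j)\<bar> = \<bar>\<Prod>j=1..n. \<rho> (int j)\<bar> * \<bar>\<rho> (int (Suc n))\<bar>"
        by (simp add: abs_mult)
      also have "\<dots> \<le> max 1 \<bar>\<rho> 1\<bar> * 1"
        using Suc False by (intro mult_mono r) auto
      finally show ?thesis by simp
    qed simp
  qed simp
  then have b: "norm (\<Prod>j=1..n. complex_of_real (\<rho> (int j))) \<le> max 1 \<bar>\<rho> 1\<bar>" for n :: nat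
    by (simp flip: of_real_prod)
  have "(\<lambda>n. s ^ n * (\<Prod>j=1..n. of_real (\<rho> (int j)))) \<longlonglongrightarrow> 0"
  proof (rule Lim_null_comparison)
    show "\<forall>\<^sub>F n in sequentially. norm (s ^ n * (\<Prod>j=1..n. of_real (\<rho> (int j)))) \<le> norm s ^ n * max 1 \<bar>\<rho> 1\<bar>"
      using b by (intro always_eventually allI) (simp add: norm_mult norm_power mult_left_mono)
    show "(\<lambda>n. norm s ^ n * max 1 \<bar>\<rho> 1\<bar>) \<longlonglongrightarrow> 0"
      using s by (intro tendsto_mult_left_zero LIMSEQ_power_zero) auto
  qed
  moreover have "(\<lambda>n. jost_right (s^2) (\<lambda>n. of_real (\<rho> n)) (int n + 1)) \<longlonglongrightarrow> 1 / (1 - s^2)"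
    using LIMSEQ_Suc[OF jost_right_tendsto[OF norm_power2_less_1[OF s] admissible]] by (simp add: add.commute)
  ultimately have "(\<lambda>n. s ^ n * (\<Prod>j=1..n. of_real (\<rho> (int j))) * jost_right (s^2) (\<lambda>n. of_real (\<rho> n)) (int n + 1)) \<longlonglongrightarrow> 0 * (1 / (1 - s^2))"
    by (rule tendsto_mult)
  then show ?thesis by (simp add: half_sol_def[abs_def])
qed

lemma half_sol_nonzero:
  assumes s: "s \<noteq> 0" "norm s < 1" and admissible: "admissible2 (\<lambda>n. of_real (\<rho> n))" and r: "\<And>n. \<rho> n \<noteq> 0"
  shows "\<exists>n. half_sol s \<rho> n \<noteq> 0"
proof -
  have n: "norm (s^2) < 1" by (rule norm_power2_less_1[OF s(2)])
  then have "1 / (1 - s^2) \<noteq> 0" by auto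
  then have "\<forall>\<^sub>F n in sequentially. jost_right (s^2) (\<lambda>n. of_real (\<rho> n)) (int n) \<noteq> 0"
    by (rule tendsto_imp_eventually_ne[OF jost_right_tendsto[OF n admissible]])
  then obtain N where "\<And>n. n \<ge> N \<Longrightarrow> jost_right (s^2) (\<lambda>n. of_real (\<rho> n)) (int n) \<noteq> 0"
    by (auto simp: eventually_sequentially)
  from this[of "Suc N"] have "half_sol s \<rho> N \<noteq> 0"
    using s r by (simp add: half_sol_def add.commute)
  then show ?thesis ..
qed

text \<open>
A zero of the two-sided limit is the vanishing of the Casoratian of the two half-line solutions at
0, so suitable multiples of them match and satisfy the equation at the index 0.
\<close>

lemma eigvec_exists:
  assumes s: "s \<noteq> 0" "norm s < 1" and c: "c = (s + 1 / s) / 2"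
    and admissible: "admissible2 (\<lambda>n. of_real (\<rho> n))" and r0: "\<And>n. \<rho> n \<noteq> 0" and r1: "\<And>n. \<bar>n\<bar> \<ge> 2 \<Longrightarrow> \<bar>\<rho> n\<bar> \<le> 1"
    and E: "evans (s^2) (\<lambda>n. of_real (\<rho> n)) = 0"
  shows "\<exists>y. eigvec \<rho> c y"
proof -
  define \<rho>' where "\<rho>' n = \<rho> (- n)" for n
  have adm': "admissible2 (\<lambda>n. of_real (\<rho>' n))" using admissible2_reflect[OF admissible] by (simp add: \<rho>'_def)
  define a where "a = half_sol s \<rho>"
  define b where "b = half_sol s \<rho>'"
  have a_rec: "2 * c * a (Suc m) = of_real (\<rho> (int (Suc m))) * (a m + a (Suc (Suc m)))" for m
    unfolding a_def by (rule half_sol_rec[OF s c admissible])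
  have b_rec: "2 * c * b (Suc m) = of_real (\<rho> (- int (Suc m))) * (b m + b (Suc (Suc m)))" for m
  proof -
    have r: "\<rho> (- int (Suc m)) = \<rho>' (int (Suc m))" by (simp only: \<rho>'_def)
    show ?thesis unfolding b_def r by (rule half_sol_rec[OF s c adm'])
  qed
  have a_lim: "a \<longlonglongrightarrow> 0" unfolding a_def by (rule half_sol_tendsto_0[OF s(2) admissible r1])
  have b_lim: "b \<longlonglongrightarrow> 0" unfolding b_def by (rule half_sol_tendsto_0[OF s(2) adm']) (simp add: \<rho>'_def r1)
  have a_nz: "\<exists>n. a n \<noteq> 0" unfolding a_def by (rule half_sol_nonzero[OF s admissible r0])
  have b_nz: "\<exists>n. b n \<noteq> 0" unfolding b_def by (rule half_sol_nonzero[OF s adm']) (simp add: \<rho>'_def r0)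
  have cs: "2 * c * s = 1 + s^2" using s c by (simp add: field_simps power2_eq_square)
  \<comment> \<open>The equation at 0 for the solution glued from multiples of a and b that agree at 0.\<close>
  have mid: "2 * c * (a 0 * b 0) = of_real (\<rho> 0) * (b 0 * a 1 + a 0 * b 1)"
  proof -
    have "s * (2 * c * (a 0 * b 0) - of_real (\<rho> 0) * (b 0 * a 1 + a 0 * b 1)) = evans (s^2) (\<lambda>n. of_real (\<rho> n))"
    proof -
      have "s * (2 * c * (a 0 * b 0) - of_real (\<rho> 0) * (b 0 * a 1 + a 0 * b 1)) = (2 * c * s) * (a 0 * b 0) - of_real (\<rho> 0) * (b 0 * (s * a 1) + a 0 * (s * b 1))"
        by (simp add: algebra_simps)
      then show ?thesis unfolding cs
        by (simp add: a_def b_def half_sol_def evans_def jost_left_reflect \<rho>'_def algebra_simps power2_eq_square)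
    qed
    then show ?thesis using E s(1) by simp
  qed
  have "\<exists>\<alpha> \<beta>. (\<alpha> \<noteq> 0 \<or> \<beta> \<noteq> 0) \<and> \<alpha> * a 0 = \<beta> * b 0 \<and> 2 * c * (\<alpha> * a 0) = of_real (\<rho> 0) * (\<alpha> * a 1 + \<beta> * b 1)"
  proof (cases "a 0 = 0 \<and> b 0 = 0")
    case True
    show ?thesis
    proof (cases "a 1 = 0")
      case True' : True
      show ?thesis by (rule exI[of _ 1], rule exI[of _ 0]) (use True True' in simp)
    next
      case False
      show ?thesis by (rule exI[of _ "b 1"], rule exI[of _ "- a 1"]) (use True False in simp)
    qed
  next
    case False
    show ?thesis by (rule exI[of _ "b 0"], rule exI[of _ "a 0"]) (use False mid in \<open>auto simp: mult_ac\<close>)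
  qed
  then obtain \<alpha> \<beta> where ab: "\<alpha> \<noteq> 0 \<or> \<beta> \<noteq> 0" "\<alpha> * a 0 = \<beta> * b 0" "2 * c * (\<alpha> * a 0) = of_real (\<rho> 0) * (\<alpha> * a 1 + \<beta> * b 1)"
    by blast
  define y where "y n = (if n \<ge> 0 then \<alpha> * a (nat n) else \<beta> * b (nat (- n)))" for n :: int
  have yp: "y (int k) = \<alpha> * a k" for k by (simp add: y_def)
  have ym: "y (- int k) = \<beta> * b k" for k using ab(2) by (cases k) (simp_all add: y_def del: of_nat_Suc)
  have "eigvec \<rho> c y"
    unfolding eigvec_def
  proof (intro conjI allI)
    fix n :: int
    have "n = 0 \<or> n = int (Suc (nat (n - 1))) \<or> n = - int (Suc (nat (- n - 1)))" by linarith
    then consider "n = 0" | m where "n = int (Suc m)" | m where "n = - int (Suc m)" by blast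
    then show "2 * c * y n = of_real (\<rho> n) * (y (n - 1) + y (n + 1))"
    proof cases
      case 1
      then show ?thesis using ab(3) yp[of 0] yp[of 1] ym[of 1] by (simp add: algebra_simps)
    next
      case 2
      have e: "n - 1 = int m" "n + 1 = int (Suc (Suc m))" using 2 by auto
      have e': "y (n - 1) = \<alpha> * a m" "y (n + 1) = \<alpha> * a (Suc (Suc m))" unfolding e by (rule yp)+
      have "2 * c * y n = \<alpha> * (2 * c * a (Suc m))" unfolding 2 yp by simp
      also have "\<dots> = of_real (\<rho> n) * (y (n - 1) + y (n + 1))" unfolding a_rec e' by (simp add: 2 algebra_simps)
      finally show ?thesis .
    next
      case 3
      have e: "n - 1 = - int (Suc (Suc m))" "n + 1 = - int m" using 3 by auto
      have e': "y (n - 1) = \<beta> * b (Suc (Suc m))" "y (n + 1) = \<beta> * b m" unfolding e by (rule ym)+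
      have "2 * c * y n = \<beta> * (2 * c * b (Suc m))" unfolding 3 ym by simp
      also have "\<dots> = of_real (\<rho> n) * (y (n - 1) + y (n + 1))" unfolding b_rec e' by (simp add: 3 algebra_simps)
      finally show ?thesis .
    qed
  next
    show "(\<lambda>k. y (int k)) \<longlonglongrightarrow> 0" unfolding yp using tendsto_mult_left[OF a_lim, of \<alpha>] by simp
    show "(\<lambda>k. y (- int k)) \<longlonglongrightarrow> 0" unfolding ym using tendsto_mult_left[OF b_lim, of \<beta>] by simp
    show "\<exists>n. y n \<noteq> 0"
    proof (cases "\<alpha> = 0")
      case False
      obtain k where "a k \<noteq> 0" using a_nz by blast
      then have "y (int k) \<noteq> 0" using False yp by simp
      then show ?thesis ..
    next
      case True
      then have "\<beta> \<noteq> 0" using ab(1) by simp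
      moreover obtain k where "b k \<noteq> 0" using b_nz by blast
      ultimately have "y (- int k) \<noteq> 0" using ym by simp
      then show ?thesis ..
    qed
  qed
  then show ?thesis by blast
qed

lemma sum_int_interval_Suc:
  fixes f :: "int \<Rightarrow> 'a::comm_monoid_add"
  shows "(\<Sum>n=- int (Suc N)..int (Suc N). f n) = f (- int (Suc N)) + (\<Sum>n=- int N..int N. f n) + f (int (Suc N))"
proof -
  have "{- int (Suc N)..int (Suc N)} = insert (- int (Suc N)) (insert (int (Suc N)) {- int N..int N})"
    by auto
  then show ?thesis by (simp add: add_ac)
qed

text \<open>
The summands times 2(c - cnj c') are differences of a Casoratian, which tends to 0 at both ends.
\<close>

lemma eigvec_neutral:
  assumes y: "eigvec \<rho> c y" and y': "eigvec \<rho> c' y'" and r0: "\<And>n. \<rho> n \<noteq> 0" and c: "c \<noteq> cnj c'"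
  shows "(\<lambda>N. \<Sum>n=- int N..int N. y n * cnj (y' n) / of_real (\<rho> n)) \<longlonglongrightarrow> 0"
proof -
  \<comment> \<open>The Casoratian.\<close>
  define w where "w n = y (n + 1) * cnj (y' n) - y n * cnj (y' (n + 1))" for n
  have term_eq: "2 * (c - cnj c') * (y n * cnj (y' n) / of_real (\<rho> n)) = w n - w (n - 1)" for n
  proof -
    have e1: "2 * c * y n / of_real (\<rho> n) = y (n - 1) + y (n + 1)"
      using y r0[of n] by (simp add: eigvec_def)
    have "cnj (2 * c' * y' n) = cnj (of_real (\<rho> n) * (y' (n - 1) + y' (n + 1)))"
      using y' by (simp only: eigvec_def)
    then have e2: "2 * cnj c' * cnj (y' n) / of_real (\<rho> n) = cnj (y' (n - 1)) + cnj (y' (n + 1))"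
      using r0[of n] by simp
    have "2 * (c - cnj c') * (y n * cnj (y' n) / of_real (\<rho> n)) =
       (2 * c * y n / of_real (\<rho> n)) * cnj (y' n) - y n * (2 * cnj c' * cnj (y' n) / of_real (\<rho> n))"
      by (simp add: algebra_simps diff_divide_distrib)
    also have "\<dots> = w n - w (n - 1)" unfolding e1 e2 w_def by (simp add: algebra_simps)
    finally show ?thesis .
  qed
  have tel: "(\<Sum>n=- int N..int N. w n - w (n - 1)) = w (int N) - w (- int (Suc N))" for N
  proof (induction N)
    case (Suc N)
    have "- int (Suc N) - 1 = - int (Suc (Suc N))" "int (Suc N) - 1 = int N" by simp_all
    then show ?case unfolding sum_int_interval_Suc Suc by simp
  qed simp
  have yl: "(\<lambda>k. y (int k)) \<longlonglongrightarrow> 0" "(\<lambda>k. y (- int k)) \<longlonglongrightarrow> 0" "(\<lambda>k. y' (int k)) \<longlonglongrightarrow> 0" "(\<lambda>k. y' (- int k)) \<longlonglongrightarrow> 0"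
    using y y' by (auto simp: eigvec_def)
  have "(\<lambda>N. w (int N)) \<longlonglongrightarrow> 0 * cnj 0 - 0 * cnj 0"
    unfolding w_def using LIMSEQ_Suc[OF yl(1)] LIMSEQ_Suc[OF yl(3)] yl
    by (intro tendsto_intros) (auto simp: add.commute)
  moreover have "(\<lambda>N. w (- int (Suc N))) \<longlonglongrightarrow> 0 * cnj 0 - 0 * cnj 0"
  proof -
    have "w (- int (Suc N)) = y (- int N) * cnj (y' (- int (Suc N))) - y (- int (Suc N)) * cnj (y' (- int N))" for N
      by (simp add: w_def)
    then show ?thesis using yl LIMSEQ_Suc[OF yl(2)] LIMSEQ_Suc[OF yl(4)] by (simp only:) (intro tendsto_intros)
  qed
  ultimately have wl: "(\<lambda>N. w (int N) - w (- int (Suc N))) \<longlonglongrightarrow> 0 - 0" by (intro tendsto_diff) simp_all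
  have "(\<Sum>n=- int N..int N. y n * cnj (y' n) / of_real (\<rho> n)) = (w (int N) - w (- int (Suc N))) / (2 * (c - cnj c'))" for N
  proof -
    have "2 * (c - cnj c') * (\<Sum>n=- int N..int N. y n * cnj (y' n) / of_real (\<rho> n)) = w (int N) - w (- int (Suc N))"
      unfolding sum_distrib_left term_eq tel ..
    then show ?thesis using c by (simp add: field_simps)
  qed
  moreover have "(\<lambda>N. (w (int N) - w (- int (Suc N))) / (2 * (c - cnj c'))) \<longlonglongrightarrow> (0 - 0) / (2 * (c - cnj c'))"
    using c by (intro tendsto_divide wl tendsto_const) simp
  ultimately show ?thesis by simp
qed

text \<open>
Gaussian elimination of one equation and one unknown in each step.
\<close>

lemma homogeneous_solution:
  fixes M :: "'i \<Rightarrow> 'j \<Rightarrow> 'a::field"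
  assumes "finite J" "finite I" "card J < card I"
  shows "\<exists>a. (\<exists>i\<in>I. a i \<noteq> 0) \<and> (\<forall>j\<in>J. (\<Sum>i\<in>I. a i * M i j) = 0)"
  using assms
proof (induction J arbitrary: I M rule: finite_induct)
  case empty
  then have "I \<noteq> {}" by auto
  then show ?case by (intro exI[of _ "\<lambda>_. 1"]) auto
next
  case (insert j J)
  show ?case
  proof (cases "\<forall>i\<in>I. M i j = 0")
    case True
    obtain a where "\<exists>i\<in>I. a i \<noteq> 0" "\<forall>k\<in>J. (\<Sum>i\<in>I. a i * M i k) = 0"
      using insert.IH[of I M] insert.prems insert.hyps by auto
    then show ?thesis using True by (intro exI[of _ a]) simp
  next
    case False
    then obtain p where p: "p \<in> I" "M p j \<noteq> 0" by blast
    define I' where "I' = I - {p}"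
    have I': "finite I'" "p \<notin> I'" "I = insert p I'" using insert.prems p by (auto simp: I'_def)
    have "card J < card I'" using insert.prems insert.hyps I' by simp
    then obtain a where a: "\<exists>i\<in>I'. a i \<noteq> 0" "\<forall>k\<in>J. (\<Sum>i\<in>I'. a i * (M i k - M i j / M p j * M p k)) = 0"
      using insert.IH[of I' "\<lambda>i k. M i k - M i j / M p j * M p k"] I'(1) by blast
    \<comment> \<open>The unknown with index p is determined by the equation j that has been eliminated.\<close>
    define a' where "a' = a(p := - (\<Sum>i\<in>I'. a i * M i j) / M p j)"
    have s: "(\<Sum>i\<in>I. a' i * M i k) = (\<Sum>i\<in>I'. a i * (M i k - M i j / M p j * M p k))" for k
    proof -
      have "(\<Sum>i\<in>I. a' i * M i k) = a' p * M p k + (\<Sum>i\<in>I'. a i * M i k)"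
        unfolding I'(3) using I' by (simp add: a'_def) (intro sum.cong, auto)
      also have "a' p * M p k = - (\<Sum>i\<in>I'. a i * (M i j / M p j * M p k))"
      proof -
        have "(\<Sum>i\<in>I'. a i * M i j) / M p j * M p k = (\<Sum>i\<in>I'. a i * (M i j / M p j * M p k))"
          by (simp only: sum_divide_distrib sum_distrib_right) (intro sum.cong, auto)
        then show ?thesis by (simp add: a'_def)
      qed
      finally show ?thesis by (simp add: right_diff_distrib sum_subtractf)
    qed
    have "(\<Sum>i\<in>I. a' i * M i j) = 0" unfolding s using p by simp
    moreover have "\<exists>i\<in>I. a' i \<noteq> 0" using a(1) I' by (auto simp: a'_def)
    ultimately show ?thesis using a(2) s by (intro exI[of _ a']) auto
  qed
qed

text \<open>
Solutions for distinct c are eigenvectors of one linear operator for distinct eigenvalues.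
\<close>

lemma eigvec_independent:
  assumes "finite I" "\<And>c. c \<in> I \<Longrightarrow> eigvec \<rho> c (y c)" "\<And>n. (\<Sum>c\<in>I. a c * y c n) = 0" "c \<in> I"
  shows "a c * y c n = 0"
  using assms
proof (induction I arbitrary: a c n rule: finite_induct)
  case (insert p I)
  have e: "2 * c * y c n = of_real (\<rho> n) * (y c (n - 1) + y c (n + 1))" if "c \<in> insert p I" for c n
    using insert.prems(1)[OF that] by (simp add: eigvec_def)
  have 1: "(\<Sum>c\<in>insert p I. a c * (c * y c n)) = 0" for n
  proof -
    have "2 * (\<Sum>c\<in>insert p I. a c * (c * y c n)) = (\<Sum>c\<in>insert p I. a c * (2 * c * y c n))"
      by (simp add: sum_distrib_left mult_ac)
    also have "\<dots> = (\<Sum>c\<in>insert p I. of_real (\<rho> n) * (a c * y c (n - 1) + a c * y c (n + 1)))"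
      by (intro sum.cong refl) (simp only: e, simp add: algebra_simps)
    also have "\<dots> = of_real (\<rho> n) * ((\<Sum>c\<in>insert p I. a c * y c (n - 1)) + (\<Sum>c\<in>insert p I. a c * y c (n + 1)))"
      by (simp only: sum_distrib_left[symmetric] sum.distrib)
    also have "\<dots> = 0" unfolding insert.prems(2) by simp
    finally show ?thesis by simp
  qed
  have 2: "(\<Sum>c\<in>I. (a c * (c - p)) * y c n) = 0" for n
  proof -
    have "(\<Sum>c\<in>insert p I. (a c * (c - p)) * y c n) = (\<Sum>c\<in>insert p I. a c * (c * y c n)) - p * (\<Sum>c\<in>insert p I. a c * y c n)"
      by (simp only: sum_distrib_left sum_subtractf[symmetric]) (intro sum.cong, auto simp: algebra_simps)
    also have "\<dots> = 0" unfolding 1 insert.prems(2) by simp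
    finally show ?thesis using insert.hyps by simp
  qed
  have 3: "a c * y c n = 0" if "c \<in> I" for c n
  proof -
    have "(a c * (c - p)) * y c n = 0"
      by (rule insert.IH[OF _ 2 that]) (use insert.prems(1) in blast)
    moreover have "c \<noteq> p" using that insert.hyps by blast
    ultimately show ?thesis by simp
  qed
  show ?case
  proof (cases "c = p")
    case True
    have "(\<Sum>c\<in>I. a c * y c n) = 0" by (rule sum.neutral) (use 3 in blast)
    then show ?thesis using insert.prems(2)[of n] insert.hyps True by simp
  next
    case False
    then show ?thesis using 3 insert.prems(3) by blast
  qed
qed simp

text \<open>
If there were more solutions than negative weights, some nontrivial combination would vanish at all
indices with negative weight. On it the neutral form is a sum of nonnegative terms, so the
combination is 0, contrary to independence.
\<close>

lemma eigvec_card_le: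
  assumes I: "finite I" "\<And>c. c \<in> I \<Longrightarrow> Im c > 0" "\<And>c. c \<in> I \<Longrightarrow> eigvec \<rho> c (y c)"
    and r0: "\<And>n. \<rho> n \<noteq> 0" and J: "finite {n. \<rho> n < 0}"
  shows "card I \<le> card {n. \<rho> n < 0}"
proof (rule ccontr)
  assume "\<not> ?thesis"
  then have "card {n. \<rho> n < 0} < card I" by simp
  then obtain a where a: "\<exists>c\<in>I. a c \<noteq> 0" "\<forall>n\<in>{n. \<rho> n < 0}. (\<Sum>c\<in>I. a c * y c n) = 0"
    using homogeneous_solution[OF J I(1), of "\<lambda>c n. y c n"] by auto
  define w where "w n = (\<Sum>c\<in>I. a c * y c n)" for n
  have "(\<lambda>N. \<Sum>c\<in>I. \<Sum>c'\<in>I. a c * cnj (a c') * (\<Sum>n=- int N..int N. y c n * cnj (y c' n) / of_real (\<rho> n))) \<longlonglongrightarrow> (\<Sum>c\<in>I. \<Sum>c'\<in>I. a c * cnj (a c') * 0)"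
  proof (intro tendsto_intros eigvec_neutral[OF I(3) I(3) r0])
    fix c c' assume "c \<in> I" "c' \<in> I"
    then have "Im c > 0" "Im c' > 0" using I(2) by auto
    then show "c \<noteq> cnj c'" by (metis cnj.simps(2) less_asym neg_0_less_iff_less)
  qed
  also have "(\<lambda>N. \<Sum>c\<in>I. \<Sum>c'\<in>I. a c * cnj (a c') * (\<Sum>n=- int N..int N. y c n * cnj (y c' n) / of_real (\<rho> n)))
      = (\<lambda>N. of_real (\<Sum>n=- int N..int N. (norm (w n))^2 / \<rho> n))"
  proof
    fix N
    have "(\<Sum>c\<in>I. \<Sum>c'\<in>I. a c * cnj (a c') * (\<Sum>n=- int N..int N. y c n * cnj (y c' n) / of_real (\<rho> n)))
       = (\<Sum>c\<in>I. \<Sum>c'\<in>I. \<Sum>n=- int N..int N. (a c * y c n) * cnj (a c' * y c' n) / of_real (\<rho> n))"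
      by (simp add: sum_distrib_left mult_ac)
    also have "\<dots> = (\<Sum>n=- int N..int N. \<Sum>c\<in>I. \<Sum>c'\<in>I. (a c * y c n) * cnj (a c' * y c' n) / of_real (\<rho> n))"
      by (subst sum.swap[of _ I "{- int N..int N}"], subst sum.swap) (rule refl)
    also have "\<dots> = (\<Sum>n=- int N..int N. w n * cnj (w n) / of_real (\<rho> n))"
      by (simp add: w_def sum_product sum_divide_distrib)
    also have "\<dots> = of_real (\<Sum>n=- int N..int N. (norm (w n))^2 / \<rho> n)"
      by (simp only: of_real_sum of_real_divide complex_norm_square)
    finally show "(\<Sum>c\<in>I. \<Sum>c'\<in>I. a c * cnj (a c') * (\<Sum>n=- int N..int N. y c n * cnj (y c' n) / of_real (\<rho> n))) = of_real (\<Sum>n=- int N..int N. (norm (w n))^2 / \<rho> n)" .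
  qed
  finally have "(\<lambda>N. complex_of_real (\<Sum>n=- int N..int N. (norm (w n))^2 / \<rho> n)) \<longlonglongrightarrow> of_real 0" by simp
  then have lim: "(\<lambda>N. \<Sum>n=- int N..int N. (norm (w n))^2 / \<rho> n) \<longlonglongrightarrow> 0"
    by (simp only: tendsto_of_real_iff)
  have nn: "(norm (w n))^2 / \<rho> n \<ge> 0" for n
  proof (cases "\<rho> n < 0")
    case True then show ?thesis using a(2) by (simp add: w_def)
  qed simp
  have w0: "w m = 0" for m
  proof -
    have "(norm (w m))^2 / \<rho> m \<le> (\<Sum>n=- int N..int N. (norm (w n))^2 / \<rho> n)" if "N \<ge> nat \<bar>m\<bar>" for N
      using that by (intro member_le_sum nn) auto
    then have "(norm (w m))^2 / \<rho> m \<le> 0"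
      by (intro LIMSEQ_le_const[OF lim]) blast
    then have "(norm (w m))^2 / \<rho> m = 0" using nn[of m] by simp
    then show ?thesis using r0 by simp
  qed
  obtain c where c: "c \<in> I" "a c \<noteq> 0" using a(1) by blast
  have "a c * y c n = 0" for n
    by (rule eigvec_independent[OF I(1,3) _ c(1)]) (use w0 in \<open>auto simp: w_def\<close>)
  then have "y c n = 0" for n using c(2) by simp
  then show False using I(3)[OF c(1)] by (simp add: eigvec_def)
qed

text \<open>
The root in the lower half plane is the one for which (s + 1/s)/2 lies in the upper half plane.
\<close>

lemma lower_root:
  assumes "z \<notin> \<real>\<^sub>\<ge>\<^sub>0"
  obtains s where "s^2 = z" "Im s < 0" "s \<noteq> 0"
proof -
  define q where "q = csqrt z"
  have q: "q^2 = z" by (simp add: q_def)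
  have "Im q \<noteq> 0"
  proof
    assume "Im q = 0"
    then have "z = of_real ((Re q)^2)" using q by (simp add: complex_eq_iff power2_eq_square)
    then have "z \<in> \<real>\<^sub>\<ge>\<^sub>0" by (simp only: nonneg_Reals_of_real_iff) simp
    then show False using assms by simp
  qed
  then consider "Im q < 0" | "Im (- q) < 0" by fastforce
  then show thesis
  proof cases
    case 1
    then show thesis using q by (intro that[of q]) auto
  next
    case 2
    then show thesis using q by (intro that[of "- q"]) auto
  qed
qed

lemma Im_joukowski:
  assumes "s \<noteq> 0"
  shows "Im ((s + 1 / s) / 2) = Im s * (1 - 1 / (norm s)^2) / 2"
proof -
  have "1 / s = cnj s / of_real ((norm s)^2)" using complex_div_cnj[of 1 s] by simp
  then have "Im (1 / s) = - Im s / (norm s)^2" by simp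
  then show ?thesis by (simp add: algebra_simps)
qed

lemma Im_joukowski_pos:
  assumes "s \<noteq> 0" "norm s < 1" "Im s < 0"
  shows "Im ((s + 1 / s) / 2) > 0"
proof -
  have "(norm s)^2 < 1" "(norm s)^2 > 0" using assms by (auto simp: power_less_one_iff)
  then have "1 - 1 / (norm s)^2 < 0" by simp
  then show ?thesis unfolding Im_joukowski[OF assms(1)] using assms(3) by (simp add: mult_neg_neg)
qed

text \<open>
Each zero z yields a decaying solution for c = (s + 1/s)/2 with Im c > 0, and distinct z yield
distinct c. The exclusion of nonnegative z is what makes c nonreal.
\<close>

lemma evans_zeros_card_le:
  assumes admissible: "admissible2 (\<lambda>n. of_real (\<rho> n))" and r0: "\<And>n. \<rho> n \<noteq> 0" and r1: "\<And>n. \<bar>n\<bar> \<ge> 2 \<Longrightarrow> \<bar>\<rho> n\<bar> \<le> 1"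
    and J: "finite {n. \<rho> n < 0}"
    and Z: "finite Z" "\<And>z. z \<in> Z \<Longrightarrow> norm z < 1" "\<And>z. z \<in> Z \<Longrightarrow> z \<notin> \<real>\<^sub>\<ge>\<^sub>0"
      "\<And>z. z \<in> Z \<Longrightarrow> evans z (\<lambda>n. of_real (\<rho> n)) = 0"
  shows "card Z \<le> card {n. \<rho> n < 0}"
proof -
  have "\<forall>z\<in>Z. \<exists>s. s^2 = z \<and> Im s < 0 \<and> s \<noteq> 0" 
  proof
    fix z assume "z \<in> Z"
    then obtain s where "s^2 = z" "Im s < 0" "s \<noteq> 0" using lower_root[OF Z(3)] by blast
    then show "\<exists>s. s^2 = z \<and> Im s < 0 \<and> s \<noteq> 0" by blast
  qed
  then obtain s where s: "\<And>z. z \<in> Z \<Longrightarrow> (s z)^2 = z" "\<And>z. z \<in> Z \<Longrightarrow> Im (s z) < 0" "\<And>z. z \<in> Z \<Longrightarrow> s z \<noteq> 0"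
    using bchoice[of Z "\<lambda>z s. s^2 = z \<and> Im s < 0 \<and> s \<noteq> 0"] by blast
  have ns: "norm (s z) < 1" if "z \<in> Z" for z
  proof -
    have "norm (s z)^2 < 1" using s(1)[OF that] Z(2)[OF that] by (metis norm_power)
    then show ?thesis by (simp add: power_less_one_iff)
  qed
  define c where "c z = (s z + 1 / s z) / 2" for z
  have inj: "inj_on c Z"
  proof (rule inj_onI)
    fix z z' assume zz: "z \<in> Z" "z' \<in> Z" "c z = c z'"
    have "s z + 1 / s z = s z' + 1 / s z'" using zz(3) unfolding c_def by (simp only: divide_cancel_right) simp
    then have eq: "s z = s z'" by (rule joukowski_inj) (fact ns[OF zz(1)] ns[OF zz(2)] s(3)[OF zz(1)] s(3)[OF zz(2)])+
    have "z = (s z)^2" by (rule s(1)[OF zz(1), symmetric])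
    also have "\<dots> = (s z')^2" by (rule arg_cong[OF eq])
    also have "\<dots> = z'" by (rule s(1)[OF zz(2)])
    finally show "z = z'" .
  qed
  have Imc: "Im (c z) > 0" if "z \<in> Z" for z
    unfolding c_def by (rule Im_joukowski_pos[OF s(3)[OF that] ns[OF that] s(2)[OF that]])
  have "\<exists>y. eigvec \<rho> (c z) y" if "z \<in> Z" for z
    by (rule eigvec_exists[OF s(3)[OF that] ns[OF that] c_def admissible r0 r1]) (auto simp only: s(1)[OF that] Z(4)[OF that])
  then have "\<forall>k\<in>c ` Z. \<exists>y. eigvec \<rho> k y" by blast
  then obtain y where y: "\<And>k. k \<in> c ` Z \<Longrightarrow> eigvec \<rho> k (y k)" using bchoice[of "c ` Z" "\<lambda>k y. eigvec \<rho> k y"] by blast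
  have "card (c ` Z) \<le> card {n. \<rho> n < 0}"
    by (rule eigvec_card_le[OF _ _ y r0 J]) (use Z(1) Imc in auto)
  then show ?thesis using card_image[OF inj] by simp
qed

section \<open>Total order of zeros under perturbation\<close>

text \<open>
Near a zero of order n the function f - f(z0) is the n-th power of a holomorphic function with a
simple zero. Hence f takes each nearby value other than f(z0) at n distinct points.
\<close>

lemma zero_splits:
  fixes f :: "complex \<Rightarrow> complex"
  assumes S: "open S" "connected S" and f: "f holomorphic_on S" and z0: "z0 \<in> S"
    and nc: "\<exists>w\<in>S. f w \<noteq> f z0" and r: "r > 0"
  defines "n \<equiv> zorder (\<lambda>z. f z - f z0) z0"
  shows "n > 0" "\<exists>\<delta>>0. \<forall>w. 0 < norm (w - f z0) \<and> norm (w - f z0) < \<delta> \<longrightarrow>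
     (\<exists>Z. finite Z \<and> card Z = nat n \<and> Z \<subseteq> ball z0 r \<inter> S \<and> (\<forall>z\<in>Z. f z = w))"
proof -
  have "(\<lambda>z. f z - f z0) holomorphic_on S" by (intro holomorphic_intros f)
  from zorder_exist_zero[OF this S z0] nc
  obtain r1 where n: "n > 0" and r1: "r1 > 0" "cball z0 r1 \<subseteq> S"
    "zor_poly (\<lambda>z. f z - f z0) z0 holomorphic_on cball z0 r1"
    "\<And>w. w \<in> cball z0 r1 \<Longrightarrow> f w - f z0 = zor_poly (\<lambda>z. f z - f z0) z0 w * (w - z0) ^ nat n \<and> zor_poly (\<lambda>z. f z - f z0) z0 w \<noteq> 0"
    by (auto simp: n_def)
  show "n > 0" by (rule n)
  define g where "g = zor_poly (\<lambda>z. f z - f z0) z0"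
  define B where "B = ball z0 (min r r1)"
  have B: "open B" "convex B" "z0 \<in> B" "B \<subseteq> cball z0 r1" "B \<subseteq> ball z0 r" using r r1(1) by (auto simp: B_def)
  have g: "g holomorphic_on B" "\<And>w. w \<in> B \<Longrightarrow> g w \<noteq> 0"
    using r1 B(4) holomorphic_on_subset by (auto simp: g_def)
  obtain l where l: "l holomorphic_on B" "\<And>x. x \<in> B \<Longrightarrow> exp (l x) = g x"
    by (rule holomorphic_logarithm_exists[OF B(2,1) g(1) _ B(3)]) (use g(2) in auto)
  \<comment> \<open>A holomorphic n-th root of f - f z0, obtained from a logarithm of the nonvanishing factor.\<close>
  define \<phi> where "\<phi> w = (w - z0) * exp (l w / of_nat (nat n))" for w
  have ph: "\<phi> holomorphic_on B" unfolding \<phi>_def by (intro holomorphic_intros l) (use n in auto)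
  have fph: "f w = f z0 + \<phi> w ^ nat n" if "w \<in> B" for w
  proof -
    have "exp (l w / of_nat (nat n)) ^ nat n = exp (l w)"
      using n by (simp flip: exp_of_nat_mult)
    then have "\<phi> w ^ nat n = g w * (w - z0) ^ nat n"
      using l(2)[OF that] by (simp add: \<phi>_def power_mult_distrib)
    then show ?thesis using r1(4)[of w] B(4) that by (auto simp: g_def algebra_simps)
  qed
  have "\<not> \<phi> constant_on B"
  proof
    assume "\<phi> constant_on B"
    then have "\<phi> w = \<phi> z0" if "w \<in> B" for w using that B(3) by (auto simp: constant_on_def)
    then have e: "w = z0" if "w \<in> B" for w using that by (simp add: \<phi>_def)
    have "z0 + of_real (min r r1 / 2) \<in> B" using r r1(1) by (simp add: B_def dist_norm min_def)
    from e[OF this] show False using r r1(1) by (simp add: min_def split: if_splits)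
  qed
  then have "open (\<phi> ` B)"
    by (intro open_mapping_thm[OF ph B(1) convex_connected[OF B(2)] B(1) order_refl])
  moreover have "0 \<in> \<phi> ` B" using B(3) by (auto simp: \<phi>_def image_iff intro!: bexI[of _ z0])
  ultimately obtain e where e: "e > 0" "ball 0 e \<subseteq> \<phi> ` B" by (meson openE)
  show "\<exists>\<delta>>0. \<forall>w. 0 < norm (w - f z0) \<and> norm (w - f z0) < \<delta> \<longrightarrow>
     (\<exists>Z. finite Z \<and> card Z = nat n \<and> Z \<subseteq> ball z0 r \<inter> S \<and> (\<forall>z\<in>Z. f z = w))"
  proof (intro exI[of _ "e ^ nat n"] conjI allI impI)
    show "0 < e ^ nat n" using e by simp
    fix w assume w: "0 < norm (w - f z0) \<and> norm (w - f z0) < e ^ nat n"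
    define U where "U = {u. u ^ nat n = w - f z0}"
    have cU: "card U = nat n" unfolding U_def by (rule card_nth_roots) (use w n in auto)
    have fU: "finite U" using cU n by (intro card_ge_0_finite) simp
    have "\<exists>z. z \<in> B \<and> \<phi> z = u" if "u \<in> U" for u
    proof -
      have "norm u ^ nat n < e ^ nat n" using that w unfolding U_def by (simp flip: norm_power)
      then have "norm u < e" by (rule power_less_imp_less_base) (use e(1) in simp)
      then have "u \<in> ball 0 e" by simp
      then show ?thesis using e(2) by blast
    qed
    then obtain h where h: "\<And>u. u \<in> U \<Longrightarrow> h u \<in> B" "\<And>u. u \<in> U \<Longrightarrow> \<phi> (h u) = u"
      using bchoice[of U "\<lambda>u z. z \<in> B \<and> \<phi> z = u"] by blast
    have inj: "inj_on h U" using h(2) by (intro inj_on_inverseI[of _ \<phi>]) auto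
    show "\<exists>Z. finite Z \<and> card Z = nat n \<and> Z \<subseteq> ball z0 r \<inter> S \<and> (\<forall>z\<in>Z. f z = w)"
    proof (intro exI[of _ "h ` U"] conjI ballI)
      show "finite (h ` U)" using fU by simp
      show "card (h ` U) = nat n" using card_image[OF inj] cU by simp
      show "h ` U \<subseteq> ball z0 r \<inter> S" using h(1) B(4,5) r1(2) by blast
      fix z assume "z \<in> h ` U"
      then obtain u where u: "u \<in> U" "z = h u" by blast
      have "f z = f z0 + u ^ nat n" using fph[OF h(1)[OF u(1)]] h(2)[OF u(1)] u(2) by simp
      then show "f z = w" using u(1) by (simp add: U_def)
    qed
  qed
qed

text \<open>
A substitute for Hurwitz' theorem: a bound on the number of distinct preimages of values arbitrarily
close to b is inherited by the total order of the preimages of b.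
\<close>

lemma total_order_bound:
  fixes f :: "complex \<Rightarrow> complex"
  assumes S: "open S" "connected S" and f: "f holomorphic_on S" and nc: "\<exists>w\<in>S. f w \<noteq> b"
    and Z: "finite Z" "Z \<subseteq> S" "\<And>z. z \<in> Z \<Longrightarrow> f z = b"
    and near: "\<And>\<epsilon>. \<epsilon> > 0 \<Longrightarrow> \<exists>w. w \<noteq> b \<and> norm (w - b) < \<epsilon> \<and> (\<forall>Z'. finite Z' \<longrightarrow> Z' \<subseteq> S \<longrightarrow> (\<forall>z\<in>Z'. f z = w) \<longrightarrow> card Z' \<le> m)"
  shows "(\<Sum>z\<in>Z. nat (zorder (\<lambda>z. f z - b) z)) \<le> m"
proof -
  have "\<exists>r>0. \<forall>z\<in>Z. \<forall>z'\<in>Z. z \<noteq> z' \<longrightarrow> r \<le> dist z z'"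
  proof -
    have "\<forall>z\<in>Z. \<forall>\<^sub>F r in at_right 0. \<forall>z'\<in>Z. z \<noteq> z' \<longrightarrow> r \<le> dist z z'"
    proof
      fix z assume "z \<in> Z"
      obtain d where d: "d > 0" "\<forall>x\<in>Z. x \<noteq> z \<longrightarrow> d \<le> dist z x" using finite_set_avoid[OF Z(1), of z] by blast
      show "\<forall>\<^sub>F r in at_right 0. \<forall>z'\<in>Z. z \<noteq> z' \<longrightarrow> r \<le> dist z z'"
        using eventually_at_right_real[OF d(1)] by eventually_elim (use d(2) in force)
    qed
    then have "\<forall>\<^sub>F r in at_right 0. \<forall>z\<in>Z. \<forall>z'\<in>Z. z \<noteq> z' \<longrightarrow> r \<le> dist z z'"
      by (rule eventually_ball_finite[OF Z(1)])
    moreover have "\<forall>\<^sub>F r in at_right 0. r > (0::real)" by (rule eventually_at_right_less)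
    ultimately have "\<forall>\<^sub>F r in at_right 0. r > (0::real) \<and> (\<forall>z\<in>Z. \<forall>z'\<in>Z. z \<noteq> z' \<longrightarrow> r \<le> dist z z')"
      by eventually_elim blast
    then show ?thesis using eventually_happens' trivial_limit_at_right_real by blast
  qed
  then obtain r where r: "r > 0" "\<And>z z'. z \<in> Z \<Longrightarrow> z' \<in> Z \<Longrightarrow> z \<noteq> z' \<Longrightarrow> r \<le> dist z z'" by blast
  define ord where "ord z = nat (zorder (\<lambda>z. f z - b) z)" for z
  define P where "P z \<delta> \<longleftrightarrow> (\<forall>w. 0 < norm (w - b) \<and> norm (w - b) < \<delta> \<longrightarrow>
     (\<exists>Z'. finite Z' \<and> card Z' = ord z \<and> Z' \<subseteq> ball z (r / 2) \<inter> S \<and> (\<forall>z\<in>Z'. f z = w)))" for z \<delta>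
  have "\<forall>z\<in>Z. \<forall>\<^sub>F \<delta> in at_right 0. P z \<delta>"
  proof
    fix z assume z: "z \<in> Z"
    have zb: "f z = b" "z \<in> S" using Z z by auto
    obtain \<delta> where "\<delta> > 0" "P z \<delta>"
      using zero_splits(2)[OF S f zb(2), of "r / 2"] nc r(1) unfolding zb(1) P_def ord_def by auto
    then show "\<forall>\<^sub>F \<delta> in at_right 0. P z \<delta>"
      using eventually_at_right_real[of 0 \<delta>] by (auto elim!: eventually_mono simp: P_def)
  qed
  then have "\<forall>\<^sub>F \<delta> in at_right 0. \<forall>z\<in>Z. P z \<delta>" by (rule eventually_ball_finite[OF Z(1)])
  moreover have "\<forall>\<^sub>F r in at_right 0. r > (0::real)" by (rule eventually_at_right_less)
  ultimately have "\<forall>\<^sub>F \<delta> in at_right 0. \<delta> > (0::real) \<and> (\<forall>z\<in>Z. P z \<delta>)"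
    by eventually_elim blast
  then obtain \<delta> where \<delta>: "\<delta> > 0" "\<And>z. z \<in> Z \<Longrightarrow> P z \<delta>"
    using eventually_happens' trivial_limit_at_right_real by blast
  obtain w where w: "w \<noteq> b" "norm (w - b) < \<delta>" "\<And>Z'. finite Z' \<Longrightarrow> Z' \<subseteq> S \<Longrightarrow> (\<forall>z\<in>Z'. f z = w) \<Longrightarrow> card Z' \<le> m"
    using near[OF \<delta>(1)] by blast
  have "\<forall>z\<in>Z. \<exists>Z'. finite Z' \<and> card Z' = ord z \<and> Z' \<subseteq> ball z (r / 2) \<inter> S \<and> (\<forall>z\<in>Z'. f z = w)"
    using \<delta>(2) w(1,2) by (auto simp: P_def)
  then obtain F where F: "\<And>z. z \<in> Z \<Longrightarrow> finite (F z)" "\<And>z. z \<in> Z \<Longrightarrow> card (F z) = ord z"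
      "\<And>z. z \<in> Z \<Longrightarrow> F z \<subseteq> ball z (r / 2) \<inter> S" "\<And>z x. z \<in> Z \<Longrightarrow> x \<in> F z \<Longrightarrow> f x = w"
    using bchoice[of Z "\<lambda>z Z'. finite Z' \<and> card Z' = ord z \<and> Z' \<subseteq> ball z (r / 2) \<inter> S \<and> (\<forall>z\<in>Z'. f z = w)"] by blast
  have disj: "F z \<inter> F z' = {}" if z: "z \<in> Z" "z' \<in> Z" "z \<noteq> z'" for z z'
  proof (rule ccontr)
    assume "F z \<inter> F z' \<noteq> {}"
    then obtain x where "x \<in> F z" "x \<in> F z'" by blast
    then have "x \<in> ball z (r / 2)" "x \<in> ball z' (r / 2)" using F(3)[OF z(1)] F(3)[OF z(2)] by blast+
    then have "dist z x < r / 2" "dist z' x < r / 2" by simp_all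
    then have "dist z z' < r" using dist_triangle2[of z z' x] by linarith
    then show False using r(2)[OF z] by simp
  qed
  have "(\<Sum>z\<in>Z. ord z) = card (\<Union>z\<in>Z. F z)"
    using F(1,2) disj by (subst card_UN_disjoint[OF Z(1)]) auto
  also have "\<dots> \<le> m" by (rule w(3)) (use Z(1) F in blast)+
  finally show ?thesis by (simp add: ord_def)
qed

section \<open>Counting zeros in the unit disc\<close>

definition disc_zeros :: "real \<Rightarrow> real \<Rightarrow> complex set" where
  "disc_zeros \<theta> d = {z. norm z < 1 \<and> of_real ((sin (pi * \<theta>))^2) + hill_fun d z = 0}"

lemma disc_zeros_not_nonneg:
  assumes "d \<noteq> 0" "z \<in> disc_zeros \<theta> d"
  shows "z \<notin> \<real>\<^sub>\<ge>\<^sub>0"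
proof
  assume "z \<in> \<real>\<^sub>\<ge>\<^sub>0"
  then obtain x where x: "z = of_real x" "x \<ge> 0" by (auto elim: nonneg_Reals_cases)
  then have "x < 1" using assms(2) by (simp add: disc_zeros_def)
  then obtain y where y: "hill_fun d z = of_real y" "y > 0" using hill_fun_pos[OF x(2) _ assms(1)] x(1) by blast
  have "complex_of_real ((sin (pi * \<theta>))^2 + y) = 0" using assms(2) y(1) by (simp add: disc_zeros_def)
  then have "(sin (pi * \<theta>))^2 + y = 0" by (simp only: of_real_eq_0_iff)
  then show False using y(2) by (smt (verit) zero_le_power2)
qed

lemma disc_zeros_evans_at:
  assumes "\<bar>\<theta>\<bar> < 3 / 4" "d \<noteq> 0" "z \<in> disc_zeros \<theta> d"
  shows "evans_at \<theta> d z = 0"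
proof -
  have z: "norm z < 1" using assms by (simp add: disc_zeros_def)
  have "sinh (pi * d) \<noteq> 0" using assms(2) by simp
  then have "(sinh (pi * d))^2 > 0" by simp
  then have "(sin (pi * \<theta>))^2 + (sinh (pi * d))^2 > 0" by (intro add_nonneg_pos) auto
  moreover have "(1 - z) * of_real ((sin (pi * \<theta>))^2 + (sinh (pi * d))^2) * evans_at \<theta> d z = 0"
    using theta_dependence[OF assms(1,2) z] assms(3) by (simp add: disc_zeros_def)
  moreover have "1 - z \<noteq> 0" using z by auto
  ultimately show ?thesis
    by (metis less_irrefl mult_eq_0_iff of_real_eq_0_iff)
qed

lemma weight_sign:
  assumes "d \<noteq> 0"
  shows "weight \<theta> d n < 0 \<longleftrightarrow> (\<theta> + of_int n)^2 + d^2 < 1" "weight \<theta> d n = 0 \<longleftrightarrow> (\<theta> + of_int n)^2 + d^2 = 1"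
    "weight \<theta> d n \<le> 1"
proof -
  have "(\<theta> + of_int n)^2 + d^2 > 0" using assms by (intro add_nonneg_pos) auto
  then show "weight \<theta> d n < 0 \<longleftrightarrow> (\<theta> + of_int n)^2 + d^2 < 1" "weight \<theta> d n = 0 \<longleftrightarrow> (\<theta> + of_int n)^2 + d^2 = 1" "weight \<theta> d n \<le> 1"
    by (auto simp: weight_def field_simps)
qed

text \<open>
For \<theta> in [0, 1/2] only the circles with index 0 and -1 can contain the point or pass through
it.
\<close>

lemma far_circle:
  fixes \<theta> d :: real and n :: int
  assumes "0 \<le> \<theta>" "\<theta> \<le> 1 / 2" "d \<noteq> 0" "n \<noteq> 0" "n \<noteq> -1"
  shows "(\<theta> + of_int n)^2 + d^2 > 1"
proof -
  have "n \<ge> 1 \<or> n \<le> -2" using assms by linarith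
  then have "\<bar>\<theta> + of_int n\<bar> \<ge> 1" using assms by (auto simp: abs_if) 
  then have "(\<theta> + of_int n)^2 \<ge> 1" using abs_le_square_iff[of 1 "\<theta> + of_int n"] by simp
  then show ?thesis using assms(3) by (smt (verit) zero_less_power2)
qed

text \<open>
The hypothesis that the point is on no circle makes all weights nonzero, which the form with
coefficients 1/\<rho>_n requires.
\<close>

lemma disc_zeros_card_le:
  assumes \<theta>: "0 \<le> \<theta>" "\<theta> \<le> 1 / 2" and d: "d \<noteq> 0"
    and off: "\<theta>^2 + d^2 \<noteq> 1" "(1 - \<theta>)^2 + d^2 \<noteq> 1"
    and Z: "finite Z" "Z \<subseteq> disc_zeros \<theta> d"
  shows "card Z \<le> (if \<theta>^2 + d^2 < 1 then 1 else 0) + (if (1 - \<theta>)^2 + d^2 < 1 then 1 else 0)"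
proof -
  have m1: "(\<theta> + of_int (-1))^2 = (1 - \<theta>)^2" by (simp add: power2_eq_square algebra_simps)
  have neg: "{n. weight \<theta> d n < 0} = (if \<theta>^2 + d^2 < 1 then {0} else {}) \<union> (if (1 - \<theta>)^2 + d^2 < 1 then {-1} else {})" (is "_ = ?A")
  proof (rule Set.set_eqI)
    fix n
    show "n \<in> {n. weight \<theta> d n < 0} \<longleftrightarrow> n \<in> ?A"
      using far_circle[OF \<theta> d, of n] m1 by (cases "n = 0"; cases "n = -1") (auto simp: weight_sign[OF d])
  qed
  have "card Z \<le> card {n. weight \<theta> d n < 0}"
  proof (rule evans_zeros_card_le[OF _ _ _ _ Z(1)])
    show "admissible2 (\<lambda>n. of_real (weight \<theta> d n))" by (rule admissible2_weight) (use \<theta> in auto)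
    show "weight \<theta> d n \<noteq> 0" for n
      using far_circle[OF \<theta> d, of n] m1 off by (cases "n = 0"; cases "n = -1") (auto simp: weight_sign[OF d])
    show "\<bar>weight \<theta> d n\<bar> \<le> 1" if "2 \<le> \<bar>n\<bar>" for n
    proof -
      have "n \<noteq> 0" "n \<noteq> -1" using that by auto
      then have "\<not> weight \<theta> d n < 0" using far_circle[OF \<theta> d, of n] by (simp add: weight_sign[OF d])
      then show ?thesis using weight_sign(3)[OF d] by simp
    qed
    show "finite {n. weight \<theta> d n < 0}" unfolding neg by simp
    fix z assume z: "z \<in> Z"
    then have "z \<in> disc_zeros \<theta> d" using Z(2) by blast
    then show "norm z < 1" "z \<notin> \<real>\<^sub>\<ge>\<^sub>0" "evans z (\<lambda>n. of_real (weight \<theta> d n)) = 0"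
      using disc_zeros_not_nonneg[OF d] disc_zeros_evans_at[OF _ d] \<theta> by (auto simp: disc_zeros_def evans_at_def)
  qed
  also have "card {n. weight \<theta> d n < 0} = (if \<theta>^2 + d^2 < 1 then 1 else 0) + (if (1 - \<theta>)^2 + d^2 < 1 then 1 else 0)"
    unfolding neg by auto
  finally show ?thesis .
qed

lemma sin_sq_strict_mono:
  assumes "0 \<le> a" "a < b" "b \<le> 1 / 2"
  shows "(sin (pi * a))^2 < (sin (pi * b))^2"
proof -
  have "sin (pi * a) < sin (pi * b)"
  proof (rule sin_monotone_2pi)
    have "0 \<le> pi * a" using assms by simp
    then show "- (pi / 2) \<le> pi * a" using pi_gt_zero by linarith
    show "pi * a < pi * b" using assms by simp
    show "pi * b \<le> pi / 2" using assms by simp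
  qed
  moreover have "0 \<le> sin (pi * a)" using assms by (intro sin_ge_zero) auto
  ultimately show ?thesis by (intro power_strict_mono) auto
qed

lemma hill_fun_0: "hill_fun d 0 = of_real ((sinh (pi * d))^2)"
proof -
  have "jost 0 r = 1" for r
  proof -
    have "continuant 0 r n = 1" for n by (induction "0::complex" r n rule: continuant.induct) auto
    then have "continuant 0 r = (\<lambda>_. 1)" by (rule ext)
    then show ?thesis by (simp add: jost_def)
  qed
  then show ?thesis by (simp add: hill_fun_def evans_def jost_left_def jost_right_def)
qed

definition zero_order :: "real \<Rightarrow> real \<Rightarrow> complex \<Rightarrow> int" where
  "zero_order \<theta> d z = zorder (\<lambda>z. of_real ((sin (pi * \<theta>))^2) + hill_fun d z) z"

lemma hill_fun_nonconst:
  assumes "d \<noteq> 0" shows "\<exists>w\<in>ball 0 1. hill_fun d w \<noteq> - of_real ((sin (pi * \<theta>))^2)"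
proof (intro bexI[of _ 0] notI)
  assume "hill_fun d 0 = - of_real ((sin (pi * \<theta>))^2)"
  then have "complex_of_real ((sinh (pi * d))^2 + (sin (pi * \<theta>))^2) = 0" by (simp add: hill_fun_0)
  then have "(sinh (pi * d))^2 + (sin (pi * \<theta>))^2 = 0" by (simp only: of_real_eq_0_iff)
  then have "sinh (pi * d) = 0" by (simp add: sum_power2_eq_zero_iff)
  then show False using assms by simp
qed simp

lemma zero_order_pos:
  assumes d: "d \<noteq> 0" and z: "z \<in> disc_zeros \<theta> d"
  shows "zero_order \<theta> d z > 0"
proof -
  have e: "hill_fun d z = - of_real ((sin (pi * \<theta>))^2)"
    using z by (simp add: disc_zeros_def eq_neg_iff_add_eq_0 add.commute)
  have "zorder (\<lambda>x. hill_fun d x - hill_fun d z) z > 0"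
    by (rule zero_splits(1)[where S = "ball 0 1" and r = 1])
       (use z hill_fun_nonconst[OF d] e hill_fun_holomorphic in \<open>auto simp: disc_zeros_def\<close>)
  then show ?thesis unfolding e zero_order_def by (simp add: add.commute)
qed

text \<open>
The parameter \<theta> enters the characteristic function only as an additive constant, so
perturbing \<theta> is the same as prescribing a nearby value of the \<theta>-independent part.
\<close>

lemma zero_order_sum_le:
  assumes d: "d \<noteq> 0" and Z: "finite Z" "Z \<subseteq> disc_zeros \<theta> d"
    and near: "\<And>\<epsilon>. \<epsilon> > 0 \<Longrightarrow> \<exists>\<theta>'. \<bar>\<theta>' - \<theta>\<bar> < \<epsilon> \<and> (sin (pi * \<theta>'))^2 \<noteq> (sin (pi * \<theta>))^2 \<and>
        (\<forall>Z'. finite Z' \<longrightarrow> Z' \<subseteq> disc_zeros \<theta>' d \<longrightarrow> card Z' \<le> m)"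
  shows "(\<Sum>z\<in>Z. nat (zero_order \<theta> d z)) \<le> m"
proof -
  define b where "b = - complex_of_real ((sin (pi * \<theta>))^2)"
  have "(\<Sum>z\<in>Z. nat (zorder (\<lambda>z. hill_fun d z - b) z)) \<le> m"
  proof (rule total_order_bound[OF open_ball connected_ball hill_fun_holomorphic _ Z(1)])
    show "\<exists>w\<in>ball 0 1. hill_fun d w \<noteq> b" unfolding b_def by (rule hill_fun_nonconst[OF d])
    show "Z \<subseteq> ball 0 1" using Z(2) by (auto simp: disc_zeros_def)
    show "hill_fun d z = b" if "z \<in> Z" for z
      using that Z(2) by (auto simp: disc_zeros_def b_def eq_neg_iff_add_eq_0 add.commute)
    fix \<epsilon> :: real assume \<epsilon>: "\<epsilon> > 0"
    have "isCont (\<lambda>t. (sin (pi * t))^2) \<theta>" by (intro continuous_intros)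
    then obtain e where e: "e > 0" "\<And>t. \<bar>t - \<theta>\<bar> < e \<Longrightarrow> \<bar>(sin (pi * t))^2 - (sin (pi * \<theta>))^2\<bar> < \<epsilon>"
      using \<epsilon> unfolding continuous_at_eps_delta dist_real_def by blast
    obtain \<theta>' where t: "\<bar>\<theta>' - \<theta>\<bar> < e" "(sin (pi * \<theta>'))^2 \<noteq> (sin (pi * \<theta>))^2"
       "\<And>Z'. finite Z' \<Longrightarrow> Z' \<subseteq> disc_zeros \<theta>' d \<Longrightarrow> card Z' \<le> m"
      using near[OF e(1)] by blast
    define w where "w = - complex_of_real ((sin (pi * \<theta>'))^2)"
    have wb: "w - b = of_real ((sin (pi * \<theta>))^2 - (sin (pi * \<theta>'))^2)" by (simp add: w_def b_def)
    show "\<exists>w. w \<noteq> b \<and> norm (w - b) < \<epsilon> \<and> (\<forall>Z'. finite Z' \<longrightarrow> Z' \<subseteq> ball 0 1 \<longrightarrow> (\<forall>z\<in>Z'. hill_fun d z = w) \<longrightarrow> card Z' \<le> m)"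
    proof (intro exI[of _ w] conjI allI impI)
      show "w \<noteq> b" using t(2) by (simp add: w_def b_def flip: of_real_power)
      show "norm (w - b) < \<epsilon>" unfolding wb norm_of_real using e(2)[OF t(1)] by linarith
      fix Z' assume Z': "finite Z'" "Z' \<subseteq> ball 0 1" "\<forall>z\<in>Z'. hill_fun d z = w"
      show "card Z' \<le> m" by (rule t(3)[OF Z'(1)]) (use Z' in \<open>auto simp: disc_zeros_def w_def\<close>)
    qed
  qed
  then show ?thesis by (simp add: zero_order_def b_def add.commute)
qed

section \<open>Zeros on the negative real axis\<close>

lemma hill_fun_real:
  assumes "\<bar>x\<bar> < 1"
  shows "hill_fun d (of_real x) = of_real (Re (hill_fun d (of_real x)))"
proof -
  have "cnj (hill_fun d (of_real x)) = hill_fun d (of_real x)" using hill_fun_cnj[of "of_real x" d] assms by simp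
  then have "hill_fun d (of_real x) \<in> \<real>" by (simp add: Reals_cnj_iff)
  then show ?thesis by simp
qed

text \<open>
The characteristic function restricted to the real axis, where it is real.
\<close>

definition hill_real :: "real \<Rightarrow> real \<Rightarrow> real \<Rightarrow> real" where
  "hill_real \<theta> d x = (sin (pi * \<theta>))^2 + Re (hill_fun d (of_real x))"

lemma hill_real_zero: "\<bar>x\<bar> < 1 \<Longrightarrow> of_real x \<in> disc_zeros \<theta> d \<longleftrightarrow> hill_real \<theta> d x = 0"
proof -
  assume x: "\<bar>x\<bar> < 1"
  have "of_real ((sin (pi * \<theta>))^2) + hill_fun d (of_real x) = of_real (hill_real \<theta> d x)"
    using hill_fun_real[OF x, of d] by (simp add: hill_real_def)
  then show ?thesis using x by (simp add: disc_zeros_def)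
qed

lemma hill_real_continuant: "continuous_on {-1<..<1} (hill_real \<theta> d)"
proof -
  have "continuous_on (ball 0 1) (hill_fun d)" using hill_fun_holomorphic holomorphic_on_imp_continuous_on by blast
  then have "continuous_on {-1<..<1} (\<lambda>x. hill_fun d (of_real x))"
    by (rule continuous_on_compose2) (auto intro!: continuous_intros)
  then show ?thesis unfolding hill_real_def by (intro continuous_intros)
qed

lemma hill_real_0: "d \<noteq> 0 \<Longrightarrow> hill_real \<theta> d 0 > 0"
proof -
  assume d: "d \<noteq> 0"
  then have "sinh (pi * d) \<noteq> 0" by simp
  then have "(sinh (pi * d))^2 > 0" by simp
  then show ?thesis by (simp add: hill_real_def hill_fun_0 add_nonneg_pos)
qed

lemma hill_real_evans_at:
  assumes "\<bar>\<theta>\<bar> < 3 / 4" "d \<noteq> 0" "\<bar>x\<bar> < 1"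
  shows "hill_real \<theta> d x = (1 - x) * ((sin (pi * \<theta>))^2 + (sinh (pi * d))^2) * Re (evans_at \<theta> d (of_real x))"
proof -
  have "hill_real \<theta> d x = Re (of_real ((sin (pi * \<theta>))^2) + hill_fun d (of_real x))" by (simp add: hill_real_def)
  also have "\<dots> = Re (of_real ((1 - x) * ((sin (pi * \<theta>))^2 + (sinh (pi * d))^2)) * evans_at \<theta> d (of_real x))"
    by (subst theta_dependence[OF assms(1,2)]) (use assms(3) in auto)
  also have "\<dots> = (1 - x) * ((sin (pi * \<theta>))^2 + (sinh (pi * d))^2) * Re (evans_at \<theta> d (of_real x))"
    by (subst times_complex.sel) (simp only: Re_complex_of_real Im_complex_of_real mult_zero_left diff_zero)
  finally show ?thesis .
qed

lemma hill_real_evans_at_sgn: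
  assumes "\<bar>\<theta>\<bar> < 3 / 4" "d \<noteq> 0" "\<bar>x\<bar> < 1"
  shows "hill_real \<theta> d x < 0 \<longleftrightarrow> Re (evans_at \<theta> d (of_real x)) < 0" "hill_real \<theta> d x > 0 \<longleftrightarrow> Re (evans_at \<theta> d (of_real x)) > 0"
proof -
  have "sinh (pi * d) \<noteq> 0" using assms(2) by simp
  then have "(sin (pi * \<theta>))^2 + (sinh (pi * d))^2 > 0" by (intro add_nonneg_pos) auto
  then have "(1 - x) * ((sin (pi * \<theta>))^2 + (sinh (pi * d))^2) > 0" using assms(3) by simp
  then show "hill_real \<theta> d x < 0 \<longleftrightarrow> Re (evans_at \<theta> d (of_real x)) < 0" "hill_real \<theta> d x > 0 \<longleftrightarrow> Re (evans_at \<theta> d (of_real x)) > 0"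
    unfolding hill_real_evans_at[OF assms] by (auto simp: mult_less_0_iff zero_less_mult_iff)
qed

lemma hill_real_ivt:
  assumes "-1 < a" "a < b" "b < 1" "hill_real \<theta> d a * hill_real \<theta> d b < 0"
  obtains x where "a < x" "x < b" "hill_real \<theta> d x = 0"
proof -
  have c: "continuous_on {a..b} (hill_real \<theta> d)" by (rule continuous_on_subset[OF hill_real_continuant]) (use assms in auto)
  have "\<exists>x. a \<le> x \<and> x \<le> b \<and> hill_real \<theta> d x = 0"
  proof (cases "hill_real \<theta> d a < 0")
    case True
    then have "hill_real \<theta> d b > 0" using assms(4) by (simp add: mult_less_0_iff)
    then show ?thesis using IVT'[of "hill_real \<theta> d" a 0 b] True assms(2) c by auto
  next
    case False
    then have "hill_real \<theta> d b < 0" "hill_real \<theta> d a > 0" using assms(4) by (auto simp: mult_less_0_iff)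
    then show ?thesis using IVT2'[of "hill_real \<theta> d" b 0 a] assms(2) c by auto
  qed
  then obtain x where x: "a \<le> x" "x \<le> b" "hill_real \<theta> d x = 0" by blast
  moreover have "x \<noteq> a" "x \<noteq> b" using x(3) assms(4) by auto
  ultimately show thesis by (intro that[of x]) auto
qed

text \<open>
The function is positive at 0 and negative close to -1.
\<close>

lemma disc_zeros_exist_I:
  assumes \<theta>: "0 \<le> \<theta>" "\<theta> \<le> 1 / 2" and d: "d \<noteq> 0"
    and reg: "\<theta>^2 + d^2 < 1" "(1 - \<theta>)^2 + d^2 \<ge> 1"
  obtains x where "-1 < x" "x < 0" "of_real x \<in> disc_zeros \<theta> d"
proof -
  have m1: "(\<theta> + of_int (-1))^2 = (1 - \<theta>)^2" by (simp add: power2_eq_square algebra_simps)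
  have admissible: "admissible2 (\<lambda>n. of_real (weight \<theta> d n))" by (rule admissible2_weight) (use \<theta> in auto)
  obtain v where v: "0 < v" "v < 1" "Re (evans (of_real (- v)) (\<lambda>n. of_real (weight \<theta> d n))) < 0"
  proof (rule evans_negative_near[OF admissible])
    show "weight \<theta> d 0 < 0" using reg(1) by (simp add: weight_sign[OF d])
    show "0 < weight \<theta> d n" if "n \<ge> 1" for n
    proof -
      have "(\<theta> + of_int n)^2 + d^2 > 1" by (rule far_circle[OF \<theta> d]) (use that in auto)
      then have "\<not> weight \<theta> d n < 0" "weight \<theta> d n \<noteq> 0" by (auto simp: weight_sign[OF d])
      then show ?thesis by linarith
    qed
    show "weight \<theta> d n \<le> 1" for n by (rule weight_sign(3)[OF d])
    show "0 \<le> weight \<theta> d n" if "n \<le> -1" for n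
    proof -
      have "(\<theta> + of_int n)^2 + d^2 \<ge> 1"
        using far_circle[OF \<theta> d, of n] reg(2) m1 that by (cases "n = -1") auto
      then have "\<not> weight \<theta> d n < 0" by (auto simp: weight_sign[OF d])
      then show ?thesis by linarith
    qed
  qed
  have "hill_real \<theta> d (- v) < 0" using hill_real_evans_at_sgn(1)[of \<theta> d "- v"] v \<theta> d by (simp add: evans_at_def)
  then have "hill_real \<theta> d (- v) * hill_real \<theta> d 0 < 0" using hill_real_0[OF d] by (simp add: mult_neg_pos)
  then obtain x where x: "- v < x" "x < 0" "hill_real \<theta> d x = 0"
    using hill_real_ivt[of "- v" 0 \<theta> d] v by auto
  then show thesis using v hill_real_zero[of x \<theta> d] by (intro that[of x]) auto
qed

text \<open>
In region II the function is positive both at 0 and close to -1. A simple real zero is a change of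
sign, so there must be a second change of sign on the appropriate side.
\<close>

lemma second_real_zero_II:
  assumes \<theta>: "0 \<le> \<theta>" "\<theta> \<le> 1 / 2" and d: "d \<noteq> 0"
    and reg: "\<theta>^2 + d^2 < 1" "(1 - \<theta>)^2 + d^2 < 1"
    and x: "-1 < x" "x < 0" "of_real x \<in> disc_zeros \<theta> d" and o: "zero_order \<theta> d (of_real x) = 1"
  obtains x' where "-1 < x'" "x' < 0" "of_real x' \<in> disc_zeros \<theta> d" "x' \<noteq> x"
proof -
  have m1: "(\<theta> + of_int (-1))^2 = (1 - \<theta>)^2" by (simp add: power2_eq_square algebra_simps)
  have admissible: "admissible2 (\<lambda>n. of_real (weight \<theta> d n))" by (rule admissible2_weight) (use \<theta> in auto)
  obtain v0 where v0: "v0 < 1" "\<And>v. v0 < v \<Longrightarrow> 0 < v \<Longrightarrow> v < 1 \<Longrightarrow> Re (evans (of_real (- v)) (\<lambda>n. of_real (weight \<theta> d n))) > 0"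
  proof (rule evans_positive_near[OF admissible])
    show "weight \<theta> d 0 < 0" "weight \<theta> d (-1) < 0" using reg m1 by (simp_all only: weight_sign[OF d]) simp_all
    show "0 < weight \<theta> d n" if "n \<noteq> 0" "n \<noteq> -1" for n
    proof -
      have "(\<theta> + of_int n)^2 + d^2 > 1" by (rule far_circle[OF \<theta> d]) (use that in auto)
      then have "\<not> weight \<theta> d n < 0" "weight \<theta> d n \<noteq> 0" by (auto simp: weight_sign[OF d])
      then show ?thesis by linarith
    qed
    show "weight \<theta> d n \<le> 1" for n by (rule weight_sign(3)[OF d])
  qed (use that in blast)
  \<comment> \<open>A point -v to the left of x at which the function is already positive.\<close>
  define v where "v = max ((1 + v0) / 2) ((1 - x) / 2)"
  have v1: "(1 + v0) / 2 \<le> v" and v2: "(1 - x) / 2 \<le> v" by (simp_all add: v_def)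
  have v3: "v < 1" using v0(1) x by (simp add: v_def)
  have v4: "v0 < v" using v1 v0(1) by argo
  have v5: "- v < x" using v2 x(1) by argo
  have v6: "0 < v" using v2 x(2) by argo
  note v = v4 v3 v5 v6
  have pm: "hill_real \<theta> d (- v) > 0" using hill_real_evans_at_sgn(2)[of \<theta> d "- v"] v v0(2)[of v] \<theta> d by (simp add: evans_at_def)
  define f where "f z = of_real ((sin (pi * \<theta>))^2) + hill_fun d z" for z
  have f_hol: "f holomorphic_on ball 0 1" unfolding f_def by (intro holomorphic_intros hill_fun_holomorphic)
  have x1: "\<bar>x\<bar> < 1" using x by simp
  have fx: "f (of_real x) = 0" using x(3) by (simp add: disc_zeros_def f_def)
  have f_kr: "f (of_real y) = of_real (hill_real \<theta> d y)" if "\<bar>y\<bar> < 1" for y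
    using hill_fun_real[OF that, of d] by (simp add: f_def hill_real_def)
  have dnz: "deriv f (of_real x) \<noteq> 0"
  proof -
    have xb: "complex_of_real x \<in> ball 0 1" using x1 by simp
    have ex: "\<exists>w\<in>ball 0 1. f w \<noteq> 0" using hill_fun_nonconst[OF d, of \<theta>] by (auto simp: f_def eq_neg_iff_add_eq_0 add.commute)
    have "\<exists>r. r > 0 \<and> cball (complex_of_real x) r \<subseteq> ball 0 1 \<and> zor_poly f (of_real x) holomorphic_on cball (of_real x) r
       \<and> (\<forall>w\<in>cball (of_real x) r. f w = zor_poly f (of_real x) w * (w - of_real x) ^ nat (zorder f (of_real x)) \<and> zor_poly f (of_real x) w \<noteq> 0)"
      by (rule conjunct2[OF zorder_exist_zero[OF f_hol open_ball connected_ball xb ex]])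
    then obtain r where r0: "r > 0 \<and> cball (complex_of_real x) r \<subseteq> ball 0 1 \<and> zor_poly f (of_real x) holomorphic_on cball (of_real x) r
       \<and> (\<forall>w\<in>cball (of_real x) r. f w = zor_poly f (of_real x) w * (w - of_real x) ^ nat (zorder f (of_real x)) \<and> zor_poly f (of_real x) w \<noteq> 0)" ..
    note r = r0[THEN conjunct1] r0[THEN conjunct2, THEN conjunct1] r0[THEN conjunct2, THEN conjunct2, THEN conjunct1]
      r0[THEN conjunct2, THEN conjunct2, THEN conjunct2, THEN bspec]
    define g where "g = zor_poly f (of_real x)"
    have o1: "nat (zorder f (of_real x)) = 1" using o by (simp add: zero_order_def f_def[abs_def])
    have fg: "f w = g w * (w - of_real x)" if "w \<in> ball (of_real x) r" for w
      using r(4)[of w] that unfolding o1 by (simp add: g_def)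
    have gh: "g holomorphic_on ball (of_real x) r"
      using r(3) holomorphic_on_subset ball_subset_cball by (auto simp: g_def)
    have "(g has_field_derivative deriv g (of_real x)) (at (of_real x))"
      using gh r(1) holomorphic_derivI[OF _ open_ball, of g "of_real x" r "of_real x"] by simp
    then have "((\<lambda>w. g w * (w - of_real x)) has_field_derivative g (of_real x)) (at (of_real x))"
      by (auto intro!: derivative_eq_intros)
    then have "(f has_field_derivative g (of_real x)) (at (of_real x))"
      by (rule has_field_derivative_transform_within_open[OF _ open_ball[of "of_real x" r]]) (use r(1) fg in auto)
    then have "deriv f (of_real x) = g (of_real x)" by (rule DERIV_imp_deriv)
    then show ?thesis using r(4)[of "of_real x"] r(1) by (simp add: g_def)
  qed
  have fd: "(f has_field_derivative deriv f (of_real x)) (at (of_real x))"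
    by (rule holomorphic_derivI[OF f_hol open_ball]) (use x1 in simp)
  define D where "D = Re (deriv f (of_real x))"
  have krd: "(hill_real \<theta> d has_real_derivative D) (at x)"
  proof -
    have "((\<lambda>y. f (of_real y)) has_vector_derivative deriv f (of_real x)) (at x)"
      using has_vector_derivative_real_field[OF fd] .
    then have "((\<lambda>y. Re (f (of_real y))) has_vector_derivative D) (at x)"
      unfolding D_def by (rule bounded_linear.has_vector_derivative[OF bounded_linear_Re])
    then have "((\<lambda>y. Re (f (of_real y))) has_real_derivative D) (at x)"
      by (simp add: has_real_derivative_iff_has_vector_derivative)
    then show ?thesis
      by (rule has_field_derivative_transform_within_open[of _ _ _ "{-1<..<1}"]) (use x in \<open>auto simp: f_kr\<close>)
  qed
  have imd: "Im (deriv f (of_real x)) = 0"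
  proof -
    have "((\<lambda>y. f (of_real y)) has_vector_derivative deriv f (of_real x)) (at x)"
      using has_vector_derivative_real_field[OF fd] .
    then have "((\<lambda>y. Im (f (of_real y))) has_vector_derivative Im (deriv f (of_real x))) (at x)"
      by (rule bounded_linear.has_vector_derivative[OF bounded_linear_Im])
    then have "((\<lambda>y. Im (f (of_real y))) has_real_derivative Im (deriv f (of_real x))) (at x)"
      by (simp add: has_real_derivative_iff_has_vector_derivative)
    then have "((\<lambda>y. 0) has_real_derivative Im (deriv f (of_real x))) (at x)"
      by (rule has_field_derivative_transform_within_open[of _ _ _ "{-1<..<1}"]) (use x in \<open>auto simp: f_kr\<close>)
    then show ?thesis using DERIV_unique[OF _ DERIV_const] by blast
  qed
  have D0: "D \<noteq> 0" using dnz imd by (auto simp: D_def complex_eq_iff)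
  have kx: "hill_real \<theta> d x = 0" using hill_real_zero[OF x1] x(3) by blast
  show thesis
  proof (cases "D > 0")
    case True
    obtain e where e: "e > 0" "\<And>h. 0 < h \<Longrightarrow> h < e \<Longrightarrow> hill_real \<theta> d (x - h) < hill_real \<theta> d x"
      using DERIV_pos_inc_left[OF krd True] by blast
    define h where "h = min (e / 2) ((x + v) / 2)"
    have h1: "h \<le> e / 2" "h \<le> (x + v) / 2"
      unfolding h_def by (rule min.cobounded1, rule min.cobounded2)
    have h2: "0 < h" using e(1) v by (simp add: h_def)
    have h3: "h < e" using h1(1) e(1) by argo
    have h4: "- v < x - h" using h1(2) v(3) by argo
    note h = h2 h3 h4
    have "hill_real \<theta> d (- v) * hill_real \<theta> d (x - h) < 0" using e(2)[OF h(1,2)] kx pm by (simp add: mult_pos_neg)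
    then obtain x' where x': "- v < x'" "x' < x - h" "hill_real \<theta> d x' = 0"
      using hill_real_ivt[of "- v" "x - h" \<theta> d] v h x by auto
    then show thesis using hill_real_zero[of x' \<theta> d] v h x by (intro that[of x']) auto
  next
    case False
    then have Dn: "D < 0" using D0 by simp
    obtain e where e: "e > 0" "\<And>h. 0 < h \<Longrightarrow> h < e \<Longrightarrow> hill_real \<theta> d x > hill_real \<theta> d (x + h)"
      using DERIV_neg_dec_right[OF krd Dn] by blast
    define h where "h = min (e / 2) (- x / 2)"
    have h1: "h \<le> e / 2" "h \<le> - x / 2"
      unfolding h_def by (rule min.cobounded1, rule min.cobounded2)
    have h2: "0 < h" using e(1) x by (simp add: h_def)
    have h3: "h < e" using h1(1) e(1) by argo
    have h4: "x + h < 0" using h1(2) x(2) by argo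
    note h = h2 h3 h4
    have "hill_real \<theta> d (x + h) * hill_real \<theta> d 0 < 0" using e(2)[OF h(1,2)] kx hill_real_0[OF d] by (simp add: mult_neg_pos)
    then obtain x' where x': "x + h < x'" "x' < 0" "hill_real \<theta> d x' = 0"
      using hill_real_ivt[of "x + h" 0 \<theta> d] v h x by auto
    then show thesis using hill_real_zero[of x' \<theta> d] v h x by (intro that[of x']) auto
  qed
qed

section \<open>No decaying solutions on the cut\<close>

lemma recurrence_unique:
  fixes y :: "int \<Rightarrow> 'a::real_normed_field"
  assumes e: "\<And>n. 2 * c * y n = of_real (\<rho> n) * (y (n - 1) + y (n + 1))" and r: "\<And>n. \<rho> n \<noteq> 0"
    and 0: "y m = 0" "y (m + 1) = 0"
  shows "y n = 0"
proof -
  have up: "y (n + 1) = 2 * c * y n / of_real (\<rho> n) - y (n - 1)" and down: "y (n - 1) = 2 * c * y n / of_real (\<rho> n) - y (n + 1)" for n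
    using e[of n] r[of n] by (simp_all add: field_simps)
  have "y n = 0 \<and> y (n + 1) = 0"
  proof (induction n rule: int_induct[of _ m])
    case base show ?case using 0 by simp
  next
    case (step1 i) then show ?case using up[of "i + 1"] by simp
  next
    case (step2 i) then show ?case using down[of i] by simp
  qed
  then show ?thesis ..
qed

text \<open>
For |c| < 1 the quadratic form E_n = u_n^2 - 2 c u_n u_{n+1} + u_{n+1}^2 is positive definite and
conserved by the unperturbed recurrence. A perturbation of size 1/n^2 changes it by a convergent
product of factors only, so it cannot tend to 0 unless it vanishes from some index on.
\<close>

lemma energy_decay:
  fixes u \<eta> :: "nat \<Rightarrow> real"
  assumes c: "\<bar>c\<bar> < 1" and e: "\<And>n. n \<ge> n0 \<Longrightarrow> u (Suc (Suc n)) + u n = 2 * c * (1 + \<eta> (Suc n)) * u (Suc n)"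
    and \<eta>: "\<And>n. n \<ge> n0 \<Longrightarrow> 0 \<le> \<eta> (Suc n) \<and> \<eta> (Suc n) \<le> K / (real n + 1)^2"
    and lim: "u \<longlonglongrightarrow> 0"
  shows "\<exists>N. u N = 0 \<and> u (Suc N) = 0"
proof -
  define \<delta> where "\<delta> = 1 - \<bar>c\<bar>"
  have \<delta>: "\<delta> > 0" using c by (simp add: \<delta>_def)
  define E where "E n = (u n)^2 - 2 * c * u n * u (Suc n) + (u (Suc n))^2" for n
  have E_lower: "\<delta> * ((u n)^2 + (u (Suc n))^2) \<le> E n" for n
  proof -
    have "2 * \<bar>u n * u (Suc n)\<bar> \<le> (u n)^2 + (u (Suc n))^2"
      using sum_squares_bound[of "\<bar>u n\<bar>" "\<bar>u (Suc n)\<bar>"] by (simp add: abs_mult mult.assoc)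
    then have "\<bar>c\<bar> * (2 * \<bar>u n * u (Suc n)\<bar>) \<le> \<bar>c\<bar> * ((u n)^2 + (u (Suc n))^2)"
      by (rule mult_left_mono) simp
    moreover have "2 * c * u n * u (Suc n) \<le> \<bar>c\<bar> * (2 * \<bar>u n * u (Suc n)\<bar>)"
      using abs_ge_self[of "2 * c * u n * u (Suc n)"] by (simp add: abs_mult mult_ac)
    ultimately show ?thesis by (simp add: E_def \<delta>_def algebra_simps)
  qed
  have E0: "E n \<ge> 0" for n
    using E_lower[of n] \<delta> by (smt (verit) mult_nonneg_nonneg zero_le_power2)
  \<comment> \<open>The relative change of the energy in step n is at most of the order L / n^2.\<close>
  define L where "L = max 0 (K / \<delta>)"
  define \<kappa> where "\<kappa> n = L / (real n + 1)^2" for n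
  have \<kappa>0: "\<kappa> n \<ge> 0" for n by (simp add: \<kappa>_def L_def)
  have step: "E n * (1 - \<kappa> n) \<le> E (Suc n) * (1 + \<kappa> n)" if n: "n \<ge> n0" for n
  proof -
    define a b d where "a = u n" and "b = u (Suc n)" and "d = u (Suc (Suc n))"
    have eq: "d + a = 2 * c * (1 + \<eta> (Suc n)) * b" using e[OF n] by (simp add: a_def b_def d_def)
    have "E (Suc n) - E n = (d - a) * (d + a - 2 * c * b)"
      by (simp add: E_def a_def b_def d_def power2_eq_square algebra_simps)
    also have "\<dots> = \<eta> (Suc n) * (2 * c * b * (d - a))" unfolding eq by (simp add: algebra_simps)
    finally have diff: "E (Suc n) - E n = \<eta> (Suc n) * (2 * c * b * (d - a))" .
    have "\<bar>2 * c * b * (d - a)\<bar> \<le> 1 * (2 * \<bar>b\<bar> * \<bar>d - a\<bar>)"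
      using c by (simp add: abs_mult mult_right_mono mult_left_le_one_le mult.assoc)
    also have "2 * \<bar>b\<bar> * \<bar>d - a\<bar> \<le> 2 * \<bar>b\<bar> * (\<bar>d\<bar> + \<bar>a\<bar>)" by (intro mult_left_mono) auto
    also have "\<dots> \<le> (b^2 + d^2) + (a^2 + b^2)"
      using sum_squares_bound[of "\<bar>b\<bar>" "\<bar>d\<bar>"] sum_squares_bound[of "\<bar>a\<bar>" "\<bar>b\<bar>"] by (simp add: algebra_simps)
    finally have "\<bar>2 * c * b * (d - a)\<bar> \<le> (b^2 + d^2) + (a^2 + b^2)" by simp
    then have "\<delta> * \<bar>2 * c * b * (d - a)\<bar> \<le> \<delta> * ((b^2 + d^2) + (a^2 + b^2))" using \<delta> by (intro mult_left_mono) auto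
    also have "\<dots> \<le> E (Suc n) + E n"
      using E_lower[of n] E_lower[of "Suc n"] by (simp add: a_def b_def d_def algebra_simps)
    finally have m: "\<delta> * \<bar>2 * c * b * (d - a)\<bar> \<le> E (Suc n) + E n" .
    have "\<eta> (Suc n) \<le> \<delta> * \<kappa> n"
    proof -
      have "\<eta> (Suc n) \<le> K / (real n + 1)^2" using \<eta>[OF n] by simp
      also have "\<dots> \<le> \<delta> * \<kappa> n"
      proof -
        have "\<delta> * (K / \<delta>) \<le> \<delta> * L" using \<delta> by (intro mult_left_mono) (auto simp: L_def)
        then have "K \<le> \<delta> * L" using \<delta> by simp
        then show ?thesis by (simp add: \<kappa>_def divide_right_mono)
      qed
      finally show ?thesis .
    qed
    then have "\<eta> (Suc n) * \<bar>2 * c * b * (d - a)\<bar> \<le> (\<delta> * \<kappa> n) * \<bar>2 * c * b * (d - a)\<bar>"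
      by (intro mult_right_mono) auto
    also have "\<dots> = \<kappa> n * (\<delta> * \<bar>2 * c * b * (d - a)\<bar>)" by simp
    also have "\<dots> \<le> \<kappa> n * (E (Suc n) + E n)" using m \<kappa>0 by (intro mult_left_mono) auto
    finally have "\<bar>E (Suc n) - E n\<bar> \<le> \<kappa> n * (E (Suc n) + E n)"
      unfolding diff abs_mult using \<eta>[OF n] by simp
    then show ?thesis by (simp add: algebra_simps)
  qed
  have step2: "E n * (1 - 2 * \<kappa> n) \<le> E (Suc n)" if n: "n \<ge> n0" for n
  proof -
    have "(1 - 2 * \<kappa> n) * (1 + \<kappa> n) \<le> 1 - \<kappa> n" using \<kappa>0[of n] by (simp add: algebra_simps)
    then have "E n * ((1 - 2 * \<kappa> n) * (1 + \<kappa> n)) \<le> E n * (1 - \<kappa> n)" using E0 by (intro mult_left_mono) auto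
    also have "\<dots> \<le> E (Suc n) * (1 + \<kappa> n)" by (rule step[OF n])
    finally have "(E n * (1 - 2 * \<kappa> n)) * (1 + \<kappa> n) \<le> E (Suc n) * (1 + \<kappa> n)" by (simp add: mult.assoc)
    then show ?thesis using \<kappa>0[of n] by (simp add: mult_le_cancel_right)
  qed
  obtain N1 :: nat where N1: "4 * L \<le> real N1" using real_arch_simple by blast
  \<comment> \<open>From N on the telescoping sum of the relative losses is at most 1/2.\<close>
  define N where "N = Suc (max n0 N1)"
  have N: "N \<ge> n0" "4 * L \<le> real N" "real N > 0" using N1 by (auto simp: N_def)
  have L0: "L \<ge> 0" by (simp add: L_def)
  have low: "E N * (1 - 2 * L * (1 / real N - 1 / real n)) \<le> E n" if "n \<ge> N" for n
    using that
  proof (induction n rule: dec_induct)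
    case base then show ?case by simp
  next
    case (step n)
    define A where "A = 2 * L * (1 / real N - 1 / real n)"
    have n: "real n > 0" "n \<ge> n0" "N \<le> n" using step N by auto
    have "1 / real n \<le> 1 / real N" using n N by (intro divide_left_mono) auto
    then have A0: "A \<ge> 0" using L0 by (simp add: A_def)
    have q: "1 / (real n + 1)^2 \<le> 1 / real n - 1 / (real n + 1)"
    proof -
      have "1 / real n - 1 / (real n + 1) = 1 / (real n * (real n + 1))" using n by (simp add: field_simps)
      moreover have "1 / (real n + 1)^2 \<le> 1 / (real n * (real n + 1))"
        using n by (intro divide_left_mono) (auto simp: power2_eq_square intro!: mult_right_mono)
      ultimately show ?thesis by simp
    qed
    have k: "2 * \<kappa> n \<le> 2 * L * (1 / real n - 1 / (real n + 1))"
      using mult_left_mono[OF q, of "2 * L"] L0 by (simp add: \<kappa>_def)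
    have k1: "2 * \<kappa> n \<le> 1"
    proof -
      have "1 / (real n + 1)^2 \<le> 1 / real N"
      proof (intro divide_left_mono)
        have "real N * 1 \<le> (real n + 1) * (real n + 1)" using n N by (intro mult_mono) auto
        then show "real N \<le> (real n + 1)^2" by (simp add: power2_eq_square)
      qed (use N n in auto)
      then have "2 * L * (1 / (real n + 1)^2) \<le> 2 * L * (1 / real N)" using L0 by (intro mult_left_mono) auto
      also have "\<dots> \<le> 1" using N by (simp add: field_simps)
      finally show ?thesis by (simp add: \<kappa>_def)
    qed
    have "E N * (1 - 2 * L * (1 / real N - 1 / real (Suc n))) \<le> E N * (1 - A - 2 * \<kappa> n)"
    proof (intro mult_left_mono E0)
      have "2 * L * (1 / real N - 1 / real (Suc n)) = A + 2 * L * (1 / real n - 1 / (real n + 1))"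
        by (simp add: A_def algebra_simps)
      then show "1 - 2 * L * (1 / real N - 1 / real (Suc n)) \<le> 1 - A - 2 * \<kappa> n" using k by linarith
    qed
    also have "\<dots> \<le> E N * ((1 - A) * (1 - 2 * \<kappa> n))"
    proof (intro mult_left_mono E0)
      have "A * (2 * \<kappa> n) \<ge> 0" using A0 \<kappa>0[of n] by simp
      then show "1 - A - 2 * \<kappa> n \<le> (1 - A) * (1 - 2 * \<kappa> n)" by (simp add: algebra_simps)
    qed
    also have "\<dots> = (E N * (1 - A)) * (1 - 2 * \<kappa> n)" by simp
    also have "\<dots> \<le> E n * (1 - 2 * \<kappa> n)" using step.IH k1 by (intro mult_right_mono) (auto simp: A_def)
    also have "\<dots> \<le> E (Suc n)" by (rule step2[OF n(2)])
    finally show ?case .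
  qed
  have half: "E N / 2 \<le> E n" if "n \<ge> N" for n
  proof -
    have "2 * L * (1 / real N - 1 / real n) \<le> 2 * L * (1 / real N)" using L0 by (intro mult_left_mono) auto
    also have "\<dots> \<le> 1 / 2" using N by (simp add: field_simps)
    finally have "E N * (1 / 2) \<le> E N * (1 - 2 * L * (1 / real N - 1 / real n))" using E0 by (intro mult_left_mono) auto
    then have "E N * (1 / 2) \<le> E n" using low[OF that] by (rule order_trans)
    then show ?thesis by simp
  qed
  have "E \<longlonglongrightarrow> 0^2 - 2 * c * 0 * 0 + 0^2"
    unfolding E_def using LIMSEQ_Suc[OF lim] by (intro tendsto_intros lim)
  then have "E \<longlonglongrightarrow> 0" by simp
  then have "E N / 2 \<le> 0" by (rule LIMSEQ_le_const) (use half in blast)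
  then have "\<delta> * ((u N)^2 + (u (Suc N))^2) \<le> 0" using E_lower[of N] by simp
  then have "(u N)^2 + (u (Suc N))^2 \<le> 0" using \<delta> by (simp add: mult_le_0_iff)
  then have "u N = 0 \<and> u (Suc N) = 0" by (simp add: sum_power2_le_zero_iff)
  then show ?thesis by blast
qed

text \<open>
A discrete maximum principle: for weights in (0,1) a solution with c = 1 has no negative interior
minimum.
\<close>

lemma no_sign_change:
  fixes w r :: "nat \<Rightarrow> real"
  assumes e: "\<And>n. 2 * w (Suc n) = r (Suc n) * (w n + w (Suc (Suc n)))"
    and r: "\<And>n. 0 < r (Suc n) \<and> r (Suc n) < 1" and lim: "w \<longlonglongrightarrow> 0" and 0: "w 0 \<ge> 0"
  shows "w n \<ge> 0"
proof (rule ccontr)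
  assume "\<not> w n \<ge> 0"
  then have neg: "w n < 0" by simp
  then have "\<forall>\<^sub>F k in sequentially. w k > w n" using order_tendstoD(1)[OF lim] by blast
  then obtain N where N: "\<And>k. k \<ge> N \<Longrightarrow> w k > w n" by (auto simp: eventually_sequentially)
  define A where "A = w ` {..max N n}"
  have A: "finite A" "A \<noteq> {}" by (auto simp: A_def)
  have "Min A \<in> w ` {..max N n}" using Min_in[OF A] unfolding A_def .
  then obtain m where m: "w m = Min A" by (elim imageE) simp
  have wn: "w m \<le> w n" unfolding m by (rule Min_le[OF A(1)]) (simp add: A_def)
  have min: "w m \<le> w k" for k
  proof (cases "k \<le> max N n")
    case True then show ?thesis unfolding m by (intro Min_le[OF A(1)]) (auto simp: A_def)
  next
    case False
    then have "N \<le> k" by simp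
    then have "w n < w k" by (rule N)
    then show ?thesis using wn by linarith
  qed
  have "m \<noteq> 0"
  proof
    assume "m = 0"
    then show False using wn neg 0 by simp
  qed
  then obtain j where j: "m = Suc j" using not0_implies_Suc by blast
  have "2 * w m \<le> w j + w (Suc (Suc j))" using min[of j] min[of "Suc (Suc j)"] by simp
  then have "r m * (2 * w m) \<le> r m * (w j + w (Suc (Suc j)))" using r[of j] j by (intro mult_left_mono) auto
  also have "\<dots> = 2 * w m" using e[of j] j by simp
  finally have "2 * w m * (1 - r m) \<ge> 0" by (simp add: algebra_simps)
  moreover have "w m < 0" "1 - r m > 0" using wn neg r[of j] j by auto
  ultimately show False by (simp add: zero_le_mult_iff)
qed

text \<open>
For d = 0 the recurrence with c = 1 has the decaying solution z_n = 1/(x+n). The Casoratian with it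
decreases strictly for d \<noteq> 0 and tends to 0, hence is positive, and this compares the ratio
w_1/w_0 with z_1/z_0 = x/(x+1).
\<close>

lemma ratio_lower_bound:
  fixes w :: "nat \<Rightarrow> real" and x d :: real
  defines "r \<equiv> \<lambda>n. 1 - 1 / ((x + real n)^2 + d^2)"
  assumes x: "0 < x" and d: "d \<noteq> 0"
    and e: "\<And>n. 2 * w (Suc n) = r (Suc n) * (w n + w (Suc (Suc n)))"
    and lim: "w \<longlonglongrightarrow> 0" and 0: "w 0 > 0"
  shows "w 1 > x / (x + 1) * w 0"
proof -
  have xn: "(x + real (Suc n))^2 > 1" for n using x by (simp add: power2_eq_square algebra_simps add_pos_nonneg)
  have d2: "d^2 > 0" using d by simp
  have r: "0 < r (Suc n)" "r (Suc n) < 1" for n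
  proof -
    have "(x + real (Suc n))^2 + d^2 > 1" using xn[of n] d2 by linarith
    then show "0 < r (Suc n)" "r (Suc n) < 1" by (auto simp: r_def)
  qed
  have nn: "w n \<ge> 0" for n
    by (rule no_sign_change[OF e _ lim]) (use r 0 in auto)
  have pos: "w n > 0" for n
  proof (induction n)
    case (Suc n)
    show ?case
    proof (rule ccontr)
      assume "\<not> w (Suc n) > 0"
      then have "w (Suc n) = 0" using nn[of "Suc n"] by simp
      then have "w n + w (Suc (Suc n)) = 0" using e[of n] r[of n] by simp
      then show False using Suc nn[of "Suc (Suc n)"] by simp
    qed
  qed (rule 0)
  define z where "z n = 1 / (x + real n)" for n
  define W where "W n = w (Suc n) * z n - w n * z (Suc n)" for n
  have zp: "z n > 0" for n using x by (simp add: z_def)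
  have z_rec: "z n + z (Suc (Suc n)) = 2 * z (Suc n) * ((x + real (Suc n))^2 / ((x + real (Suc n))^2 - 1))" for n
  proof -
    define y where "y = x + real (Suc n)"
    have y: "y > 1" using x by (simp add: y_def)
    have "z n = 1 / (y - 1)" "z (Suc n) = 1 / y" "z (Suc (Suc n)) = 1 / (y + 1)"
      by (simp_all add: z_def y_def algebra_simps)
    moreover have "1 / (y - 1) + 1 / (y + 1) = 2 * (1 / y) * (y^2 / (y^2 - 1))"
    proof -
      have "y^2 - 1 = (y - 1) * (y + 1)" by (simp add: power2_eq_square algebra_simps)
      moreover have "1 / (y - 1) + 1 / (y + 1) = 2 * y / ((y - 1) * (y + 1))" using y by (simp add: field_simps)
      moreover have "2 * (1 / y) * (y^2 / X) = 2 * y / X" for X using y by (simp add: power2_eq_square)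
      ultimately show ?thesis by simp
    qed
    ultimately show ?thesis unfolding y_def[symmetric] by simp
  qed
  have W_dec: "W (Suc n) < W n" for n
  proof -
    define Q where "Q = (x + real (Suc n))^2"
    have Q: "Q > 1" using xn by (simp add: Q_def)
    have inv: "1 / r (Suc n) < Q / (Q - 1)"
    proof -
      have nz: "Q + d^2 \<noteq> 0" using Q d2 by linarith
      have "r (Suc n) = 1 - 1 / (Q + d^2)" by (simp only: r_def Q_def)
      also have "\<dots> = (Q + d^2 - 1) / (Q + d^2)" using nz by (simp add: diff_divide_distrib)
      finally have "r (Suc n) = (Q + d^2 - 1) / (Q + d^2)" .
      then have "1 / r (Suc n) = (Q + d^2) / (Q + d^2 - 1)" by simp
      also have "\<dots> < Q / (Q - 1)"
      proof -
        have g: "X / (X - 1) = 1 + 1 / (X - 1)" if "X > 1" for X :: real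
          using that by (simp add: field_simps)
        have "1 / (Q + d^2 - 1) < 1 / (Q - 1)"
        proof (rule divide_strict_left_mono)
          show "Q - 1 < Q + d^2 - 1" using d2 by linarith
          have "0 < Q + d^2 - 1" using Q d2 by linarith
          then show "0 < (Q + d^2 - 1) * (Q - 1)" using Q by (intro mult_pos_pos) auto
        qed simp
        moreover have "Q + d^2 > 1" using Q d2 by linarith
        ultimately show ?thesis using g[of Q] g[of "Q + d^2"] Q by linarith
      qed
      finally show ?thesis .
    qed
    have w_rec: "w n + w (Suc (Suc n)) = 2 * w (Suc n) * (1 / r (Suc n))"
      using e[of n] r[of n] by (simp add: field_simps)
    have "W (Suc n) - W n = z (Suc n) * (w n + w (Suc (Suc n))) - w (Suc n) * (z n + z (Suc (Suc n)))"
      by (simp add: W_def algebra_simps)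
    also have "\<dots> = 2 * w (Suc n) * z (Suc n) * (1 / r (Suc n) - Q / (Q - 1))"
      unfolding w_rec z_rec Q_def by (simp add: algebra_simps)
    also have "\<dots> < 0" using inv pos[of "Suc n"] zp[of "Suc n"] by (intro mult_pos_neg mult_pos_pos) auto
    finally show ?thesis by simp
  qed
  have zl: "z \<longlonglongrightarrow> 0" unfolding z_def by real_asymp
  have "W \<longlonglongrightarrow> 0 * 0 - 0 * 0"
    unfolding W_def using LIMSEQ_Suc[OF lim] LIMSEQ_Suc[OF zl] by (intro tendsto_intros lim zl)
  then have Wl: "W \<longlonglongrightarrow> 0" by simp
  have "W n \<le> W 1" if "n \<ge> 1" for n
    using that by (induction n rule: dec_induct) (use W_dec less_imp_le order_trans in blast)+
  then have "0 \<le> W 1" by (intro LIMSEQ_le_const2[OF Wl]) blast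
  then have "W 0 > 0" using W_dec[of 0] by simp
  then have "w 0 / (x + 1) < w 1 / x" by (simp add: W_def z_def)
  then show ?thesis using x by (simp add: field_simps)
qed

text \<open>
Comparing both half-lines with the solutions for d = 0 gives two inequalities for p = u_0 and q =
-u_{-1}, namely q > \<theta>/(1-\<theta>) p and p > (1-\<theta>)/\<theta> q. They contradict each
other.
\<close>

lemma no_solution_at_edge_pos:
  fixes u :: "int \<Rightarrow> real"
  assumes \<theta>: "0 < \<theta>" "\<theta> < 1" and d: "d \<noteq> 0" and reg: "\<theta>^2 + d^2 < 1" "(1 - \<theta>)^2 + d^2 < 1"
    and e: "\<And>n. 2 * u n = weight \<theta> d n * (u (n - 1) + u (n + 1))"
    and lim: "(\<lambda>k. u (int k)) \<longlonglongrightarrow> 0" "(\<lambda>k. u (- int k)) \<longlonglongrightarrow> 0" and 0: "u 0 > 0"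
  shows False
proof -
  have jost_right: "u 1 > \<theta> / (\<theta> + 1) * u 0"
    using ratio_lower_bound[of \<theta> d "\<lambda>n. u (int n)", OF \<theta>(1) d _ lim(1)] e[of "int (Suc n)" for n] 0
    by (simp add: weight_def add_ac)
  define \<rho>0 \<rho>1 where "\<rho>0 = weight \<theta> d 0" and "\<rho>1 = weight \<theta> d (-1)"
  have inv: "2 / (- (1 - 1 / b)) > 2 * t^2 / (1 - t^2)" if "b = t^2 + d^2" "b < 1" "0 < t" "t < 1" for b t :: real
  proof -
    have t2: "t^2 > 0" "t^2 < b" using that d by auto
    have b: "b > 0" using t2 by linarith
    have "2 / (- (1 - 1 / b)) = 2 * b / (1 - b)" using b that(2) by (simp add: field_simps)
    moreover have "2 * t^2 / (1 - t^2) < 2 * b / (1 - b)"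
      using t2 that(2) by (intro frac_less) auto
    ultimately show ?thesis by simp
  qed
  have r0: "2 / (- \<rho>0) > 2 * \<theta>^2 / (1 - \<theta>^2)" "\<rho>0 < 0"
    using inv[of "\<theta>^2 + d^2" \<theta>] reg \<theta> weight_sign(1)[OF d, of \<theta> 0] by (auto simp: \<rho>0_def weight_def)
  have m1: "(\<theta> + of_int (-1))^2 = (1 - \<theta>)^2" by (simp add: power2_eq_square algebra_simps)
  have r1: "2 / (- \<rho>1) > 2 * (1 - \<theta>)^2 / (1 - (1 - \<theta>)^2)" "\<rho>1 < 0"
    using inv[of "(1 - \<theta>)^2 + d^2" "1 - \<theta>"] reg \<theta> weight_sign(1)[OF d, of \<theta> "-1"] m1 by (auto simp: \<rho>1_def weight_def)
  define p q where "p = u 0" and "q = - u (-1)"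
  have e0: "q = 2 / (- \<rho>0) * p + u 1"
    using e[of 0] r0(2) by (simp add: p_def q_def \<rho>0_def[symmetric] field_simps)
  \<comment> \<open>The equation at the index 0 or -1 for the comparison solution with d = 0.\<close>
  have alg: "2 * t^2 / (1 - t^2) + t / (t + 1) = t / (1 - t)" if "0 < t" "t < 1" for t :: real
  proof -
    have n: "1 - t \<noteq> 0" "t + 1 \<noteq> 0" "1 - t^2 = (1 - t) * (t + 1)" using that by (auto simp: power2_eq_square algebra_simps)
    show ?thesis unfolding n(3) using n(1,2) by (simp add: divide_simps) (simp add: power2_eq_square algebra_simps)
  qed
  have p0: "p > 0" using 0 by (simp add: p_def)
  have q1: "q > \<theta> / (1 - \<theta>) * p"
  proof -
    have "\<theta> / (1 - \<theta>) * p = 2 * \<theta>^2 / (1 - \<theta>^2) * p + \<theta> / (\<theta> + 1) * p"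
      unfolding alg[OF \<theta>, symmetric] by (simp add: distrib_right)
    also have "\<dots> < 2 / (- \<rho>0) * p + u 1"
      using r0(1) p0 jost_right by (intro add_strict_mono mult_strict_right_mono) (auto simp: p_def)
    finally show ?thesis by (simp add: e0)
  qed
  have q0: "q > 0" using q1 p0 \<theta> by (smt (verit) divide_pos_pos mult_pos_pos)
  define w where "w n = - u (- 1 - int n)" for n
  have jost_left: "w 1 > (1 - \<theta>) / ((1 - \<theta>) + 1) * w 0"
  proof (rule ratio_lower_bound[OF _ d])
    show "0 < 1 - \<theta>" using \<theta> by simp
    show "2 * w (Suc n) = (1 - 1 / ((1 - \<theta> + real (Suc n))^2 + d^2)) * (w n + w (Suc (Suc n)))" for n
    proof -
      have "(\<theta> + of_int (- 1 - int (Suc n)))^2 = (1 - \<theta> + real (Suc n))^2"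
        by (simp add: power2_eq_square algebra_simps)
      then have "weight \<theta> d (- 1 - int (Suc n)) = 1 - 1 / ((1 - \<theta> + real (Suc n))^2 + d^2)"
        unfolding weight_def by (simp only:)
      moreover have "- 1 - int (Suc n) - 1 = - 1 - int (Suc (Suc n))" "- 1 - int (Suc n) + 1 = - 1 - int n" by simp_all
      ultimately have eqn: "2 * u (- 1 - int (Suc n)) = (1 - 1 / ((1 - \<theta> + real (Suc n))^2 + d^2)) * (u (- 1 - int (Suc (Suc n))) + u (- 1 - int n))"
        using e[of "- 1 - int (Suc n)"] by (simp only:)
      have gen: "2 * (- a) = R * (- b + - c)" if "2 * a = R * (c + b)" for a b c R :: real
        using that by (simp add: algebra_simps)
      show ?thesis unfolding w_def by (rule gen[OF eqn])
    qed
    have "(\<lambda>n. - u (- int (Suc n))) \<longlonglongrightarrow> - 0" using LIMSEQ_Suc[OF lim(2)] by (rule tendsto_minus)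
    then show "w \<longlonglongrightarrow> 0" by (simp add: w_def[abs_def])
    show "w 0 > 0" using q0 by (simp add: w_def q_def)
  qed
  have e1: "p = 2 / (- \<rho>1) * q + w 1"
    using e[of "-1"] r1(2) by (simp add: p_def q_def \<rho>1_def[symmetric] w_def field_simps)
  have "p > (1 - \<theta>) / \<theta> * q"
  proof -
    have "(1 - \<theta>) / (1 - (1 - \<theta>)) * q = 2 * (1 - \<theta>)^2 / (1 - (1 - \<theta>)^2) * q + (1 - \<theta>) / ((1 - \<theta>) + 1) * q"
      by (subst alg[symmetric]) (use \<theta> in \<open>auto simp: distrib_right\<close>)
    also have "\<dots> < 2 / (- \<rho>1) * q + w 1"
      using r1(1) q0 jost_left by (intro add_strict_mono mult_strict_right_mono) (auto simp: q_def w_def)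
    finally show ?thesis by (simp add: e1)
  qed
  then have "\<theta> / (1 - \<theta>) * ((1 - \<theta>) / \<theta> * q) < \<theta> / (1 - \<theta>) * p" using \<theta> by (intro mult_strict_left_mono) auto
  then have "q < \<theta> / (1 - \<theta>) * p" using \<theta> by simp
  then show False using q1 by simp
qed

lemma weight_nonzero_II:
  assumes \<theta>: "0 \<le> \<theta>" "\<theta> \<le> 1 / 2" and d: "d \<noteq> 0" and reg: "\<theta>^2 + d^2 < 1" "(1 - \<theta>)^2 + d^2 < 1"
  shows "weight \<theta> d n \<noteq> 0"
proof -
  have m1: "(\<theta> + of_int (-1))^2 = (1 - \<theta>)^2" by (simp add: power2_eq_square algebra_simps)
  show ?thesis
    using far_circle[OF \<theta> d, of n] m1 reg by (cases "n = 0"; cases "n = -1") (auto simp: weight_sign(2)[OF d])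
qed

text \<open>
For c = -1 the alternating sequence (-1)^n u_n solves the equation with c = 1.
\<close>

lemma no_real_decaying_solution:
  fixes u :: "int \<Rightarrow> real"
  assumes \<theta>: "0 \<le> \<theta>" "\<theta> \<le> 1 / 2" and d: "d \<noteq> 0" and reg: "\<theta>^2 + d^2 < 1" "(1 - \<theta>)^2 + d^2 < 1"
    and c: "\<bar>c\<bar> \<le> 1"
    and e: "\<And>n. 2 * c * u n = weight \<theta> d n * (u (n - 1) + u (n + 1))"
    and lim: "(\<lambda>k. u (int k)) \<longlonglongrightarrow> 0" "(\<lambda>k. u (- int k)) \<longlonglongrightarrow> 0"
  shows "u n = 0"
proof -
  have r0: "weight \<theta> d n \<noteq> 0" for n by (rule weight_nonzero_II[OF \<theta> d reg])
  have uniq: "u n = 0" if "u m = 0" "u (m + 1) = 0" for m n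
    by (rule recurrence_unique[of c u "weight \<theta> d" m]) (use e r0 that in auto)
  have edge: "v 0 = 0" if v: "\<And>n. 2 * v n = weight \<theta> d n * (v (n - 1) + v (n + 1))" "(\<lambda>k. v (int k)) \<longlonglongrightarrow> 0" "(\<lambda>k. v (- int k)) \<longlonglongrightarrow> 0" for v :: "int \<Rightarrow> real"
  proof -
    have t0: "0 < \<theta>"
    proof (rule ccontr)
      assume "\<not> 0 < \<theta>"
      then have "\<theta> = 0" using \<theta> by simp
      then show False using reg(2) d by simp
    qed
    have a: "\<not> v 0 > 0"
      using no_solution_at_edge_pos[OF t0 _ d reg v] \<theta> by auto
    have "\<not> (- v 0) > 0"
    proof
      assume "- v 0 > 0"
      moreover have "2 * (- v n) = weight \<theta> d n * (- v (n - 1) + - v (n + 1))" for n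
        using v(1)[of n] by (simp add: algebra_simps)
      moreover have "(\<lambda>k. - v (int k)) \<longlonglongrightarrow> 0" "(\<lambda>k. - v (- int k)) \<longlonglongrightarrow> 0"
        using tendsto_minus[OF v(2)] tendsto_minus[OF v(3)] by simp_all
      ultimately show False
        using no_solution_at_edge_pos[OF t0 _ d reg, of "\<lambda>n. - v n"] \<theta> by auto
    qed
    then show ?thesis using a by simp
  qed
  consider "\<bar>c\<bar> < 1" | "c = 1" | "c = -1" using c by linarith
  then show ?thesis
  proof cases
    case 1
    define \<eta> where "\<eta> k = 1 / weight \<theta> d (int k) - 1" for k :: nat
    have "\<exists>N. u (int N) = 0 \<and> u (int (Suc N)) = 0"
    proof (rule energy_decay[OF 1, of 1 "\<lambda>n. u (int n)" \<eta> 2])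
      fix n :: nat assume n: "n \<ge> 1"
      have "2 * c * u (int (Suc n)) = weight \<theta> d (int (Suc n)) * (u (int n) + u (int (Suc (Suc n))))"
        using e[of "int (Suc n)"] by (simp add: add_ac)
      then show "u (int (Suc (Suc n))) + u (int n) = 2 * c * (1 + \<eta> (Suc n)) * u (int (Suc n))"
        using r0[of "int (Suc n)"] by (simp add: \<eta>_def field_simps)
      define B where "B = (\<theta> + of_int (int (Suc n)))^2 + d^2"
      have "(real n + 1)^2 \<le> (\<theta> + of_int (int (Suc n)))^2" using \<theta> by (intro power_mono) auto
      then have B: "(real n + 1)^2 \<le> B" by (simp add: B_def add_increasing2)
      have "2 * 2 \<le> (real n + 1) * (real n + 1)" using n by (intro mult_mono) auto
      then have n4: "4 \<le> (real n + 1)^2" by (simp add: power2_eq_square)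
      then have B4: "B \<ge> 4" using B by linarith
      have h: "\<eta> (Suc n) = 1 / (B - 1)"
      proof -
        have "weight \<theta> d (int (Suc n)) = 1 - 1 / B" by (simp only: weight_def B_def)
        moreover have "1 / (1 - 1 / B) - 1 = 1 / (B - 1)" using B4 by (simp add: field_simps)
        ultimately show ?thesis by (simp only: \<eta>_def)
      qed
      have "1 / (B - 1) \<le> 1 / ((real n + 1)^2 / 2)" using B n4 by (intro divide_left_mono mult_pos_pos) auto
      then show "0 \<le> \<eta> (Suc n) \<and> \<eta> (Suc n) \<le> 2 / (real n + 1)^2" using B4 unfolding h by simp
    qed (rule lim(1))
    then obtain N where "u (int N) = 0" "u (int N + 1) = 0" by (auto simp: add.commute)
    then show ?thesis by (rule uniq)
  next
    case 2
    have e1: "2 * u n = weight \<theta> d n * (u (n - 1) + u (n + 1))" for n using e[of n] 2 by simp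
    have "u 0 = 0" by (rule edge[OF e1 lim])
    have u1: "u 1 = 0"
    proof -
      have "u (int k) = 0" for k
      proof -
        have r: "0 < weight \<theta> d (int (Suc n)) \<and> weight \<theta> d (int (Suc n)) < 1" for n
        proof -
          have "(\<theta> + of_int (int (Suc n)))^2 + d^2 > 1" by (rule far_circle[OF \<theta> d]) auto
          then show ?thesis by (simp add: weight_def)
        qed
        have a: "2 * u (int (Suc n)) = weight \<theta> d (int (Suc n)) * (u (int n) + u (int (Suc (Suc n))))" for n
          using e1[of "int (Suc n)"] by (simp add: add_ac)
        have "u (int k) \<ge> 0"
          by (rule no_sign_change[of "\<lambda>k. u (int k)" "\<lambda>k. weight \<theta> d (int k)", OF a r lim(1)]) (simp add: \<open>u 0 = 0\<close>)
        moreover have "- u (int k) \<ge> 0"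
          by (rule no_sign_change[of "\<lambda>k. - u (int k)" "\<lambda>k. weight \<theta> d (int k)", OF _ r])
             (use a tendsto_minus[OF lim(1)] \<open>u 0 = 0\<close> in \<open>auto simp: algebra_simps\<close>)
        ultimately show ?thesis by simp
      qed
      from this[of 1] show ?thesis by simp
    qed
    show ?thesis by (rule uniq[of 0]) (use \<open>u 0 = 0\<close> u1 in auto)
  next
    case 3
    define v where "v n = (if even n then u n else - u n)" for n
    have e1: "2 * v n = weight \<theta> d n * (v (n - 1) + v (n + 1))" for n
      using e[of n] 3 by (cases "even n") (auto simp: v_def algebra_simps)
    have vl: "(\<lambda>k. v (int k)) \<longlonglongrightarrow> 0" "(\<lambda>k. v (- int k)) \<longlonglongrightarrow> 0"
      by (rule Lim_null_comparison[OF always_eventually tendsto_rabs_zero[OF lim(1)]], simp add: v_def,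
          rule Lim_null_comparison[OF always_eventually tendsto_rabs_zero[OF lim(2)]], simp add: v_def)
    have v0: "v 0 = 0" by (rule edge[OF e1 vl])
    have v1: "v (int k) = 0" for k
    proof -
      have r: "0 < weight \<theta> d (int (Suc n)) \<and> weight \<theta> d (int (Suc n)) < 1" for n
      proof -
        have "(\<theta> + of_int (int (Suc n)))^2 + d^2 > 1" by (rule far_circle[OF \<theta> d]) auto
        then show ?thesis by (simp add: weight_def)
      qed
      have a: "2 * v (int (Suc n)) = weight \<theta> d (int (Suc n)) * (v (int n) + v (int (Suc (Suc n))))" for n
        using e1[of "int (Suc n)"] by (simp add: add_ac)
      have "v (int k) \<ge> 0"
        by (rule no_sign_change[of "\<lambda>k. v (int k)" "\<lambda>k. weight \<theta> d (int k)", OF a r vl(1)]) (simp add: v0)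
      moreover have "- v (int k) \<ge> 0"
        by (rule no_sign_change[of "\<lambda>k. - v (int k)" "\<lambda>k. weight \<theta> d (int k)", OF _ r])
           (use a tendsto_minus[OF vl(1)] v0 in \<open>auto simp: algebra_simps\<close>)
      ultimately show ?thesis by simp
    qed
    show ?thesis by (rule uniq[of 0]) (use v0 v1[of 1] in \<open>auto simp: v_def\<close>)
  qed
qed

section \<open>Existence of zeros in region II\<close>

lemma scaled_eigvec:
  assumes "eigvec \<rho> c y" "a \<noteq> 0"
  shows "eigvec \<rho> c (\<lambda>n. a * y n)"
proof -
  have 1: "\<And>n. 2 * c * y n = of_real (\<rho> n) * (y (n - 1) + y (n + 1))" and 2: "(\<lambda>k. y (int k)) \<longlonglongrightarrow> 0" "(\<lambda>k. y (- int k)) \<longlonglongrightarrow> 0"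
    and 3: "\<exists>n. y n \<noteq> 0"
    using assms(1) by (auto simp: eigvec_def)
  have "2 * c * (a * y n) = of_real (\<rho> n) * (a * y (n - 1) + a * y (n + 1))" for n
    using arg_cong[OF 1[of n], of "\<lambda>x. a * x"] by (simp add: algebra_simps)
  moreover have "(\<lambda>k. a * y (int k)) \<longlonglongrightarrow> 0" "(\<lambda>k. a * y (- int k)) \<longlonglongrightarrow> 0"
    using tendsto_mult_left[OF 2(1), of a] tendsto_mult_left[OF 2(2), of a] by simp_all
  ultimately show ?thesis using 3 assms(2) by (auto simp: eigvec_def)
qed

text \<open>
Neutrality bounds the positive part of the form by the two negative squares; together with 0 <
\<rho>_n \<le> 1 this controls the sequence by its values at the two indices 0 and -1.
\<close>

lemma eigvec_mass_bound:
  assumes y: "eigvec \<rho> c y" and c: "Im c \<noteq> 0" and r0: "\<And>n. \<rho> n \<noteq> 0"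
    and neg: "\<rho> 0 < 0" "\<rho> (-1) < 0" and pos: "\<And>n. n \<noteq> 0 \<Longrightarrow> n \<noteq> -1 \<Longrightarrow> 0 < \<rho> n \<and> \<rho> n \<le> 1"
    and F: "finite F" "0 \<notin> F" "-1 \<notin> F"
  shows "(\<Sum>n\<in>F. (norm (y n))^2) \<le> (norm (y 0))^2 / (- \<rho> 0) + (norm (y (-1)))^2 / (- \<rho> (-1))"
proof -
  define f where "f n = (norm (y n))^2 / \<rho> n" for n
  have cc: "c \<noteq> cnj c" using c by (auto simp: complex_eq_iff)
  have "(\<lambda>N. complex_of_real (\<Sum>n=- int N..int N. f n)) \<longlonglongrightarrow> of_real 0"
    using eigvec_neutral[OF y y r0 cc] by (simp add: f_def complex_norm_square[symmetric])
  then have lim: "(\<lambda>N. \<Sum>n=- int N..int N. f n) \<longlonglongrightarrow> 0" by (simp only: tendsto_of_real_iff)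
  obtain N0 where N0: "F \<subseteq> {- int N0..int N0}"
  proof -
    have "\<forall>n\<in>F. \<bar>n\<bar> \<le> Max (insert 0 (abs ` F))" using F(1) by auto
    then have "F \<subseteq> {- int (nat (Max (insert 0 (abs ` F))))..int (nat (Max (insert 0 (abs ` F))))}"
      by (auto simp: abs_le_iff)
    then show thesis by (rule that)
  qed
  have "(\<Sum>n\<in>F. (norm (y n))^2) + (f 0 + f (-1)) \<le> (\<Sum>n=- int N..int N. f n)" if N: "N \<ge> Suc N0" for N
  proof -
    have sub: "F \<union> {0, -1} \<subseteq> {- int N..int N}" using N0 N by auto
    have "(\<Sum>n\<in>F. (norm (y n))^2) \<le> (\<Sum>n\<in>F. f n)"
    proof (rule sum_mono)
      fix n assume "n \<in> F"
      then have "0 < \<rho> n" "\<rho> n \<le> 1" using pos[of n] F by auto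
      then show "(norm (y n))^2 \<le> f n" by (simp add: f_def pos_le_divide_eq mult_left_le)
    qed
    moreover have "(\<Sum>n\<in>F. f n) + (f 0 + f (-1)) = (\<Sum>n\<in>F \<union> {0, -1}. f n)"
      using F by (subst sum.union_disjoint) auto
    moreover have "(\<Sum>n\<in>F \<union> {0, -1}. f n) \<le> (\<Sum>n=- int N..int N. f n)"
    proof (rule sum_mono2[OF _ sub])
      fix n assume "n \<in> {- int N..int N} - (F \<union> {0, -1})"
      then have "0 < \<rho> n" using pos[of n] by auto
      then show "0 \<le> f n" by (simp add: f_def)
    qed simp
    ultimately show ?thesis by linarith
  qed
  then have "(\<Sum>n\<in>F. (norm (y n))^2) + (f 0 + f (-1)) \<le> 0"
    by (intro LIMSEQ_le_const[OF lim]) blast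
  then show ?thesis by (simp add: f_def)
qed

lemma weight_far:
  fixes \<theta> d :: real and n :: int
  assumes "0 \<le> \<theta>" "\<theta> \<le> 1 / 2" "d \<noteq> 0" "n \<noteq> 0" "n \<noteq> -1"
  shows "0 < weight \<theta> d n \<and> weight \<theta> d n \<le> 1"
proof -
  have "(\<theta> + of_int n)^2 + d^2 > 1" by (rule far_circle[OF assms])
  then have "\<not> weight \<theta> d n < 0" "weight \<theta> d n \<noteq> 0" by (auto simp: weight_sign[OF assms(3)])
  then show ?thesis using weight_sign(3)[OF assms(3), of \<theta> n] by linarith
qed

lemma weight_neg_II:
  assumes d: "d \<noteq> 0" and reg: "\<theta>^2 + d^2 < 1" "(1 - \<theta>)^2 + d^2 < 1"
  shows "weight \<theta> d 0 < 0" "weight \<theta> d (-1) < 0"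
proof -
  have m1: "(\<theta> + of_int (-1))^2 = (1 - \<theta>)^2" by (simp add: power2_eq_square algebra_simps)
  show "weight \<theta> d 0 < 0" "weight \<theta> d (-1) < 0" using reg m1 by (simp_all only: weight_sign[OF d]) simp_all
qed

text \<open>
Normalising at the indices 0 and -1 keeps limits nontrivial: two consecutive values determine a
solution of the recurrence.
\<close>

lemma disc_zero_eigvec_II:
  assumes \<theta>: "0 \<le> \<theta>" "\<theta> \<le> 1 / 2" and d: "d \<noteq> 0" and reg: "\<theta>^2 + d^2 < 1" "(1 - \<theta>)^2 + d^2 < 1"
    and z: "z \<in> disc_zeros \<theta> d"
  obtains s y where "s^2 = z" "s \<noteq> 0" "norm s < 1" "eigvec (weight \<theta> d) ((s + 1 / s) / 2) y"
    "(norm (y 0))^2 + (norm (y (-1)))^2 = 1"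
    "\<And>F. finite F \<Longrightarrow> 0 \<notin> F \<Longrightarrow> -1 \<notin> F \<Longrightarrow> (\<Sum>n\<in>F. (norm (y n))^2) \<le> 1 / (- weight \<theta> d 0) + 1 / (- weight \<theta> d (-1))"
proof -
  note neg = weight_neg_II[OF d reg]
  have r0: "weight \<theta> d n \<noteq> 0" for n by (rule weight_nonzero_II[OF \<theta> d reg])
  obtain s where s: "s^2 = z" "Im s < 0" "s \<noteq> 0" using lower_root[OF disc_zeros_not_nonneg[OF d z]] by blast
  have zn: "norm z < 1" using z by (simp add: disc_zeros_def)
  have sn: "norm s < 1"
  proof -
    have "norm s ^ 2 < 1" using zn unfolding s(1)[symmetric] by (simp add: norm_power)
    then show ?thesis by (simp add: power_less_one_iff)
  qed
  define c where "c = (s + 1 / s) / 2"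
  have Ic: "Im c > 0" unfolding c_def by (rule Im_joukowski_pos[OF s(3) sn s(2)])
  have "\<exists>y. eigvec (weight \<theta> d) c y"
  proof (rule eigvec_exists[OF s(3) sn c_def _ r0])
    show "admissible2 (\<lambda>n. of_real (weight \<theta> d n))" by (rule admissible2_weight) (use \<theta> in auto)
    show "\<bar>weight \<theta> d n\<bar> \<le> 1" if "2 \<le> \<bar>n\<bar>" for n
    proof -
      have "n \<noteq> 0" "n \<noteq> -1" using that by auto
      from weight_far[OF \<theta> d this] show ?thesis by simp
    qed
    show "evans (s^2) (\<lambda>n. of_real (weight \<theta> d n)) = 0"
      using disc_zeros_evans_at[OF _ d z] \<theta> unfolding evans_at_def s(1) by simp
  qed
  then obtain y where y: "eigvec (weight \<theta> d) c y" by blast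
  define N where "N = (norm (y 0))^2 + (norm (y (-1)))^2"
  have N: "N > 0"
  proof (rule ccontr)
    assume "\<not> N > 0"
    then have N0: "(norm (y 0))^2 + (norm (y (-1)))^2 \<le> 0" by (simp add: N_def)
    have "(norm (y 0))^2 = 0" using N0 zero_le_power2[of "norm (y 0)"] zero_le_power2[of "norm (y (-1))"] by linarith
    moreover have "(norm (y (-1)))^2 = 0" using N0 zero_le_power2[of "norm (y 0)"] zero_le_power2[of "norm (y (-1))"] by linarith
    ultimately have "y 0 = 0" "y (-1) = 0" by simp_all
    then have "y n = 0" for n
      using recurrence_unique[of c y "weight \<theta> d" "-1" n] y r0 by (simp add: eigvec_def)
    then show False using y by (simp add: eigvec_def)
  qed
  define a where "a = complex_of_real (1 / sqrt N)"
  have a0: "a \<noteq> 0" using N by (simp add: a_def)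
  have an: "(norm (a * x))^2 = (norm x)^2 / N" for x
    using N by (simp add: a_def norm_divide norm_mult power_mult_distrib power_divide)
  define v where "v n = a * y n" for n
  have ve: "eigvec (weight \<theta> d) c v" unfolding v_def by (rule scaled_eigvec[OF y a0])
  have v1: "(norm (v 0))^2 + (norm (v (-1)))^2 = 1"
  proof -
    have "(norm (v 0))^2 + (norm (v (-1)))^2 = N / N" by (simp only: v_def an N_def add_divide_distrib)
    also have "\<dots> = 1" using N by simp
    finally show ?thesis .
  qed
  show thesis
  proof (rule that[OF s(1,3) sn ve[unfolded c_def] v1])
    fix F :: "int set" assume F: "finite F" "0 \<notin> F" "-1 \<notin> F"
    have "(\<Sum>n\<in>F. (norm (v n))^2) \<le> (norm (v 0))^2 / (- weight \<theta> d 0) + (norm (v (-1)))^2 / (- weight \<theta> d (-1))"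
      by (rule eigvec_mass_bound[OF ve _ r0 neg weight_far[OF \<theta> d] F]) (use Ic in auto)
    also have "\<dots> \<le> 1 / (- weight \<theta> d 0) + 1 / (- weight \<theta> d (-1))"
    proof (intro add_mono divide_right_mono)
      show "(norm (v 0))^2 \<le> 1" "(norm (v (-1)))^2 \<le> 1"
        using v1 zero_le_power2[of "norm (v 0)"] zero_le_power2[of "norm (v (-1))"] by linarith+
    qed (use neg in auto)
    finally show "(\<Sum>n\<in>F. (norm (v n))^2) \<le> 1 / (- weight \<theta> d 0) + 1 / (- weight \<theta> d (-1))" .
  qed
qed

lemma bounded_sums_tendsto_0:
  fixes y :: "nat \<Rightarrow> complex"
  assumes "\<And>n. (\<Sum>k<n. (norm (y k))^2) \<le> M"
  shows "y \<longlonglongrightarrow> 0"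
proof -
  have "summable (\<lambda>k. (norm (y k))^2)" by (rule summableI_nonneg_bounded[of _ M]) (use assms in auto)
  then have "(\<lambda>k. (norm (y k))^2) \<longlonglongrightarrow> 0" by (rule summable_LIMSEQ_zero)
  then have "(\<lambda>k. sqrt ((norm (y k))^2)) \<longlonglongrightarrow> sqrt 0" by (intro tendsto_intros)
  then show ?thesis by (simp add: tendsto_norm_zero_iff)
qed

text \<open>
The normalised solutions at the zeros have a convergent subsequence at two indices, hence at all
indices. The limit is square summable by the mass bound, so it decays, and it belongs to a real c in
[-1,1].
\<close>

lemma no_zero_reaches_circle:
  fixes X :: "nat \<Rightarrow> real"
  assumes d: "d \<noteq> 0"
    and X: "\<And>k. 0 \<le> X k" "\<And>k. X k \<le> 1 / 2" "\<And>k. (X k)^2 + d^2 < 1" "\<And>k. (1 - X k)^2 + d^2 < 1"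
    and l: "0 \<le> l" "l \<le> 1 / 2" "l^2 + d^2 < 1" "(1 - l)^2 + d^2 < 1" and Xl: "X \<longlonglongrightarrow> l"
    and z: "\<And>k. z k \<in> disc_zeros (X k) d" and zl: "z \<longlonglongrightarrow> z0"
  shows "norm z0 \<noteq> 1"
proof
  assume z1: "norm z0 = 1"
  have "\<forall>k. \<exists>p. (fst p)^2 = z k \<and> fst p \<noteq> 0 \<and> norm (fst p) < 1 \<and> eigvec (weight (X k) d) ((fst p + 1 / fst p) / 2) (snd p) \<and>
      (norm (snd p 0))^2 + (norm (snd p (-1)))^2 = 1 \<and>
      (\<forall>F. finite F \<longrightarrow> 0 \<notin> F \<longrightarrow> -1 \<notin> F \<longrightarrow> (\<Sum>n\<in>F. (norm (snd p n))^2) \<le> 1 / (- weight (X k) d 0) + 1 / (- weight (X k) d (-1)))"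
  proof
    fix k
    obtain s y where "s^2 = z k" "s \<noteq> 0" "norm s < 1" "eigvec (weight (X k) d) ((s + 1 / s) / 2) y"
      "(norm (y 0))^2 + (norm (y (-1)))^2 = 1"
      "\<And>F. finite F \<Longrightarrow> 0 \<notin> F \<Longrightarrow> -1 \<notin> F \<Longrightarrow> (\<Sum>n\<in>F. (norm (y n))^2) \<le> 1 / (- weight (X k) d 0) + 1 / (- weight (X k) d (-1))"
      using disc_zero_eigvec_II[OF X(1,2) d X(3,4) z] by blast
    then show "\<exists>p. (fst p)^2 = z k \<and> fst p \<noteq> 0 \<and> norm (fst p) < 1 \<and> eigvec (weight (X k) d) ((fst p + 1 / fst p) / 2) (snd p) \<and>
      (norm (snd p 0))^2 + (norm (snd p (-1)))^2 = 1 \<and>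
      (\<forall>F. finite F \<longrightarrow> 0 \<notin> F \<longrightarrow> -1 \<notin> F \<longrightarrow> (\<Sum>n\<in>F. (norm (snd p n))^2) \<le> 1 / (- weight (X k) d 0) + 1 / (- weight (X k) d (-1)))"
      by (intro exI[of _ "(s, y)"]) simp
  qed
  then obtain p where p: "\<forall>k. (fst (p k))^2 = z k \<and> fst (p k) \<noteq> 0 \<and> norm (fst (p k)) < 1 \<and> eigvec (weight (X k) d) ((fst (p k) + 1 / fst (p k)) / 2) (snd (p k)) \<and>
      (norm (snd (p k) 0))^2 + (norm (snd (p k) (-1)))^2 = 1 \<and>
      (\<forall>F. finite F \<longrightarrow> 0 \<notin> F \<longrightarrow> -1 \<notin> F \<longrightarrow> (\<Sum>n\<in>F. (norm (snd (p k) n))^2) \<le> 1 / (- weight (X k) d 0) + 1 / (- weight (X k) d (-1)))"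
    by (rule choice[THEN exE]) 
  define s where "s k = fst (p k)" for k
  define v where "v k = snd (p k)" for k
  have s2: "(s k)^2 = z k" and s0: "s k \<noteq> 0" and sn: "norm (s k) < 1"
    and ve: "eigvec (weight (X k) d) ((s k + 1 / s k) / 2) (v k)"
    and v1: "(norm (v k 0))^2 + (norm (v k (-1)))^2 = 1"
    and vF: "finite F \<Longrightarrow> 0 \<notin> F \<Longrightarrow> -1 \<notin> F \<Longrightarrow> (\<Sum>n\<in>F. (norm (v k n))^2) \<le> 1 / (- weight (X k) d 0) + 1 / (- weight (X k) d (-1))" for k F
    using p by (simp_all add: s_def v_def)
  have vb: "norm (v k 0) \<le> 1" "norm (v k (-1)) \<le> 1" for k
  proof -
    have "(norm (v k 0))^2 \<le> 1" using v1[of k] zero_le_power2[of "norm (v k (-1))"] by linarith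
    then have "(norm (v k 0))^2 \<le> 1^2" by simp
    then show "norm (v k 0) \<le> 1" by (rule power2_le_imp_le) simp
    have "(norm (v k (-1)))^2 \<le> 1" using v1[of k] zero_le_power2[of "norm (v k 0)"] by linarith
    then have "(norm (v k (-1)))^2 \<le> 1^2" by simp
    then show "norm (v k (-1)) \<le> 1" by (rule power2_le_imp_le) simp
  qed
  have "compact (cball (0::complex) 1 \<times> cball (0::complex) 1 \<times> cball (0::complex) 1)"
    by (intro compact_Times compact_cball)
  then have sc: "seq_compact (cball (0::complex) 1 \<times> cball (0::complex) 1 \<times> cball (0::complex) 1)"
    by (rule compact_imp_seq_compact)
  have mem: "\<forall>k. (s k, v k 0, v k (-1)) \<in> cball (0::complex) 1 \<times> cball (0::complex) 1 \<times> cball (0::complex) 1"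
    using sn vb by (auto intro: less_imp_le)
  obtain L r where r: "strict_mono r" "((\<lambda>k. (s k, v k 0, v k (-1))) \<circ> r) \<longlonglongrightarrow> L"
    using seq_compactE[OF sc mem] by blast
  define s' a0 a1 where "s' = fst L" and "a0 = fst (snd L)" and "a1 = snd (snd L)"
  have sl: "(\<lambda>k. s (r k)) \<longlonglongrightarrow> s'" using tendsto_fst[OF r(2)] by (simp add: o_def s'_def)
  have al0: "(\<lambda>k. v (r k) 0) \<longlonglongrightarrow> a0" using tendsto_fst[OF tendsto_snd[OF r(2)]] by (simp add: o_def a0_def)
  have al1: "(\<lambda>k. v (r k) (-1)) \<longlonglongrightarrow> a1" using tendsto_snd[OF tendsto_snd[OF r(2)]] by (simp add: o_def a1_def)
  have Xr: "(\<lambda>k. X (r k)) \<longlonglongrightarrow> l" using LIMSEQ_subseq_LIMSEQ[OF Xl r(1)] by (simp add: o_def)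
  have zr: "(\<lambda>k. z (r k)) \<longlonglongrightarrow> z0" using LIMSEQ_subseq_LIMSEQ[OF zl r(1)] by (simp add: o_def)
  have "(\<lambda>k. (s (r k))^2) \<longlonglongrightarrow> s'^2" by (intro tendsto_intros sl)
  then have "s'^2 = z0" unfolding s2 using zr LIMSEQ_unique by blast
  then have "norm (s'^2) = 1" using z1 by simp
  then have "norm s' ^ 2 = 1^2" by (simp add: norm_power)
  then have ns: "norm s' = 1" by (rule power2_eq_imp_eq) simp_all
  then have s'0: "s' \<noteq> 0" by auto
  define c where "c = Re s'"
  have cc: "(s' + 1 / s') / 2 = of_real c"
  proof -
    have "1 / s' = cnj s'" using complex_div_cnj[of 1 s'] ns by simp
    then show ?thesis by (simp add: c_def complex_eq_iff)
  qed
  have c1: "\<bar>c\<bar> \<le> 1" using abs_Re_le_cmod[of s'] ns by (simp add: c_def)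
  have cl: "(\<lambda>k. (s (r k) + 1 / s (r k)) / 2) \<longlonglongrightarrow> of_real c"
    unfolding cc[symmetric] by (intro tendsto_intros sl s'0) simp
  have rrl: "(\<lambda>k. weight (X (r k)) d n) \<longlonglongrightarrow> weight l d n" for n
  proof -
    have "(l + of_int n)^2 + d^2 > 0" using d by (intro add_nonneg_pos) auto
    then show ?thesis unfolding weight_def by (intro tendsto_intros Xr) (simp add: d)
  qed
  have rl0: "weight l d n \<noteq> 0" for n by (rule weight_nonzero_II[OF l(1,2) d l(3,4)])
  have rX0: "weight (X k) d n \<noteq> 0" for k n by (rule weight_nonzero_II[OF X(1,2) d X(3,4)])
  have veq: "2 * ((s k + 1 / s k) / 2) * v k n = of_real (weight (X k) d n) * (v k (n - 1) + v k (n + 1))" for k n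
    using ve[of k] by (simp add: eigvec_def)
  have up: "v k (n + 1) = 2 * ((s k + 1 / s k) / 2) * v k n / of_real (weight (X k) d n) - v k (n - 1)"
    and down: "v k (n - 1) = 2 * ((s k + 1 / s k) / 2) * v k n / of_real (weight (X k) d n) - v k (n + 1)" for k n
    unfolding veq using rX0[of k n] by simp_all
  have stp: "(\<lambda>k. 2 * ((s (r k) + 1 / s (r k)) / 2) * v (r k) n / of_real (weight (X (r k)) d n) - v (r k) m)
      \<longlonglongrightarrow> 2 * of_real c * A / of_real (weight l d n) - B"
    if "(\<lambda>k. v (r k) n) \<longlonglongrightarrow> A" "(\<lambda>k. v (r k) m) \<longlonglongrightarrow> B" for n m A B
    using that rl0 by (intro tendsto_intros cl rrl) auto
  have "convergent (\<lambda>k. v (r k) n) \<and> convergent (\<lambda>k. v (r k) (n - 1))" for n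
  proof (induction n rule: int_induct[of _ 0])
    case base show ?case using al0 al1 by (auto simp: convergent_def)
  next
    case (step1 i)
    then obtain A B where "(\<lambda>k. v (r k) i) \<longlonglongrightarrow> A" "(\<lambda>k. v (r k) (i - 1)) \<longlonglongrightarrow> B" by (auto simp: convergent_def)
    from stp[OF this] have "convergent (\<lambda>k. v (r k) (i + 1))" unfolding up[symmetric] by (auto simp: convergent_def)
    then show ?case using step1 by simp
  next
    case (step2 i)
    then obtain A B where "(\<lambda>k. v (r k) (i - 1)) \<longlonglongrightarrow> A" "(\<lambda>k. v (r k) i) \<longlonglongrightarrow> B" by (auto simp: convergent_def)
    from stp[OF this] have "convergent (\<lambda>k. v (r k) (i - 1 - 1))"
      using down[of _ "i - 1"] by (simp add: convergent_def) blast
    then show ?case using step2 by simp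
  qed
  then have "\<forall>n. \<exists>A. (\<lambda>k. v (r k) n) \<longlonglongrightarrow> A" by (auto simp: convergent_def)
  then obtain y where y: "\<And>n. (\<lambda>k. v (r k) n) \<longlonglongrightarrow> y n" by (rule choice[THEN exE]) blast
  have yeq: "2 * of_real c * y n = of_real (weight l d n) * (y (n - 1) + y (n + 1))" for n
  proof (rule LIMSEQ_unique)
    show "(\<lambda>k. 2 * ((s (r k) + 1 / s (r k)) / 2) * v (r k) n) \<longlonglongrightarrow> 2 * of_real c * y n"
      by (intro tendsto_intros cl y)
    show "(\<lambda>k. 2 * ((s (r k) + 1 / s (r k)) / 2) * v (r k) n) \<longlonglongrightarrow> of_real (weight l d n) * (y (n - 1) + y (n + 1))"
      unfolding veq by (intro tendsto_intros rrl y)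
  qed
  have y1: "(norm (y 0))^2 + (norm (y (-1)))^2 = 1"
  proof (rule LIMSEQ_unique)
    show "(\<lambda>k. (norm (v (r k) 0))^2 + (norm (v (r k) (-1)))^2) \<longlonglongrightarrow> (norm (y 0))^2 + (norm (y (-1)))^2"
      by (intro tendsto_intros y)
  qed (simp add: v1)
  define M where "M = 1 / (- weight l d 0) + 1 / (- weight l d (-1))"
  have yF: "(\<Sum>n\<in>F. (norm (y n))^2) \<le> M" if F: "finite F" "0 \<notin> F" "-1 \<notin> F" for F
  proof (rule LIMSEQ_le)
    show "(\<lambda>k. \<Sum>n\<in>F. (norm (v (r k) n))^2) \<longlonglongrightarrow> (\<Sum>n\<in>F. (norm (y n))^2)"
      by (intro tendsto_intros y)
    show "(\<lambda>k. 1 / (- weight (X (r k)) d 0) + 1 / (- weight (X (r k)) d (-1))) \<longlonglongrightarrow> M"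
      unfolding M_def by (intro tendsto_intros rrl) (use rl0 in auto)
    show "\<exists>N. \<forall>n\<ge>N. (\<Sum>m\<in>F. (norm (v (r n) m))^2) \<le> 1 / (- weight (X (r n)) d 0) + 1 / (- weight (X (r n)) d (-1))"
      using vF[OF F] by blast
  qed
  have yp: "(\<lambda>k. y (int k)) \<longlonglongrightarrow> 0"
  proof -
    have "(\<lambda>k. y (int (Suc k))) \<longlonglongrightarrow> 0"
    proof (rule bounded_sums_tendsto_0)
      fix n
      have inj: "inj_on (\<lambda>k. int (Suc k)) {..<n}" by (auto simp: inj_on_def)
      have "(\<Sum>k<n. (norm (y (int (Suc k))))^2) = (\<Sum>m\<in>(\<lambda>k. int (Suc k)) ` {..<n}. (norm (y m))^2)"
        by (simp only: sum.reindex[OF inj] o_def)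
      also have "\<dots> \<le> M" by (rule yF) auto
      finally show "(\<Sum>k<n. (norm (y (int (Suc k))))^2) \<le> M" .
    qed
    then show ?thesis by (rule LIMSEQ_imp_Suc)
  qed
  have ym: "(\<lambda>k. y (- int k)) \<longlonglongrightarrow> 0"
  proof -
    have "(\<lambda>k. y (- int (k + 2))) \<longlonglongrightarrow> 0"
    proof (rule bounded_sums_tendsto_0)
      fix n
      have inj: "inj_on (\<lambda>k. - int (k + 2)) {..<n}" by (auto simp: inj_on_def)
      have "(\<Sum>k<n. (norm (y (- int (k + 2))))^2) = (\<Sum>m\<in>(\<lambda>k. - int (k + 2)) ` {..<n}. (norm (y m))^2)"
        by (simp only: sum.reindex[OF inj] o_def)
      also have "\<dots> \<le> M" by (rule yF) auto
      finally show "(\<Sum>k<n. (norm (y (- int (k + 2))))^2) \<le> M" .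
    qed
    then show ?thesis by (rule LIMSEQ_offset)
  qed
  have "Re (y n) = 0" for n
  proof (rule no_real_decaying_solution[OF l(1,2) d l(3,4) c1])
    fix n
    have "Re (2 * of_real c * y n) = Re (of_real (weight l d n) * (y (n - 1) + y (n + 1)))" by (simp only: yeq)
    then show "2 * c * Re (y n) = weight l d n * (Re (y (n - 1)) + Re (y (n + 1)))" by simp
    show "(\<lambda>k. Re (y (int k))) \<longlonglongrightarrow> 0" "(\<lambda>k. Re (y (- int k))) \<longlonglongrightarrow> 0"
      using tendsto_Re[OF yp] tendsto_Re[OF ym] by simp_all
  qed
  moreover have "Im (y n) = 0" for n
  proof (rule no_real_decaying_solution[OF l(1,2) d l(3,4) c1])
    fix n
    have "Im (2 * of_real c * y n) = Im (of_real (weight l d n) * (y (n - 1) + y (n + 1)))" by (simp only: yeq)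
    then show "2 * c * Im (y n) = weight l d n * (Im (y (n - 1)) + Im (y (n + 1)))" by simp
    show "(\<lambda>k. Im (y (int k))) \<longlonglongrightarrow> 0" "(\<lambda>k. Im (y (- int k))) \<longlonglongrightarrow> 0"
      using tendsto_Im[OF yp] tendsto_Im[OF ym] by simp_all
  qed
  ultimately have "y n = 0" for n by (simp add: complex_eq_iff)
  then show False using y1 by simp
qed

text \<open>
Continuation along a segment of fixed d that starts on the boundary between the regions I and II,
where a zero exists by the change of sign.
\<close>

lemma disc_zeros_exist_II:
  assumes \<theta>: "0 \<le> \<theta>" "\<theta> \<le> 1 / 2" and d: "d \<noteq> 0" and reg: "\<theta>^2 + d^2 < 1" "(1 - \<theta>)^2 + d^2 < 1"
  shows "disc_zeros \<theta> d \<noteq> {}"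
proof -
  \<comment> \<open>The value of \<theta> at which the segment of this d meets the circle with index -1.\<close>
  define a where "a = 1 - sqrt (1 - d^2)"
  have d2a: "0 < d^2" using d by simp
  have d2b: "d^2 < 1" using reg(1) zero_le_power2[of \<theta>] by linarith
  note d2 = d2a d2b
  have a1: "(1 - a)^2 + d^2 = 1" using d2 by (simp add: a_def)
  have a0: "0 < a" using d2 by (simp add: a_def)
  have a\<theta>: "a < \<theta>"
  proof (rule ccontr)
    assume "\<not> a < \<theta>"
    then have "(1 - a)^2 \<le> (1 - \<theta>)^2" using d2 by (intro power_mono) (auto simp: a_def)
    then show False using a1 reg(2) by linarith
  qed
  have aI: "a^2 + d^2 < 1"
  proof -
    have "a^2 \<le> \<theta>^2" using a\<theta> a0 by (intro power_mono) auto
    then show ?thesis using reg(1) by linarith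
  qed
  have regt: "t^2 + d^2 < 1 \<and> (1 - t)^2 + d^2 < 1" if "a < t" "t \<le> 1 / 2" for t
  proof -
    have "(1 - t)^2 < (1 - a)^2" using that by (intro power_strict_mono) auto
    moreover have "t^2 \<le> (1 - t)^2" using that a0 by (intro power_mono) auto
    ultimately show ?thesis using a1 by linarith
  qed
  define J where "J = {a..1 / 2 :: real}"
  define S where "S = {t \<in> J. disc_zeros t d \<noteq> {}}"
  have aS: "a \<in> S"
  proof -
    obtain x where "complex_of_real x \<in> disc_zeros a d"
      by (rule disc_zeros_exist_I[OF less_imp_le[OF a0] _ d aI]) (use a1 a\<theta> \<theta> that in auto)
    then show ?thesis using a\<theta> \<theta> by (auto simp: S_def J_def)
  qed
  have nc: "\<not> hill_fun d constant_on ball 0 1"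
  proof
    assume "hill_fun d constant_on ball 0 1"
    then obtain k where k: "\<And>z. z \<in> ball 0 1 \<Longrightarrow> hill_fun d z = k" by (auto simp: constant_on_def)
    obtain z where "z \<in> disc_zeros a d" using aS by (auto simp: S_def)
    then have "z \<in> ball 0 1" "hill_fun d z = - of_real ((sin (pi * a))^2)"
      by (auto simp: disc_zeros_def eq_neg_iff_add_eq_0 add.commute)
    then have "\<forall>w\<in>ball 0 1. hill_fun d w = - of_real ((sin (pi * a))^2)" using k by simp
    then show False using hill_fun_nonconst[OF d, of a] by blast
  qed
  have oS: "openin (top_of_set J) S"
  proof -
    have "open (hill_fun d ` ball 0 1)"
      by (rule open_mapping_thm[OF hill_fun_holomorphic open_ball connected_ball open_ball order_refl nc])
    then have "open ((\<lambda>t. - complex_of_real ((sin (pi * t))^2)) -` (hill_fun d ` ball 0 1))"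
      by (rule open_vimage) (intro continuous_intros)
    moreover have "S = J \<inter> ((\<lambda>t. - complex_of_real ((sin (pi * t))^2)) -` (hill_fun d ` ball 0 1))"
    proof -
      have "disc_zeros t d \<noteq> {} \<longleftrightarrow> - complex_of_real ((sin (pi * t))^2) \<in> hill_fun d ` ball 0 1" for t
      proof -
        have e: "of_real ((sin (pi * t))^2) + w = 0 \<longleftrightarrow> - complex_of_real ((sin (pi * t))^2) = w" for w
          by (auto simp: add_eq_0_iff)
        show ?thesis unfolding disc_zeros_def e by (auto simp: image_iff)
      qed
      then show ?thesis by (auto simp: S_def)
    qed
    ultimately show ?thesis by (simp add: openin_open_Int)
  qed
  have cS: "closed S"
    unfolding closed_sequential_limits
  proof (intro allI impI)
    fix X l assume Xl: "(\<forall>n. X n \<in> S) \<and> X \<longlonglongrightarrow> l"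
    have "closed J" by (simp add: J_def)
    moreover have "\<forall>n. X n \<in> J" using Xl by (auto simp: S_def)
    ultimately have lJ: "l \<in> J" using Xl closed_sequentially by blast
    show "l \<in> S"
    proof (cases "l = a")
      case True then show ?thesis using aS by simp
    next
      case False
      then have la: "a < l" "l \<le> 1 / 2" using lJ by (auto simp: J_def)
      have "\<forall>\<^sub>F n in sequentially. X n > a" using order_tendstoD(1)[of X l sequentially a] Xl la by blast
      then obtain N where N: "\<And>n. n \<ge> N \<Longrightarrow> X n > a" by (auto simp: eventually_sequentially)
      define Y where "Y n = X (n + N)" for n
      have YS: "Y n \<in> S" "a < Y n" "Y n \<le> 1 / 2" for n
        using Xl N by (auto simp: Y_def S_def J_def)
      have Yl: "Y \<longlonglongrightarrow> l" unfolding Y_def using LIMSEQ_ignore_initial_segment Xl by blast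
      have "\<forall>n. \<exists>z. z \<in> disc_zeros (Y n) d" using YS(1) by (auto simp: S_def)
      then obtain z where z: "\<And>n. z n \<in> disc_zeros (Y n) d" by (rule choice[THEN exE]) blast
      have zb: "\<forall>n. z n \<in> cball 0 1" using z by (auto simp: disc_zeros_def intro: less_imp_le)
      obtain z0 r where r: "z0 \<in> cball 0 1" "strict_mono r" "(z \<circ> r) \<longlonglongrightarrow> z0"
        using seq_compactE[OF compact_imp_seq_compact[OF compact_cball[of "0::complex" 1]] zb] by blast
      have Yr: "(\<lambda>n. Y (r n)) \<longlonglongrightarrow> l" using LIMSEQ_subseq_LIMSEQ[OF Yl r(2)] by (simp add: o_def)
      have zr: "(\<lambda>n. z (r n)) \<longlonglongrightarrow> z0" using r(3) by (simp add: o_def)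
      have "norm z0 \<noteq> 1"
      proof (rule no_zero_reaches_circle[OF d, where X = "\<lambda>n. Y (r n)" and z = "\<lambda>n. z (r n)" and l = l])
        show "0 \<le> Y (r k)" "Y (r k) \<le> 1 / 2" "(Y (r k))^2 + d^2 < 1" "(1 - Y (r k))^2 + d^2 < 1" for k
          using YS(2,3)[of "r k"] a0 regt[of "Y (r k)"] by auto
        show "0 \<le> l" "l \<le> 1 / 2" "l^2 + d^2 < 1" "(1 - l)^2 + d^2 < 1" using la a0 regt[of l] by auto
        show "z (r k) \<in> disc_zeros (Y (r k)) d" for k by (rule z)
      qed (rule Yr, rule zr)
      then have z0: "norm z0 < 1" using r(1) by simp
      have "isCont (hill_fun d) z0"
        using holomorphic_on_imp_continuous_on[OF hill_fun_holomorphic] z0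
        by (simp add: continuous_on_eq_continuous_at)
      then have "(\<lambda>n. hill_fun d (z (r n))) \<longlonglongrightarrow> hill_fun d z0" using zr by (rule isCont_tendsto_compose)
      then have "(\<lambda>n. of_real ((sin (pi * Y (r n)))^2) + hill_fun d (z (r n))) \<longlonglongrightarrow> of_real ((sin (pi * l))^2) + hill_fun d z0"
        by (intro tendsto_intros Yr)
      moreover have "of_real ((sin (pi * Y (r n)))^2) + hill_fun d (z (r n)) = 0" for n
        using z[of "r n"] by (simp add: disc_zeros_def)
      ultimately have "of_real ((sin (pi * l))^2) + hill_fun d z0 = 0"
        by (simp only:) (simp add: tendsto_const_iff)
      then have "z0 \<in> disc_zeros l d" using z0 by (simp add: disc_zeros_def)
      then show ?thesis using lJ by (auto simp: S_def)
    qed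
  qed
  have cS': "closedin (top_of_set J) S"
    by (rule closed_subset[OF _ cS]) (auto simp: S_def)
  have "connected J" by (simp add: J_def)
  then have "S = {} \<or> S = J" using oS cS' unfolding connected_clopen by blast
  then have "S = J" using aS by blast
  moreover have "\<theta> \<in> J" using a\<theta> \<theta> by (simp add: J_def)
  ultimately show ?thesis by (auto simp: S_def)
qed

section \<open>From the unit disc to the slit plane\<close>

lemma s_of_unique:
  assumes "norm s < 1" "s \<noteq> 0" "(s + 1 / s) / 2 \<notin> cut"
  shows "s_of ((s + 1 / s) / 2) = s"
proof -
  note e = s_of_explicit(4,5,6)[OF assms(3)]
  show ?thesis
  proof (rule joukowski_inj[OF _ e(1) assms(1) e(2) assms(2)])
    show "s_of ((s + 1 / s) / 2) + 1 / s_of ((s + 1 / s) / 2) = s + 1 / s"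
      using arg_cong[OF e(3), of "\<lambda>c. 2 * c"] unfolding mult_2 field_sum_of_halves by simp
  qed
qed

lemma cut_uminus: "- c \<in> cut \<longleftrightarrow> c \<in> cut"
  by (simp add: cut_iff)

lemma s_of_uminus:
  assumes "c \<notin> cut" shows "s_of (- c) = - s_of c"
proof -
  note e = s_of_explicit(4,5,6)[OF assms]
  have c: "(- s_of c + 1 / (- s_of c)) / 2 = - c"
    by (subst (3) e(3)) (simp add: field_simps)
  show ?thesis using s_of_unique[of "- s_of c"] e assms unfolding c by (simp add: cut_uminus)
qed

lemma four_c_sq:
  assumes "c \<notin> cut" shows "4 * c^2 * (s_of c)^2 = (1 + (s_of c)^2)^2"
proof -
  note e = s_of_explicit(4,5,6)[OF assms]
  have "2 * c * s_of c = 1 + (s_of c)^2"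
    by (subst e(3)) (use e(2) in \<open>simp add: field_simps power2_eq_square\<close>)
  then have "(2 * c * s_of c)^2 = (1 + (s_of c)^2)^2" by simp
  then show ?thesis by (simp add: power_mult_distrib)
qed

text \<open>
The map from c to z = s^2 is two-to-one, since replacing c by -c replaces s by -s.
\<close>

lemma s_of_sq_eq_iff:
  assumes "c \<notin> cut" "c' \<notin> cut"
  shows "(s_of c')^2 = (s_of c)^2 \<longleftrightarrow> c' = c \<or> c' = - c"
proof
  assume "(s_of c')^2 = (s_of c)^2"
  then have "s_of c' = s_of c \<or> s_of c' = - s_of c" by (metis power2_eq_iff)
  moreover have "s_of c' = s_of (- c) \<longleftrightarrow> s_of c' = - s_of c" by (simp add: s_of_uminus[OF assms(1)])
  moreover have "x = y" if "s_of x = s_of y" "x \<notin> cut" "y \<notin> cut" for x y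
    using s_of_explicit(6)[OF that(2)] s_of_explicit(6)[OF that(3)] that(1) by simp
  ultimately show "c' = c \<or> c' = - c" using assms by (metis cut_uminus)
next
  assume "c' = c \<or> c' = - c"
  then show "(s_of c')^2 = (s_of c)^2" using s_of_uminus[OF assms(1)] by auto
qed

lemma open_compl_cut: "open (- cut)"
proof -
  have "compact cut" unfolding cut_def by (intro compact_continuous_image continuous_intros compact_Icc)
  then show ?thesis by (simp add: compact_imp_closed open_Compl)
qed

text \<open>
The map h(c) = s(c)^2 satisfies 4 c^2 h = (1 + h)^2. Differentiation shows that it has no critical
points off the cut, so composition with it preserves orders of zeros.
\<close>

lemma mult_eq_zero_order:
  assumes d: "d \<noteq> 0" and c: "c \<notin> cut"
  shows "mult \<theta> d c = zero_order \<theta> d ((s_of c)^2)"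
proof -
  define h where "h w = (s_of w)^2" for w
  define F where "F z = of_real ((sin (pi * \<theta>))^2) + hill_fun d z" for z
  have hol: "h holomorphic_on - cut"
  proof (rule holomorphic_transform)
    show "(\<lambda>w. (w * (1 - csqrt (1 - 1 / w^2)))^2) holomorphic_on - cut"
      by (intro holomorphic_intros) (use s_of_explicit(1,2) in auto)
  qed (simp add: h_def s_of_explicit(3))
  have ha: "h analytic_on {c}" using hol open_compl_cut c analytic_at by blast
  have near: "\<forall>\<^sub>F w in nhds c. w \<notin> cut"
    using eventually_nhds_in_open[OF open_compl_cut, of c] c by simp
  have hb: "norm (h c) < 1" using s_of_explicit(4)[OF c] by (simp add: h_def norm_power2_less_1)
  have Fh: "F holomorphic_on ball 0 1" unfolding F_def by (intro holomorphic_intros hill_fun_holomorphic)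
  have Fa: "F analytic_on {h c}" using Fh hb by (auto simp: analytic_at intro!: exI[of _ "ball 0 1"])
  obtain w0 where w0: "w0 \<in> ball 0 1" "F w0 \<noteq> 0"
    using hill_fun_nonconst[OF d, of \<theta>] by (auto simp: F_def eq_neg_iff_add_eq_0 add.commute)
  have Fn: "\<forall>\<^sub>F w in at (h c). F w \<noteq> 0"
    using non_zero_neighbour_alt[OF Fh open_ball connected_ball _ w0, of "h c"] hb by (auto elim: eventually_mono)
  have "c \<noteq> - c" using s_of_explicit(1)[OF c] by simp
  then have "\<forall>\<^sub>F w in at c. w \<noteq> - c" using t1_space_nhds[of c "- c"] by (simp add: eventually_at_filter eventually_mono)
  then have hn: "\<forall>\<^sub>F w in at c. h w \<noteq> h c"
    using near unfolding eventually_at_filter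
    by eventually_elim (simp add: h_def s_of_sq_eq_iff[OF c])
  have h0: "h c \<noteq> 0" using s_of_explicit(5)[OF c] by (simp add: h_def)
  have hd: "(h has_field_derivative deriv h c) (at c)"
    using ha by (simp add: analytic_on_imp_differentiable_at DERIV_deriv_iff_field_differentiable)
  \<comment> \<open>Differentiating the identity shows that h has nonzero derivative at c.\<close>
  have "((\<lambda>w. 4 * w^2 * h w - (1 + h w)^2) has_field_derivative
      8 * c * h c + 4 * c^2 * deriv h c - 2 * (1 + h c) * deriv h c) (at c)"
    by (rule derivative_eq_intros hd refl | simp)+ 
  moreover have "((\<lambda>w. 4 * w^2 * h w - (1 + h w)^2) has_field_derivative 0) (at c)"
  proof -
    have "\<forall>\<^sub>F w in nhds c. 4 * w^2 * h w - (1 + h w)^2 = 0"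
      using near by eventually_elim (simp add: h_def four_c_sq)
    then show ?thesis
      using DERIV_cong_ev[OF refl, of "\<lambda>w. 4 * w^2 * h w - (1 + h w)^2" "\<lambda>_. 0" c 0 0] by simp
  qed
  ultimately have "8 * c * h c + 4 * c^2 * deriv h c - 2 * (1 + h c) * deriv h c = 0"
    by (rule DERIV_unique)
  then have dh: "deriv h c \<noteq> 0" using h0 s_of_explicit(1)[OF c] by auto
  have "zorder (\<lambda>w. h w - h c) c = 1"
  proof (rule zorder_zero_eqI')
    show "(\<lambda>w. h w - h c) analytic_on {c}" by (intro analytic_intros ha)
    have "deriv (\<lambda>w. h w - h c) c = deriv h c"
      by (rule DERIV_imp_deriv) (rule derivative_eq_intros hd | simp)+
    then show "(deriv ^^ nat 1) (\<lambda>w. h w - h c) c \<noteq> 0" using dh by simp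
  qed simp_all
  then have "zorder (F \<circ> h) c = zorder F (h c)"
    using zorder_compose'[OF _ _ ha Fn hn] Fa isolated_singularity_at_analytic not_essential_analytic by simp
  moreover have "mult \<theta> d c = zorder (\<lambda>w. - 4 * (F \<circ> h) w) c"
    unfolding mult_def
  proof (rule zorder_cong)
    show "\<forall>\<^sub>F w in at c. E w \<theta> d = - 4 * (F \<circ> h) w"
      using eventually_nhds_conv_at near
      by (rule eventually_mono[OF iffD1[THEN conjunct1]]) (simp add: E_eq[OF _ d] F_def h_def)
  qed simp
  moreover have "zorder (\<lambda>w. - 4 * (F \<circ> h) w) c = zorder (F \<circ> h) c" by (rule zorder_cmult) simp
  ultimately show ?thesis by (simp add: zero_order_def F_def[abs_def] h_def)
qed

lemma eigenvalues_eq: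
  assumes d: "d \<noteq> 0"
  shows "eigenvalues \<theta> d = {c. c \<notin> cut \<and> (s_of c)^2 \<in> disc_zeros \<theta> d}"
proof -
  have "c \<in> eigenvalues \<theta> d \<longleftrightarrow> c \<notin> cut \<and> (s_of c)^2 \<in> disc_zeros \<theta> d" for c
  proof (cases "c \<in> cut")
    case False
    have "E c \<theta> d = 0 \<longleftrightarrow> of_real ((sin (pi * \<theta>))^2) + hill_fun d ((s_of c)^2) = 0"
      unfolding E_eq[OF False d] mult_eq_0_iff by simp
    then show ?thesis
      using norm_power2_less_1[OF s_of_explicit(4)[OF False]] by (simp only: eigenvalues_def disc_zeros_def mem_Collect_eq) simp
  qed (simp add: eigenvalues_def)
  then show ?thesis by blast
qed

text \<open>
A real c off the cut would have real s, hence z = s^2 > 0.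
\<close>

lemma eigenvalue_nonreal:
  assumes d: "d \<noteq> 0" and c: "c \<in> eigenvalues \<theta> d"
  shows "Im c \<noteq> 0"
proof
  assume I: "Im c = 0"
  have c': "c \<notin> cut" "(s_of c)^2 \<in> disc_zeros \<theta> d" using c by (auto simp: eigenvalues_eq[OF d])
  note e = s_of_explicit(4,5,6)[OF c'(1)]
  have "(norm (s_of c))^2 < 1" "(norm (s_of c))^2 > 0" using e by (auto simp: power_less_one_iff)
  then have "1 - 1 / (norm (s_of c))^2 < 0" by simp
  moreover have "Im (s_of c) * (1 - 1 / (norm (s_of c))^2) / 2 = 0"
    using Im_joukowski[OF e(2)] e(3) I by simp
  ultimately have "Im (s_of c) = 0" by (metis divide_eq_0_iff less_irrefl mult_eq_0_iff zero_neq_numeral)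
  then have "s_of c = of_real (Re (s_of c))" by (simp add: complex_eq_iff)
  then have "(s_of c)^2 = of_real ((Re (s_of c))^2)" by (metis of_real_power)
  then have "(s_of c)^2 \<in> \<real>\<^sub>\<ge>\<^sub>0" by (metis nonneg_Reals_of_real_iff zero_le_power2)
  then show False using disc_zeros_not_nonneg[OF d c'(2)] by blast
qed

text \<open>
The root s in the lower half plane is fixed first; the formula for c^2 decides below between
imaginary and non-imaginary eigenvalues.
\<close>

lemma disc_zero_preimage:
  assumes d: "d \<noteq> 0" and z: "z \<in> disc_zeros \<theta> d"
  obtains c where "c \<notin> cut" "Im c > 0" "(s_of c)^2 = z" "s_of (cnj c) = cnj (s_of c)"
    "{c'. c' \<notin> cut \<and> (s_of c')^2 = z} = {c, - c}" "c^2 = (z + 2 + 1 / z) / 4"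
proof -
  obtain s where s: "s^2 = z" "Im s < 0" "s \<noteq> 0" using lower_root[OF disc_zeros_not_nonneg[OF d z]] by blast
  have "norm s ^ 2 < 1" using z unfolding s(1)[symmetric] by (simp add: norm_power disc_zeros_def)
  then have sn: "norm s < 1" by (simp add: power_less_one_iff)
  define c where "c = (s + 1 / s) / 2"
  have Ic: "Im c > 0" unfolding c_def by (rule Im_joukowski_pos[OF s(3) sn s(2)])
  then have cc: "c \<notin> cut" "cnj c \<notin> cut" by (auto simp: cut_iff)
  have sc: "s_of c = s" unfolding c_def by (rule s_of_unique[OF sn s(3)]) (use cc in \<open>simp add: c_def\<close>)
  have "cnj c = (cnj s + 1 / cnj s) / 2" by (simp add: c_def)
  then have "s_of (cnj c) = cnj s"
    by (metis s_of_unique sn s(3) cc(2) complex_mod_cnj complex_cnj_zero_iff)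
  moreover have "{c'. c' \<notin> cut \<and> (s_of c')^2 = z} = {c, - c}"
    using s_of_sq_eq_iff[OF cc(1)] cc by (auto simp: cut_uminus simp flip: s(1) sc)
  moreover have "c^2 = (z + 2 + 1 / z) / 4"
    using s(3) unfolding s(1)[symmetric] c_def by (simp add: field_simps power2_eq_square)
  ultimately show thesis using that[OF cc(1) Ic] sc s(1) by simp
qed

lemma disc_zero_preimage_real:
  assumes x: "-1 < x" "x < 0" and I: "Im c > 0" and c: "c^2 = (of_real x + 2 + 1 / of_real x) / (4::complex)"
  shows "Re c = 0"
proof -
  have "c^2 = of_real ((x + 2 + 1 / x) / 4)" unfolding c by simp
  then have "Im (c^2) = 0" by (simp only: Im_complex_of_real)
  then have "Re c * Im c = 0" by (auto simp: power2_eq_square)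
  then show ?thesis using I by simp
qed

lemma disc_zero_preimage_nonreal:
  assumes z: "norm z < 1" "Im z \<noteq> 0" and c: "c^2 = (z + 2 + 1 / z) / (4::complex)"
  shows "Re c \<noteq> 0"
proof
  assume "Re c = 0"
  then have "Im (c^2) = 0" by (simp add: power2_eq_square)
  then have "Im ((z + 2 + 1 / z) / 4) = 0" by (simp only: c)
  then have "Im ((z + 1 / z) / 2) = 0" by (simp add: algebra_simps)
  moreover have z0: "z \<noteq> 0" using z(2) by auto
  moreover have "(norm z)^2 < 1" "(norm z)^2 > 0" using z z0 by (auto simp: power_less_one_iff)
  then have "1 - 1 / (norm z)^2 < 0" by simp
  ultimately show False using z(2) unfolding Im_joukowski[OF z0] by simp
qed

section \<open>Reduction of the Floquet exponent\<close>

lemma sin_sq_reduced: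
  fixes n :: int
  assumes "\<theta>' = \<theta> - of_int n \<or> \<theta>' = of_int n - \<theta>"
  shows "(sin (pi * \<theta>'))^2 = (sin (pi * \<theta>))^2"
proof -
  have c: "(sin (pi * t))^2 = (1 - cos (2 * pi * t)) / 2" for t
    using cos_double_sin[of "pi * t"] by (simp add: mult.assoc)
  have "2 * pi * (\<theta> - of_int n) = 2 * pi * \<theta> - 2 * pi * of_int n"
    "2 * pi * (of_int n - \<theta>) = 2 * pi * of_int n - 2 * pi * \<theta>" by (simp_all add: algebra_simps)
  then have "cos (2 * pi * (\<theta> - of_int n)) = cos (2 * pi * \<theta>)" "cos (2 * pi * (of_int n - \<theta>)) = cos (2 * pi * \<theta>)"
    by (simp_all add: cos_diff)
  then show ?thesis using assms unfolding c by auto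
qed

text \<open>
Periodicity and evenness in \<theta> allow one to replace \<theta> by its distance t to the nearest
integer. The circles with indices a and b become those with index 0 and -1.
\<close>

lemma circles_reduced:
  fixes \<theta> :: real
  obtains t a b where "0 \<le> t" "t \<le> 1 / 2" "(sin (pi * t))^2 = (sin (pi * \<theta>))^2" "(a :: int) \<noteq> b"
    "(\<theta> + of_int a)^2 = t^2" "(\<theta> + of_int b)^2 = (1 - t)^2"
    "\<And>l. l \<noteq> a \<Longrightarrow> l \<noteq> b \<Longrightarrow> (\<theta> + of_int l)^2 \<ge> 1"
proof -
  define n where "n = round \<theta>"
  define x where "x = \<theta> - of_int n"
  have x: "\<bar>x\<bar> \<le> 1 / 2" using of_int_round_abs_le[of \<theta>] by (simp add: x_def n_def abs_minus_commute)
  have th: "\<theta> + of_int l = x + of_int (l + n)" for l by (simp add: x_def)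
  have far: "(x + of_int m)^2 \<ge> 1" if "m \<noteq> 0" "m \<noteq> (if x \<ge> 0 then -1 else 1)" for m :: int
  proof -
    have "1 \<le> \<bar>x + of_int m\<bar>"
    proof (cases "x \<ge> 0")
      case True
      then have "m \<ge> 1 \<or> m \<le> -2" using that by auto
      then have "real_of_int m \<ge> 1 \<or> real_of_int m \<le> -2" by linarith
      then show ?thesis using x True by linarith
    next
      case False
      then have "m \<ge> 2 \<or> m \<le> -1" using that by auto
      then have "real_of_int m \<ge> 2 \<or> real_of_int m \<le> -1" by linarith
      then show ?thesis using x False by linarith
    qed
    then have "1^2 \<le> \<bar>x + of_int m\<bar>^2" by (intro power_mono) auto
    then show ?thesis by simp
  qed
  show thesis
  proof (rule that[of "\<bar>x\<bar>" "- n" "(if x \<ge> 0 then -1 else 1) - n"])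
    show "(sin (pi * \<bar>x\<bar>))^2 = (sin (pi * \<theta>))^2"
      by (rule sin_sq_reduced[of _ _ n]) (auto simp: x_def abs_if)
    show "(\<theta> + of_int l)^2 \<ge> 1" if "l \<noteq> - n" "l \<noteq> (if x \<ge> 0 then -1 else 1) - n" for l
      unfolding th by (rule far) (use that in auto)
    show "(\<theta> + of_int ((if x \<ge> 0 then -1 else 1) - n))^2 = (1 - \<bar>x\<bar>)^2"
      unfolding th by (simp add: power2_eq_square algebra_simps)
    show "(\<theta> + of_int (- n))^2 = \<bar>x\<bar>^2" unfolding th by simp
  qed (use x in auto)
qed

text \<open>
On the boundary between the regions I and II the second circle may only be known not to contain the
point; this weaker condition is the one under which a single zero is obtained.
\<close>

lemma regions_reduced:
  assumes d: "d \<noteq> 0"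
  obtains t where "0 \<le> t" "t \<le> 1 / 2" "(sin (pi * t))^2 = (sin (pi * \<theta>))^2"
    "region_0 \<theta> d \<Longrightarrow> t^2 + d^2 > 1"
    "region_I \<theta> d \<or> boundary_I_II \<theta> d \<Longrightarrow> t^2 + d^2 < 1 \<and> (1 - t)^2 + d^2 \<ge> 1"
    "region_II \<theta> d \<Longrightarrow> t^2 + d^2 < 1 \<and> (1 - t)^2 + d^2 < 1"
proof -
  obtain t a b where t: "0 \<le> t" "t \<le> 1 / 2" "(sin (pi * t))^2 = (sin (pi * \<theta>))^2" and ab: "(a :: int) \<noteq> b"
    "(\<theta> + of_int a)^2 = t^2" "(\<theta> + of_int b)^2 = (1 - t)^2"
    "\<And>l. l \<noteq> a \<Longrightarrow> l \<noteq> b \<Longrightarrow> (\<theta> + of_int l)^2 \<ge> 1"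
    using circles_reduced[of \<theta>] by blast
  have d2: "d^2 > 0" using d by simp
  have le: "t^2 \<le> (1 - t)^2" by (rule power_mono) (use t in auto)
  have off: "\<not> (\<theta> + of_int l)^2 + d^2 < 1" if "l \<noteq> a" "l \<noteq> b" for l using ab(4)[OF that] d2 by linarith
  have "l \<in> inside_circles \<theta> d \<longleftrightarrow> (l = a \<and> t^2 + d^2 < 1) \<or> (l = b \<and> (1 - t)^2 + d^2 < 1)" for l
    using ab(1) ab(2,3) off[of l] by (cases "l = a"; cases "l = b") (auto simp: inside_circles_def)
  then have ins: "inside_circles \<theta> d = (if t^2 + d^2 < 1 then {a} else {}) \<union> (if (1 - t)^2 + d^2 < 1 then {b} else {})"
    by auto
  show thesis
  proof (rule that[OF t])
    assume "region_0 \<theta> d"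
    then have "(\<theta> + of_int a)^2 + d^2 > 1" by (simp add: region_0_def)
    then show "t^2 + d^2 > 1" by (simp only: ab(2))
  next
    assume "region_I \<theta> d \<or> boundary_I_II \<theta> d"
    then have "card (inside_circles \<theta> d) = 1" by (auto simp: region_I_def boundary_I_II_def)
    then show "t^2 + d^2 < 1 \<and> (1 - t)^2 + d^2 \<ge> 1" using le ab(1) unfolding ins by (auto split: if_splits)
  next
    assume "region_II \<theta> d"
    then have "card (inside_circles \<theta> d) = 2" by (simp add: region_II_def)
    then show "t^2 + d^2 < 1 \<and> (1 - t)^2 + d^2 < 1" using ab(1) unfolding ins by (auto split: if_splits)
  qed
qed

section \<open>Zeros in each region\<close>

lemma disc_zeros_empty:
  assumes t: "0 \<le> t" "t \<le> 1 / 2" and d: "d \<noteq> 0" and out: "t^2 + d^2 > 1"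
  shows "disc_zeros t d = {}"
proof (rule ccontr)
  assume "disc_zeros t d \<noteq> {}"
  then obtain z where z: "{z} \<subseteq> disc_zeros t d" by blast
  have "t^2 \<le> (1 - t)^2" by (rule power_mono) (use t in auto)
  then have o: "\<not> t^2 + d^2 < 1" "\<not> (1 - t)^2 + d^2 < 1" "t^2 + d^2 \<noteq> 1" "(1 - t)^2 + d^2 \<noteq> 1" using out by linarith+
  have "card {z} \<le> (if t^2 + d^2 < 1 then 1 else 0) + (if (1 - t)^2 + d^2 < 1 then 1 else 0)"
    by (rule disc_zeros_card_le[OF t d o(3,4) _ z]) simp
  then show False using o by simp
qed

text \<open>
The bound on the number of zeros is available off the circles only. A suitable small change of t
leaves the circles and does not increase the number of circles around the point.
\<close>

lemma zero_order_sum_bound: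
  assumes t: "0 \<le> t" "t \<le> 1 / 2" and d: "d \<noteq> 0" and reg: "t^2 + d^2 < 1"
    and Z: "finite Z" "Z \<subseteq> disc_zeros t d"
  shows "(\<Sum>z\<in>Z. nat (zero_order t d z)) \<le> (if (1 - t)^2 + d^2 < 1 then 2 else 1)"
proof (rule zero_order_sum_le[OF d Z])
  fix \<epsilon> :: real assume \<epsilon>: "\<epsilon> > 0"
  have d2: "d^2 > 0" using d by simp
  have "\<exists>u. \<bar>u - t\<bar> < \<epsilon> \<and> 0 \<le> u \<and> u \<le> 1 / 2 \<and> u \<noteq> t \<and> u^2 + d^2 < 1 \<and>
      (if (1 - t)^2 + d^2 < 1 then (1 - u)^2 + d^2 < 1 else (1 - u)^2 + d^2 > 1)"
  proof (cases "t = 0")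
    case True
    have e: "\<not> (1 - t)^2 + d^2 < 1" using d2 True by simp
    have d1: "d^2 < 1" using reg True by simp
    \<comment> \<open>Here t = 0, and u must be positive: (1-u)^2 + d^2 > 1 holds for 2u < d^2, and u^2 + d^2 < 1 for u < 1 - d^2.\<close>
    define u where "u = min \<epsilon> (min (d^2 / 2) (1 - d^2)) / 2"
    have u: "0 < u" "u < \<epsilon>" "2 * u < d^2" "u < 1 - d^2" using \<epsilon> d2 d1 by (auto simp: u_def min_def)
    have "u^2 \<le> u * 1" unfolding power2_eq_square by (rule mult_left_mono) (use u d1 in auto)
    then have "u^2 + d^2 < 1" using u by linarith
    moreover have "(1 - u)^2 = 1 - 2 * u + u^2" by (simp add: power2_eq_square algebra_simps)
    then have "(1 - u)^2 + d^2 > 1" using u(3) zero_le_power2[of u] by linarith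
    ultimately show ?thesis using u d1 True e by (intro exI[of _ u]) auto
  next
    case False
    then have t0: "t > 0" using t by simp
    \<comment> \<open>A step towards 0 increases (1 - t)^2; a point inside the second circle stays there if the step is shorter than h.\<close>
    define h where "h = (if (1 - t)^2 + d^2 < 1 then (1 - (1 - t)^2 - d^2) / 2 else 1)"
    have h: "h > 0" by (simp add: h_def)
    define e where "e = min \<epsilon> (min t h) / 2"
    have e: "0 < e" "e < \<epsilon>" "e < t" "e < h" using \<epsilon> t0 h by (auto simp: e_def min_def)
    have "(t - e)^2 \<le> t^2" by (rule power_mono) (use e in auto)
    then have 1: "(t - e)^2 + d^2 < 1" using reg by linarith
    have eq: "(1 - (t - e))^2 = (1 - t)^2 + e * (2 - 2 * t + e)" by (simp add: power2_eq_square algebra_simps)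
    have "0 < e * (2 - 2 * t + e)" using e t by (intro mult_pos_pos) auto
    moreover have "e * (2 - 2 * t + e) \<le> e * 2" using e t by (intro mult_left_mono) auto
    ultimately have "if (1 - t)^2 + d^2 < 1 then (1 - (t - e))^2 + d^2 < 1 else (1 - (t - e))^2 + d^2 > 1"
      unfolding eq using e(4) unfolding h_def by (simp split: if_splits)
    then show ?thesis using e t 1 by (intro exI[of _ "t - e"]) auto
  qed
  then obtain u where u: "\<bar>u - t\<bar> < \<epsilon>" "0 \<le> u" "u \<le> 1 / 2" "u \<noteq> t" "u^2 + d^2 < 1"
      "if (1 - t)^2 + d^2 < 1 then (1 - u)^2 + d^2 < 1 else (1 - u)^2 + d^2 > 1" by blast
  have "(sin (pi * u))^2 \<noteq> (sin (pi * t))^2"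
    using sin_sq_strict_mono[of u t] sin_sq_strict_mono[of t u] u t by (cases "u < t") auto
  moreover have "card Z' \<le> (if (1 - t)^2 + d^2 < 1 then 2 else 1)" if "finite Z'" "Z' \<subseteq> disc_zeros u d" for Z'
  proof -
    have "(1 - u)^2 + d^2 \<noteq> 1" using u(6) by (auto split: if_splits)
    from disc_zeros_card_le[OF u(2,3) d _ this that] u(5,6) show ?thesis by (auto split: if_splits)
  qed
  ultimately show "\<exists>\<theta>'. \<bar>\<theta>' - t\<bar> < \<epsilon> \<and> (sin (pi * \<theta>'))^2 \<noteq> (sin (pi * t))^2 \<and>
      (\<forall>Z'. finite Z' \<longrightarrow> Z' \<subseteq> disc_zeros \<theta>' d \<longrightarrow> card Z' \<le> (if (1 - t)^2 + d^2 < 1 then 2 else 1))"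
    using u(1) by blast
qed

lemma zero_order_nat_ge_1: "d \<noteq> 0 \<Longrightarrow> z \<in> disc_zeros \<theta> d \<Longrightarrow> nat (zero_order \<theta> d z) \<ge> 1"
  using zero_order_pos[of d z \<theta>] by linarith

lemma disc_zeros_one:
  assumes t: "0 \<le> t" "t \<le> 1 / 2" and d: "d \<noteq> 0" and reg: "t^2 + d^2 < 1" "(1 - t)^2 + d^2 \<ge> 1"
  obtains x where "-1 < x" "x < 0" "disc_zeros t d = {of_real x}" "zero_order t d (of_real x) = 1"
proof -
  obtain x where x: "-1 < x" "x < 0" "of_real x \<in> disc_zeros t d" using disc_zeros_exist_I[OF t d reg] by blast
  have b: "(\<Sum>z\<in>Z. nat (zero_order t d z)) \<le> 1" if "finite Z" "Z \<subseteq> disc_zeros t d" for Z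
    using zero_order_sum_bound[OF t d reg(1) that] reg(2) by simp
  have "z = of_real x" if z: "z \<in> disc_zeros t d" for z
  proof (rule ccontr)
    assume "z \<noteq> of_real x"
    then have "nat (zero_order t d z) + nat (zero_order t d (of_real x)) \<le> 1" using b[of "{z, of_real x}"] z x(3) by simp
    then show False using zero_order_nat_ge_1[OF d z] zero_order_nat_ge_1[OF d x(3)] by linarith
  qed
  then have "disc_zeros t d = {of_real x}" using x(3) by blast
  moreover have "zero_order t d (of_real x) = 1" using b[of "{of_real x}"] x(3) zero_order_pos[OF d x(3)] by simp
  ultimately show thesis using that x by blast
qed

lemma disc_zeros_cnj: "z \<in> disc_zeros \<theta> d \<Longrightarrow> cnj z \<in> disc_zeros \<theta> d"
proof -
  assume z: "z \<in> disc_zeros \<theta> d"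
  then have n: "norm z < 1" and e: "of_real ((sin (pi * \<theta>))^2) + hill_fun d z = 0" by (auto simp: disc_zeros_def)
  have "of_real ((sin (pi * \<theta>))^2) + hill_fun d (cnj z) = cnj (of_real ((sin (pi * \<theta>))^2) + hill_fun d z)"
    by (simp add: hill_fun_cnj[OF n])
  also have "\<dots> = 0" unfolding e by simp
  finally show ?thesis using n by (simp only: disc_zeros_def mem_Collect_eq complex_mod_cnj)
qed

text \<open>
A nonreal zero comes with its conjugate; a real zero is either double or accompanied by a second
real one. Two distinct zeros exhaust the total order 2.
\<close>

lemma disc_zeros_two:
  assumes t: "0 \<le> t" "t \<le> 1 / 2" and d: "d \<noteq> 0" and reg: "t^2 + d^2 < 1" "(1 - t)^2 + d^2 < 1"
  shows "(\<exists>x. -1 < x \<and> x < 0 \<and> disc_zeros t d = {of_real x} \<and> zero_order t d (of_real x) = 2) \<or>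
    (\<exists>x x'. -1 < x \<and> x < 0 \<and> -1 < x' \<and> x' < 0 \<and> x \<noteq> x' \<and> disc_zeros t d = {of_real x, of_real x'} \<and>
       zero_order t d (of_real x) = 1 \<and> zero_order t d (of_real x') = 1) \<or>
    (\<exists>z. norm z < 1 \<and> Im z \<noteq> 0 \<and> disc_zeros t d = {z, cnj z} \<and> zero_order t d z = 1 \<and> zero_order t d (cnj z) = 1)"
proof -
  have b: "(\<Sum>z\<in>Z. nat (zero_order t d z)) \<le> 2" if "finite Z" "Z \<subseteq> disc_zeros t d" for Z
    using zero_order_sum_bound[OF t d reg(1) that] reg(2) by simp
  have two: "disc_zeros t d = {z, w} \<and> zero_order t d z = 1 \<and> zero_order t d w = 1"
    if z: "z \<in> disc_zeros t d" and w: "w \<in> disc_zeros t d" and zw: "z \<noteq> w" for z w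
  proof -
    note ge = zero_order_nat_ge_1[OF d z] zero_order_nat_ge_1[OF d w]
    have "nat (zero_order t d z) + nat (zero_order t d w) \<le> 2" using b[of "{z, w}"] z w zw by simp
    then have "nat (zero_order t d z) = 1" "nat (zero_order t d w) = 1" using ge by linarith+
    moreover have "u = z \<or> u = w" if u: "u \<in> disc_zeros t d" for u
    proof (rule ccontr)
      assume "\<not> (u = z \<or> u = w)"
      then have "nat (zero_order t d u) + (nat (zero_order t d z) + nat (zero_order t d w)) \<le> 2" using b[of "{u, z, w}"] u z w zw by simp
      then show False using zero_order_nat_ge_1[OF d u] ge by linarith
    qed
    ultimately show ?thesis using z w by auto
  qed
  obtain z where z: "z \<in> disc_zeros t d" using disc_zeros_exist_II[OF t d reg] by blast
  show ?thesis
  proof (cases "Im z = 0")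
    case False
    then have "z \<noteq> cnj z" by (simp add: complex_eq_iff)
    from two[OF z disc_zeros_cnj[OF z] this] False z show ?thesis unfolding disc_zeros_def by blast
  next
    case True
    define x where "x = Re z"
    have zx: "z = of_real x" using True by (simp add: x_def complex_eq_iff)
    have "\<bar>x\<bar> < 1" using z unfolding zx disc_zeros_def by simp
    moreover have "x < 0" using disc_zeros_not_nonneg[OF d z] unfolding zx by simp
    ultimately have x: "-1 < x" "x < 0" "of_real x \<in> disc_zeros t d" using z zx by auto
    have "nat (zero_order t d (of_real x)) \<le> 2" using b[of "{of_real x}"] x by simp
    then consider "zero_order t d (of_real x) = 1" | "zero_order t d (of_real x) = 2" using zero_order_pos[OF d x(3)] by linarith
    then show ?thesis
    proof cases
      case 1
      obtain x' where x': "-1 < x'" "x' < 0" "of_real x' \<in> disc_zeros t d" "x' \<noteq> x"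
        using second_real_zero_II[OF t d reg x 1] by blast
      have "complex_of_real x \<noteq> of_real x'" using x'(4) by simp
      from two[OF x(3) x'(3) this] x x' show ?thesis by blast
    next
      case 2
      have "u = of_real x" if u: "u \<in> disc_zeros t d" for u
      proof (rule ccontr)
        assume "u \<noteq> of_real x"
        from two[OF u x(3) this] 2 show False by simp
      qed
      then have "disc_zeros t d = {of_real x}" using x(3) by blast
      then show ?thesis using x 2 by blast
    qed
  qed
qed

section \<open>Eigenvalues in each region\<close>

lemma unstable_iff: "unstable k c \<longleftrightarrow> k * Im c > 0"
  by (simp add: unstable_def)

text \<open>
The reflection c \<mapsto> -c preserves eigenvalues and multiplicities and exchanges stable and
unstable ones, as no eigenvalue is real.
\<close>

lemma half_unstable:
  assumes d: "d \<noteq> 0" and fin: "finite (eigenvalues \<theta> d)" and k: "k \<noteq> 0"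
  shows "2 * num_unstable k \<theta> d = num_eigenvalues \<theta> d"
proof -
  define U where "U = {c \<in> eigenvalues \<theta> d. unstable k c}"
  have sym: "- c \<in> eigenvalues \<theta> d \<and> mult \<theta> d (- c) = mult \<theta> d c" if "c \<in> eigenvalues \<theta> d" for c
    using that s_of_uminus[of c] by (auto simp: eigenvalues_eq[OF d] cut_uminus mult_eq_zero_order[OF d])
  have eq: "eigenvalues \<theta> d = U \<union> uminus ` U"
  proof (intro equalityI subsetI)
    fix c assume c: "c \<in> eigenvalues \<theta> d"
    have "k * Im c \<noteq> 0" using k eigenvalue_nonreal[OF d c] by simp
    then have "k * Im c > 0 \<or> k * Im c < 0" by linarith
    then have "unstable k c \<or> unstable k (- c)" by (auto simp: unstable_iff)
    then have "c \<in> U \<or> - c \<in> U" using c sym by (auto simp: U_def)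
    then show "c \<in> U \<union> uminus ` U" by (metis UnI1 UnI2 add.inverse_inverse imageI)
  qed (use sym in \<open>auto simp: U_def\<close>)
  have dis: "U \<inter> uminus ` U = {}" by (auto simp: U_def unstable_iff)
  have finU: "finite U" using fin by (simp add: U_def)
  have "num_eigenvalues \<theta> d = sum (mult \<theta> d) U + sum (mult \<theta> d) (uminus ` U)"
    unfolding num_eigenvalues_def eq by (rule sum.union_disjoint) (use finU dis in auto)
  also have "sum (mult \<theta> d) (uminus ` U) = sum (\<lambda>c. mult \<theta> d (- c)) U"
    by (subst sum.reindex) (auto simp: inj_on_def)
  also have "\<dots> = sum (mult \<theta> d) U" by (rule sum.cong) (use sym in \<open>auto simp: U_def\<close>)
  finally show ?thesis by (simp add: num_unstable_def U_def)
qed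

lemma imaginary_pair_of_real_zero:
  assumes d: "d \<noteq> 0" and x: "-1 < x" "x < 0" and K: "disc_zeros \<theta> d = {of_real x}" "zero_order \<theta> d (of_real x) = m"
  shows "one_imaginary_pair \<theta> d m" "finite (eigenvalues \<theta> d)" "num_eigenvalues \<theta> d = 2 * m"
proof -
  have "of_real x \<in> disc_zeros \<theta> d" using K by simp
  from disc_zero_preimage[OF d this] obtain c where c: "c \<notin> cut" "Im c > 0" "(s_of c)^2 = of_real x"
    "{c'. c' \<notin> cut \<and> (s_of c')^2 = of_real x} = {c, - c}" "c^2 = (of_real x + 2 + 1 / of_real x) / 4" by blast
  have e: "eigenvalues \<theta> d = {c, - c}" using c(4) by (simp add: eigenvalues_eq[OF d] K)
  have "Re c = 0" by (rule disc_zero_preimage_real[OF x c(2,5)])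
  then have p: "purely_imaginary c" using c(2) by (auto simp: purely_imaginary_def)
  have mc: "mult \<theta> d z = m" if "z \<in> {c, - c}" for z
    using that c(1,3) K(2) s_of_uminus[OF c(1)] by (auto simp: mult_eq_zero_order[OF d] cut_uminus)
  show "one_imaginary_pair \<theta> d m" unfolding one_imaginary_pair_def pair_def using p e mc by blast
  show "finite (eigenvalues \<theta> d)" by (simp add: e)
  have "c \<noteq> - c" using c(2) by (auto simp: complex_eq_iff)
  then show "num_eigenvalues \<theta> d = 2 * m" unfolding num_eigenvalues_def e using mc by simp
qed

lemma imaginary_pairs_of_real_zeros:
  assumes d: "d \<noteq> 0" and x: "-1 < x" "x < 0" "-1 < x'" "x' < 0" "x \<noteq> x'"
    and K: "disc_zeros \<theta> d = {of_real x, of_real x'}" "zero_order \<theta> d (of_real x) = 1" "zero_order \<theta> d (of_real x') = 1"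
  shows "two_imaginary_pairs \<theta> d" "finite (eigenvalues \<theta> d)" "num_eigenvalues \<theta> d = 4"
proof -
  have "of_real x \<in> disc_zeros \<theta> d" "of_real x' \<in> disc_zeros \<theta> d" using K by simp_all
  note z = this
  obtain c where c: "c \<notin> cut" "Im c > 0" "(s_of c)^2 = of_real x"
    "{c'. c' \<notin> cut \<and> (s_of c')^2 = of_real x} = {c, - c}" "c^2 = (of_real x + 2 + 1 / of_real x) / 4"
    using disc_zero_preimage[OF d z(1)] by blast
  obtain c' where c': "c' \<notin> cut" "Im c' > 0" "(s_of c')^2 = of_real x'"
    "{c. c \<notin> cut \<and> (s_of c)^2 = of_real x'} = {c', - c'}" "c'^2 = (of_real x' + 2 + 1 / of_real x') / 4"
    using disc_zero_preimage[OF d z(2)] by blast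
  have "eigenvalues \<theta> d = {c'. c' \<notin> cut \<and> (s_of c')^2 = of_real x} \<union> {c. c \<notin> cut \<and> (s_of c)^2 = of_real x'}"
    by (auto simp: eigenvalues_eq[OF d] K)
  then have e: "eigenvalues \<theta> d = pair c \<union> pair c'" unfolding c(4) c'(4) pair_def .
  have "Re c = 0" "Re c' = 0" by (rule disc_zero_preimage_real[OF x(1,2) c(2,5)], rule disc_zero_preimage_real[OF x(3,4) c'(2,5)])
  then have p: "purely_imaginary c" "purely_imaginary c'" using c(2) c'(2) by (auto simp: purely_imaginary_def)
  have "(s_of c)^2 \<noteq> (s_of c')^2" using x(5) c(3) c'(3) by simp
  then have ne: "c' \<noteq> c" "c' \<noteq> - c" using s_of_sq_eq_iff[OF c(1) c'(1)] by auto
  then have dis: "pair c \<inter> pair c' = {}" by (auto simp: pair_def)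
  have m: "\<forall>z\<in>pair c \<union> pair c'. mult \<theta> d z = 1"
    using c(1,3) c'(1,3) K(2,3) s_of_uminus[OF c(1)] s_of_uminus[OF c'(1)]
    by (auto simp: pair_def mult_eq_zero_order[OF d] cut_uminus)
  show "two_imaginary_pairs \<theta> d" unfolding two_imaginary_pairs_def using p dis e m by blast
  show "finite (eigenvalues \<theta> d)" by (simp add: e pair_def)
  have "c \<noteq> - c" "c' \<noteq> - c'" using c(2) c'(2) by (auto simp: complex_eq_iff)
  then have "card (pair c) = 2" "card (pair c') = 2" by (simp_all add: pair_def)
  then have "card (pair c \<union> pair c') = 4" using dis by (subst card_Un_disjoint) (auto simp: pair_def)
  then show "num_eigenvalues \<theta> d = 4" unfolding num_eigenvalues_def e using m by simp
qed

lemma quadruplet_of_nonreal_zero: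
  assumes d: "d \<noteq> 0" and z: "norm z < 1" "Im z \<noteq> 0"
    and K: "disc_zeros \<theta> d = {z, cnj z}" "zero_order \<theta> d z = 1" "zero_order \<theta> d (cnj z) = 1"
  shows "one_complex_quadruplet \<theta> d" "finite (eigenvalues \<theta> d)" "num_eigenvalues \<theta> d = 4"
proof -
  have "z \<in> disc_zeros \<theta> d" using K by simp
  from disc_zero_preimage[OF d this] obtain c where c: "c \<notin> cut" "Im c > 0" "(s_of c)^2 = z"
    "s_of (cnj c) = cnj (s_of c)" "{c'. c' \<notin> cut \<and> (s_of c')^2 = z} = {c, - c}" "c^2 = (z + 2 + 1 / z) / 4" by blast
  have R: "Re c \<noteq> 0" by (rule disc_zero_preimage_nonreal[OF z c(6)])
  have cc: "cnj c \<notin> cut" using c(2) by (simp add: cut_iff)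
  have sc: "(s_of (cnj c))^2 = cnj z" using c(3,4) by (simp flip: complex_cnj_power)
  have "eigenvalues \<theta> d = {c'. c' \<notin> cut \<and> (s_of c')^2 = z} \<union> {c'. c' \<notin> cut \<and> (s_of c')^2 = cnj z}"
    by (auto simp: eigenvalues_eq[OF d] K)
  also have "{c'. c' \<notin> cut \<and> (s_of c')^2 = cnj z} = {cnj c, - cnj c}"
    using s_of_sq_eq_iff[OF cc] cc by (auto simp: cut_uminus simp flip: sc)
  finally have e: "eigenvalues \<theta> d = quadruplet c" unfolding c(5) quadruplet_def by auto
  have m: "\<forall>w\<in>quadruplet c. mult \<theta> d w = 1"
    using c(1,3) cc sc K(2,3) s_of_uminus[OF c(1)] s_of_uminus[OF cc]
    by (auto simp: quadruplet_def mult_eq_zero_order[OF d] cut_uminus)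
  show "one_complex_quadruplet \<theta> d" unfolding one_complex_quadruplet_def using R c(2) e m by (intro exI[of _ c]) auto
  show "finite (eigenvalues \<theta> d)" by (simp add: e quadruplet_def)
  have "c \<noteq> - c" "c \<noteq> cnj c" "c \<noteq> - cnj c" "- c \<noteq> cnj c" "- c \<noteq> - cnj c" "cnj c \<noteq> - cnj c"
    using c(2) R by (auto simp: complex_eq_iff)
  then have "card (quadruplet c) = 4" by (simp add: quadruplet_def)
  then show "num_eigenvalues \<theta> d = 4" unfolding num_eigenvalues_def e using m by simp
qed

theorem theorem5p10:
  fixes \<theta> d :: real
  assumes "d \<noteq> 0"
  shows "(region_0 \<theta> d \<longrightarrow> eigenvalues \<theta> d = {}) \<and>
    (region_I \<theta> d \<longrightarrow> one_imaginary_pair \<theta> d 1) \<and>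
    (region_II \<theta> d \<longrightarrow>
       finite (eigenvalues \<theta> d) \<and> num_eigenvalues \<theta> d = 4 \<and>
       (two_imaginary_pairs \<theta> d \<or> one_imaginary_pair \<theta> d 2 \<or> one_complex_quadruplet \<theta> d)) \<and>
    (boundary_I_II \<theta> d \<longrightarrow> one_imaginary_pair \<theta> d 1) \<and>
    (region_0 \<theta> d \<or> region_I \<theta> d \<or> region_II \<theta> d \<or> boundary_I_II \<theta> d \<longrightarrow>
       (\<forall>k::real. k \<noteq> 0 \<longrightarrow> 2 * num_unstable k \<theta> d = num_eigenvalues \<theta> d))"
proof -
  obtain t where t: "0 \<le> t" "t \<le> 1 / 2" "(sin (pi * t))^2 = (sin (pi * \<theta>))^2"
    and reg0: "region_0 \<theta> d \<Longrightarrow> t^2 + d^2 > 1"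
    and reg1: "region_I \<theta> d \<or> boundary_I_II \<theta> d \<Longrightarrow> t^2 + d^2 < 1 \<and> (1 - t)^2 + d^2 \<ge> 1"
    and reg2: "region_II \<theta> d \<Longrightarrow> t^2 + d^2 < 1 \<and> (1 - t)^2 + d^2 < 1"
    using regions_reduced[OF assms, of \<theta>] by blast
  have K: "disc_zeros t d = disc_zeros \<theta> d" "zero_order t d = zero_order \<theta> d"
    by (simp_all only: disc_zeros_def zero_order_def[abs_def] t(3))
  have 0: "eigenvalues \<theta> d = {}" if "region_0 \<theta> d"
    using disc_zeros_empty[OF t(1,2) assms reg0[OF that]] by (simp add: eigenvalues_eq[OF assms] K)
  have 1: "one_imaginary_pair \<theta> d 1 \<and> finite (eigenvalues \<theta> d)" if "region_I \<theta> d \<or> boundary_I_II \<theta> d"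
  proof -
    note r = reg1[OF that]
    obtain x where "-1 < x" "x < 0" "disc_zeros \<theta> d = {of_real x}" "zero_order \<theta> d (of_real x) = 1"
      using disc_zeros_one[OF t(1,2) assms r[THEN conjunct1] r[THEN conjunct2]] unfolding K by blast
    from imaginary_pair_of_real_zero[OF assms this] show ?thesis by blast
  qed
  have 2: "finite (eigenvalues \<theta> d) \<and> num_eigenvalues \<theta> d = 4 \<and>
       (two_imaginary_pairs \<theta> d \<or> one_imaginary_pair \<theta> d 2 \<or> one_complex_quadruplet \<theta> d)" if "region_II \<theta> d"
  proof -
    note r = reg2[OF that]
    from disc_zeros_two[OF t(1,2) assms r[THEN conjunct1] r[THEN conjunct2], unfolded K]
    show ?thesis
    proof (elim disjE exE conjE)
      fix x assume "-1 < x" "x < 0" "disc_zeros \<theta> d = {of_real x}" "zero_order \<theta> d (of_real x) = 2"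
      from imaginary_pair_of_real_zero[OF assms this] show ?thesis by simp
    next
      fix x x' assume "-1 < x" "x < 0" "-1 < x'" "x' < 0" "x \<noteq> x'" "disc_zeros \<theta> d = {of_real x, of_real x'}"
        "zero_order \<theta> d (of_real x) = 1" "zero_order \<theta> d (of_real x') = 1"
      from imaginary_pairs_of_real_zeros[OF assms this] show ?thesis by simp
    next
      fix z assume "norm z < 1" "Im z \<noteq> 0" "disc_zeros \<theta> d = {z, cnj z}" "zero_order \<theta> d z = 1" "zero_order \<theta> d (cnj z) = 1"
      from quadruplet_of_nonreal_zero[OF assms this] show ?thesis by simp
    qed
  qed
  have "finite (eigenvalues \<theta> d)" if "region_0 \<theta> d \<or> region_I \<theta> d \<or> region_II \<theta> d \<or> boundary_I_II \<theta> d"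
    using that 0 1 2 by auto
  then show ?thesis using 0 1 2 half_unstable[OF assms] by blast
qed

end
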